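(* The functions $J$, $r$, $\tilde u$, $W$ (defined on $\mathbb{R}^n$) are $PC^1$ and semismooth. Further, for all $\xi\in\mathbb{R}^n$, $$\Theta(\xi)\in\partial^C\tilde u(\xi),\qquad \tfrac1\alpha\nabla^2 g(\tilde u(\xi))\Theta(\xi)-I\in\partial^C r(\xi),$$ $$2(A-\xi)^\top\Theta(\xi)\in\partial^C W(\xi),\qquad \alpha\, r(\xi)^\top\Theta(\xi)\in\partial^C J(\xi).$$
   Context: $|\cdot|$ is the Euclidean norm. $F=\{a_1,\ldots,a_n\}\subset\mathbb{R}^2$ is a finite set of pairwise distinct points; $D\subset\mathbb{R}^2$ is a convex compact polygon with nonempty interior; $u_d$ is a nonnegative Borel measure on $D$, absolutely continuous w.r.t. the Lebesgue measure, with density $\varrho$ continuous on $D$; $\alpha>0$. $\mathcal{M}(F)$ (signed Borel measures on $F$) is identified with $\mathbb{R}^n$ via $v\leftrightarrow\sum_{i=1}^n v_i\delta_{a_i}$. $g\colon\mathcal{M}(F)\cong\mathbb{R}^n\to\mathbb{R}$ is twice continuously differentiable with gradient $\nabla g$ and Hessian $\nabla^2 g$. For $u\in\mathcal{M}(F)$, $W_2^2(u_d,u):=\inf\{\int_{D\times F}|x_1-x_2|^2\,\mathrm{d}\gamma(x_1,x_2)\}$ over all nonnegative Borel measures $\gamma$ on $D\times F$ with marginals $u_d$ and $u$ ($+\infty$ if there are none). For $\xi\in\mathbb{R}^n$: $D_i(\xi):=\{x\in\operatorname{int}(D): a_i^\top x-\xi_i>a_j^\top x-\xi_j\ \forall j\ne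 i\}$; $\tilde u(\xi):=(u_d(D_1(\xi)),\ldots,u_d(D_n(\xi)))^\top$; $W(\xi):=W_2^2(u_d,\tilde u(\xi))$; $J(\xi):=g(\tilde u(\xi))+\frac\alpha2W(\xi)$; $A:=\frac12(|a_1|^2,\ldots,|a_n|^2)^\top$; $r(\xi):=A+\frac1\alpha\nabla g(\tilde u(\xi))-\xi$. The matrix $\Theta(\xi)\in\mathbb{R}^{n\times n}$: regions $D_i(\xi)$ and $D_k(\xi)$, $i\neq k$, are said to share an edge if both are nonempty and $\operatorname{cl}(D_i(\xi))\cap\operatorname{cl}(D_k(\xi))$ is a line segment of positive length. If $u_d(D_i(\xi))>0$, then for $k\ne i$, $\Theta_{ik}(\xi):=\frac{1}{|a_k-a_i|}\int_{\operatorname{cl}(D_i(\xi))\cap\operatorname{cl}(D_k(\xi))}\varrho\,\mathrm{d}\mathcal{H}^1$ if $D_i(\xi)$ and $D_k(\xi)$ share an edge and $\Theta_{ik}(\xi):=0$ otherwise, and $\Theta_{ii}(\xi):=-\sum_{k\ne i}\Theta_{ik}(\xi)$. If $u_d(D_i(\xi))=0$, then $\Theta_{ij}(\xi):=0$ for all $j$. Here $\mathcal{H}^1$ is the one-dimensional Hausdorff measure. A continuous $f\colon\mathbb{R}^n\to\mathbb{R}^m$ is $PC^1$ if every $x_0\in\mathbb{R}^n$ has a neighborhood $U$ and finitely many $C^1$ functions $f^1,\ldots,f^M\colon U\to\mathbb{R}^m$ with $f(x)\in\{f^1(x),\ldots,f^M(x)\}$ for all $x\in U$. For $f$ Lipschitz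 near $x$, $\partial^C f(x)\subset\mathbb{R}^{m\times n}$ is the convex hull of all limits of $f'(x_k)$ with $x_k\to x$, $f$ differentiable at $x_k$ (Clarke's generalized Jacobian). $f$ is semismooth if for every $x$: $f$ is Lipschitz continuous near $x$, the directional derivative $f'(x;\cdot)$ exists, and $\sup_{M\in\partial^C f(x+s)}|f(x+s)-f(x)-Ms|=o(|s|)$ as $s\to0$. *)

theory Defs
  imports "HOL-Analysis.Analysis"
begin

section \<open>Nonsmooth analysis\<close>

text \<open>Everything is stated for functions from \<open>real^'n\<close> to \<open>real^'m\<close>. A real-valued function is
  treated as a function into \<open>real^1\<close>, so that its generalized Jacobian consists of row
  matrices \<open>real^'n^1\<close>.\<close>

definition scalar_fun :: "(real^'n \<Rightarrow> real) \<Rightarrow> real^'n \<Rightarrow> real^1" where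
  "scalar_fun f = (\<lambda>x. vec (f x))"

definition C1_on :: "(real^'n) set \<Rightarrow> (real^'n \<Rightarrow> real^'m) \<Rightarrow> bool" where
  "C1_on U h \<longleftrightarrow>
     (\<exists>h' :: real^'n \<Rightarrow> real^'n^'m.
        (\<forall>x\<in>U. (h has_derivative (\<lambda>s. h' x *v s)) (at x)) \<and> continuous_on U h')"

definition PC1 :: "(real^'n \<Rightarrow> real^'m) \<Rightarrow> bool" where
  "PC1 f \<longleftrightarrow> continuous_on UNIV f \<and>
     (\<forall>x0. \<exists>U H. open U \<and> x0 \<in> U \<and> finite H \<and> (\<forall>h\<in>H. C1_on U h) \<and>
        (\<forall>x\<in>U. f x \<in> (\<lambda>h. h x) ` H))"

definition lipschitz_near :: "(real^'n \<Rightarrow> real^'m) \<Rightarrow> real^'n \<Rightarrow> bool" where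
  "lipschitz_near f x \<longleftrightarrow> (\<exists>e>0. \<exists>L. L-lipschitz_on (ball x e) f)"

definition clarke_jacobian :: "(real^'n \<Rightarrow> real^'m) \<Rightarrow> real^'n \<Rightarrow> (real^'n^'m) set" where
  "clarke_jacobian f x = convex hull
     {M. \<exists>X Ms. X \<longlonglongrightarrow> x \<and>
           (\<forall>k :: nat. (f has_derivative (\<lambda>s. Ms k *v s)) (at (X k))) \<and> Ms \<longlonglongrightarrow> M}"

definition directionally_differentiable_at :: "(real^'n \<Rightarrow> real^'m) \<Rightarrow> real^'n \<Rightarrow> bool" where
  "directionally_differentiable_at f x \<longleftrightarrow>
     (\<forall>s. \<exists>l. ((\<lambda>t. (f (x + t *\<^sub>R s) - f x) /\<^sub>R t) \<longlongrightarrow> l) (at_right 0))"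

text \<open>The bound \<open>o(|s|)\<close> on the supremum over the generalized Jacobian is written out as a bound
  that is uniform over its elements.\<close>

definition semismooth :: "(real^'n \<Rightarrow> real^'m) \<Rightarrow> bool" where
  "semismooth f \<longleftrightarrow> (\<forall>x. lipschitz_near f x \<and> directionally_differentiable_at f x \<and>
     (\<forall>e>0. \<exists>d>0. \<forall>s. norm s < d \<longrightarrow>
        (\<forall>M \<in> clarke_jacobian f (x + s). norm (f (x + s) - f x - M *v s) \<le> e * norm s)))"


section \<open>One-dimensional Hausdorff measure\<close>

text \<open>Boundedness is required explicitly because \<^const>\<open>diameter\<close> is unspecified on unbounded
  sets. The constant is normalized so that the measure of a segment is its length.\<close>

definition hausdorff1_pre :: "real \<Rightarrow> 'a::metric_space set \<Rightarrow> ennreal" where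
  "hausdorff1_pre \<delta> E =
     (INF C \<in> {C :: nat \<Rightarrow> 'a set. E \<subseteq> (\<Union>i. C i) \<and> (\<forall>i. bounded (C i) \<and> diameter (C i) \<le> \<delta>)}.
        \<Sum>i. ennreal (diameter (C i)))"

definition hausdorff1_outer :: "'a::metric_space set \<Rightarrow> ennreal" where
  "hausdorff1_outer E = (SUP \<delta> \<in> {0<..}. hausdorff1_pre \<delta> E)"

text \<open>\<^const>\<open>hausdorff1_outer\<close> is a metric outer measure, hence countably additive on the Borel
  sets; so \<open>measure_of\<close> below does not fall back to the zero measure.\<close>

definition hausdorff1 :: "'a::metric_space measure" where
  "hausdorff1 = measure_of UNIV (sets borel) hausdorff1_outer"


section \<open>Semidiscrete optimal transport\<close>

text \<open>The points are given by a family \<open>a\<close> with finite index type, \<open>F = range a\<close>, and \<open>v\<close> stands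
  for the signed measure \<open>\<Sum>i. v $ i * \<delta>(a i)\<close> on \<open>F\<close>. All subsets of the finite set \<open>F\<close> are
  Borel. The second marginal condition is stated in \<^typ>\<open>ereal\<close> so that a \<open>v\<close> with a negative
  entry has no couplings.\<close>

definition couplings ::
  "(real^2) set \<Rightarrow> (real^2) measure \<Rightarrow> ('n::finite \<Rightarrow> real^2) \<Rightarrow> real^'n
     \<Rightarrow> ((real^2) \<times> (real^2)) measure set" where
  "couplings D \<mu> a v =
     {\<gamma>. sets \<gamma> = sets (restrict_space borel (D \<times> range a)) \<and>
         (\<forall>B \<in> sets (restrict_space borel D). emeasure \<gamma> (B \<times> range a) = emeasure \<mu> B) \<and>
         (\<forall>B \<subseteq> range a. enn2ereal (emeasure \<gamma> (D \<times> B)) = ereal (\<Sum>i | a i \<in> B. v $ i))}"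

definition wasserstein2_sq ::
  "(real^2) set \<Rightarrow> (real^2) measure \<Rightarrow> ('n::finite \<Rightarrow> real^2) \<Rightarrow> real^'n \<Rightarrow> ennreal" where
  "wasserstein2_sq D \<mu> a v =
     (INF \<gamma> \<in> couplings D \<mu> a v. \<integral>\<^sup>+ z. ennreal ((norm (fst z - snd z))\<^sup>2) \<partial>\<gamma>)"

definition cell :: "(real^2) set \<Rightarrow> ('n::finite \<Rightarrow> real^2) \<Rightarrow> real^'n \<Rightarrow> 'n \<Rightarrow> (real^2) set" where
  "cell D a \<xi> i = {x \<in> interior D. \<forall>j. j \<noteq> i \<longrightarrow> a i \<bullet> x - \<xi> $ i > a j \<bullet> x - \<xi> $ j}"

definition u_tilde ::
  "(real^2) set \<Rightarrow> (real^2) measure \<Rightarrow> ('n::finite \<Rightarrow> real^2) \<Rightarrow> real^'n \<Rightarrow> real^'n" where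
  "u_tilde D \<mu> a \<xi> = (\<chi> i. measure \<mu> (cell D a \<xi> i))"

definition W_fun ::
  "(real^2) set \<Rightarrow> (real^2) measure \<Rightarrow> ('n::finite \<Rightarrow> real^2) \<Rightarrow> real^'n \<Rightarrow> real" where
  "W_fun D \<mu> a \<xi> = enn2real (wasserstein2_sq D \<mu> a (u_tilde D \<mu> a \<xi>))"

definition J_fun ::
  "(real^2) set \<Rightarrow> (real^2) measure \<Rightarrow> ('n::finite \<Rightarrow> real^2) \<Rightarrow> real \<Rightarrow> (real^'n \<Rightarrow> real)
     \<Rightarrow> real^'n \<Rightarrow> real" where
  "J_fun D \<mu> a \<alpha> g \<xi> = g (u_tilde D \<mu> a \<xi>) + \<alpha> / 2 * W_fun D \<mu> a \<xi>"

definition A_vec :: "('n::finite \<Rightarrow> real^2) \<Rightarrow> real^'n" where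
  "A_vec a = (\<chi> i. 1 / 2 * (norm (a i))\<^sup>2)"

definition r_fun ::
  "(real^2) set \<Rightarrow> (real^2) measure \<Rightarrow> ('n::finite \<Rightarrow> real^2) \<Rightarrow> real \<Rightarrow> (real^'n \<Rightarrow> real^'n)
     \<Rightarrow> real^'n \<Rightarrow> real^'n" where
  "r_fun D \<mu> a \<alpha> grad_g \<xi> = A_vec a + (1 / \<alpha>) *\<^sub>R grad_g (u_tilde D \<mu> a \<xi>) - \<xi>"

definition cell_edge ::
  "(real^2) set \<Rightarrow> ('n::finite \<Rightarrow> real^2) \<Rightarrow> real^'n \<Rightarrow> 'n \<Rightarrow> 'n \<Rightarrow> (real^2) set" where
  "cell_edge D a \<xi> i k = closure (cell D a \<xi> i) \<inter> closure (cell D a \<xi> k)"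

definition share_edge ::
  "(real^2) set \<Rightarrow> ('n::finite \<Rightarrow> real^2) \<Rightarrow> real^'n \<Rightarrow> 'n \<Rightarrow> 'n \<Rightarrow> bool" where
  "share_edge D a \<xi> i k \<longleftrightarrow> cell D a \<xi> i \<noteq> {} \<and> cell D a \<xi> k \<noteq> {} \<and>
     (\<exists>p q. p \<noteq> q \<and> cell_edge D a \<xi> i k = closed_segment p q)"

definition Theta_offdiag ::
  "(real^2) set \<Rightarrow> (real^2 \<Rightarrow> real) \<Rightarrow> ('n::finite \<Rightarrow> real^2) \<Rightarrow> real^'n \<Rightarrow> 'n \<Rightarrow> 'n \<Rightarrow> real" where
  "Theta_offdiag D \<rho> a \<xi> i k =
     (if share_edge D a \<xi> i k
      then 1 / norm (a k - a i) * (LINT x:cell_edge D a \<xi> i k|hausdorff1. \<rho> x) else 0)"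

definition Theta ::
  "(real^2) set \<Rightarrow> (real^2) measure \<Rightarrow> (real^2 \<Rightarrow> real) \<Rightarrow> ('n::finite \<Rightarrow> real^2) \<Rightarrow> real^'n
     \<Rightarrow> real^'n^'n" where
  "Theta D \<mu> \<rho> a \<xi> = (\<chi> i k.
     if measure \<mu> (cell D a \<xi> i) > 0 then
       (if k \<noteq> i then Theta_offdiag D \<rho> a \<xi> i k
        else - (\<Sum>l | l \<noteq> i. Theta_offdiag D \<rho> a \<xi> i l))
     else 0)"

end

theory Submission
  imports Defs
begin

text \<open>
  The vector \<xi> enters the cell masses only through the positions of the lines that bound the cells.
  In coordinates in which none of these lines is vertical, the mass of a cell is the integral over \<open>s\<close>
  of the mass of its vertical slice at \<open>s\<close>, and this slice runs from the highest of the lower lines to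
  the lowest of the upper lines. Sorting the values \<open>s\<close> by the line that bounds the slice, the mass becomes
  a signed sum over the lines; the term of a line integrates a primitive of the density along the line over
  the interval of those \<open>s\<close> for which the line carries an edge. The ends of this interval are crossings with
  other lines, hence belong to a finite list of affine functions of \<xi>. So every mass agrees at each \<xi> with
  one member of a finite family of functions that are continuously differentiable on all of \<open>\<real>\<^sup>n\<close>
  (\<open>mass_C1_selection\<close>), whatever the combinatorial type of the partition is.

  Such selections are closed under sums, products and composition with continuously differentiable maps.
  Kantorovich duality (\<open>wasserstein2_sq_eq\<close>) gives
  \<open>W \<xi> = const - 2 * phi \<xi> + 2 * ((A - \<xi>) \<bullet> u \<xi>)\<close>, where \<open>phi\<close> integrates the maximum of the functions
  \<open>a i \<bullet> x - \<xi> $ i\<close>; it is convex, and since \<open>- u\<close> is a continuous selection of its subgradients, it is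
  continuously differentiable with gradient \<open>- u\<close>. Hence \<open>u\<close>, \<open>r\<close>, \<open>W\<close> and \<open>J\<close> are all piecewise
  continuously differentiable, and such functions are semismooth (\<open>PC1_imp_semismooth\<close>): where one of them
  is differentiable, its derivative is that of an active selection function, so every element of the
  generalized Jacobian is a convex combination of derivatives of active selection functions.

  For the generalized Jacobians, the point \<xi> itself may be bad, because a cell may be squeezed to a segment.
  Raising \<open>\<xi> $ k\<close> by \<open>\<epsilon>\<close> for all \<open>k\<close> with empty cell leaves the partition unchanged but keeps the empty
  cells empty under small perturbations. At the new point no two lines that carry edges of a nonempty cell
  coincide, and differentiation under the integral sign shows that \<open>u\<close> is differentiable there with
  derivative \<open>\<Theta> \<xi>\<close> (\<open>u_tilde_has_derivative\<close>). The chain rule gives the derivatives of the other functions,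
  and \<open>\<epsilon> \<rightarrow> 0\<close> proves the claim. The edge integrals first appear as integrals over the parameter \<open>s\<close>; to
  read them as integrals with respect to the one-dimensional Hausdorff measure one needs that the latter is
  additive on Borel sets and equals length on segments (\<open>hausdorff1_segment_integral\<close>).
\<close>

section \<open>Piecewise continuously differentiable functions are semismooth\<close>
lemma norm_matrix_vector_mult_le: "norm (A *v x) \<le> norm A * norm x" for A :: "real^'n^'m"
proof -
  have "norm (A *v x) = L2_set (\<lambda>i. norm (A $ i \<bullet> x)) UNIV"
    by (simp add: norm_vec_def matrix_vector_mul_component)
  also have "\<dots> \<le> L2_set (\<lambda>i. norm (A $ i) * norm x) UNIV"
    by (intro L2_set_mono) (auto simp: Cauchy_Schwarz_ineq2)
  also have "\<dots> = norm A * norm x"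
    by (simp add: norm_vec_def L2_set_left_distrib)
  finally show ?thesis .
qed

lemma C1_on_subset: "C1_on U h \<Longrightarrow> V \<subseteq> U \<Longrightarrow> C1_on V h"
  unfolding C1_on_def by (meson continuous_on_subset subsetD)

lemma directional_quotient_tendsto:
  assumes "(f has_derivative F) (at y)"
  shows "((\<lambda>t. (f (y + t *\<^sub>R d) - f y) /\<^sub>R t) \<longlongrightarrow> F d) (at_right 0)"
proof -
  have "((\<lambda>t. f (y + t *\<^sub>R d)) has_derivative (\<lambda>t. F (t *\<^sub>R d))) (at 0)"
    by (rule has_derivative_compose[of "\<lambda>t. y + t *\<^sub>R d" "\<lambda>t. t *\<^sub>R d" 0 UNIV f F])
       (auto intro!: derivative_eq_intros assms)
  moreover have "F (t *\<^sub>R d) = t *\<^sub>R F d" for t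
    using assms has_derivative_bounded_linear linear_simps(5) by blast
  ultimately have "((\<lambda>t. f (y + t *\<^sub>R d)) has_vector_derivative F d) (at 0)"
    by (simp add: has_vector_derivative_def)
  then have "((\<lambda>t. (f (y + t *\<^sub>R d) - (f y + t *\<^sub>R F d)) /\<^sub>R norm t) \<longlongrightarrow> 0) (at 0)"
    by (simp add: has_vector_derivative_def has_derivative_at2 divide_inverse_commute)
  then have "((\<lambda>t. norm ((f (y + t *\<^sub>R d) - (f y + t *\<^sub>R F d)) /\<^sub>R norm t)) \<longlongrightarrow> 0) (at 0)"
    by (rule tendsto_norm_zero)
  moreover have "\<forall>\<^sub>F t in at 0. norm ((f (y + t *\<^sub>R d) - (f y + t *\<^sub>R F d)) /\<^sub>R norm t)
      = norm ((f (y + t *\<^sub>R d) - f y) /\<^sub>R t - F d)"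
  proof (unfold eventually_at_filter, intro always_eventually allI impI)
    fix t :: real assume "t \<noteq> 0"
    then have "(f (y + t *\<^sub>R d) - f y) /\<^sub>R t - F d = (f (y + t *\<^sub>R d) - (f y + t *\<^sub>R F d)) /\<^sub>R t"
      by (simp add: algebra_simps)
    then show "norm ((f (y + t *\<^sub>R d) - (f y + t *\<^sub>R F d)) /\<^sub>R norm t)
      = norm ((f (y + t *\<^sub>R d) - f y) /\<^sub>R t - F d)" by simp
  qed
  ultimately have "((\<lambda>t. norm ((f (y + t *\<^sub>R d) - f y) /\<^sub>R t - F d)) \<longlongrightarrow> 0) (at 0)"
    by (rule Lim_transform_eventually)
  then have "((\<lambda>t. (f (y + t *\<^sub>R d) - f y) /\<^sub>R t) \<longlongrightarrow> F d) (at 0)"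
    by (rule LIM_zero_cancel[OF tendsto_norm_zero_cancel])
  then show ?thesis
    by (simp add: filterlim_at_split)
qed

text \<open>Selection functions that do not take the value of \<open>f\<close> at \<open>x\<close> are inactive near \<open>x\<close> by continuity and
  can be dropped.\<close>
lemma PC1_active:
  assumes "PC1 f"
  obtains r H where "r > 0" "finite H" "\<And>h. h \<in> H \<Longrightarrow> C1_on (ball x r) h"
    "\<And>h. h \<in> H \<Longrightarrow> h x = f x" "\<And>y. y \<in> ball x r \<Longrightarrow> \<exists>h\<in>H. f y = h y"
proof -
  have cf: "continuous_on UNIV f" using assms by (simp add: PC1_def)
  obtain U H where U: "open U" "x \<in> U" "finite H" "\<And>h. h \<in> H \<Longrightarrow> C1_on U h"
    "\<And>y. y \<in> U \<Longrightarrow> f y \<in> (\<lambda>h. h y) ` H"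
    using assms unfolding PC1_def by metis
  have "\<forall>\<^sub>F y in nhds x. h y \<noteq> f y" if "h \<in> {h \<in> H. h x \<noteq> f x}" for h
  proof -
    have "C1_on U h" using that U(4) by simp
    then obtain h' where "(h has_derivative h') (at x)" using U(2) by (auto simp: C1_on_def)
    then have "isCont h x" by (rule has_derivative_continuous)
    moreover have "isCont f x" using cf by (simp add: continuous_on_eq_continuous_at)
    ultimately have "isCont (\<lambda>y. h y - f y) x" by simp
    moreover have "h x - f x \<noteq> 0" using that by simp
    ultimately have "\<forall>\<^sub>F y in nhds x. h y - f y \<noteq> 0"
      using continuous_at_avoid[of x "\<lambda>y. h y - f y" 0]
      by (auto simp: eventually_nhds_metric dist_commute)
    then show ?thesis by simp
  qed
  then have "\<forall>\<^sub>F y in nhds x. \<forall>h\<in>{h \<in> H. h x \<noteq> f x}. h y \<noteq> f y"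
    using U(3) by (intro eventually_ball_finite) auto
  moreover have "\<forall>\<^sub>F y in nhds x. y \<in> U" using U by (simp add: eventually_nhds_in_open)
  ultimately have "\<forall>\<^sub>F y in nhds x. y \<in> U \<and> (\<forall>h\<in>{h \<in> H. h x \<noteq> f x}. h y \<noteq> f y)"
    by eventually_elim auto
  then obtain r where r: "r > 0"
      "\<And>y. y \<in> ball x r \<Longrightarrow> y \<in> U \<and> (\<forall>h\<in>{h \<in> H. h x \<noteq> f x}. h y \<noteq> f y)"
    by (auto simp: eventually_nhds_metric dist_commute)
  show thesis
  proof (rule that[of r "{h \<in> H. h x = f x}"])
    fix y assume "y \<in> ball x r"
    then show "\<exists>h\<in>{h \<in> H. h x = f x}. f y = h y" using r(2)[of y] U(5)[of y] by fastforce
  next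
    fix h assume "h \<in> {h \<in> H. h x = f x}"
    then have "C1_on U h" using U(4) by simp
    then show "C1_on (ball x r) h" by (rule C1_on_subset) (use r(2)[THEN conjunct1] in blast)
  next
    show "finite {h \<in> H. h x = f x}" using U(3) by simp
  qed (use r(1) in auto)
qed

text \<open>Proper subspaces are null sets, and finitely many null sets do not cover the space.\<close>
lemma subspace_cover_finite:
  fixes S :: "'i \<Rightarrow> 'a::euclidean_space set"
  assumes "finite I" "\<And>i. i \<in> I \<Longrightarrow> subspace (S i)" "(\<Union>i\<in>I. S i) = UNIV"
  shows "\<exists>i\<in>I. S i = UNIV"
proof (rule ccontr)
  assume *: "\<not> ?thesis"
  have "negligible (S i)" if "i \<in> I" for i
  proof (rule negligible_lowdim)
    have "span (S i) \<noteq> UNIV" using * that assms(2)[OF that] by (metis span_eq_iff)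
    then have "dim (S i) \<noteq> DIM('a)" by (simp add: dim_eq_full)
    then show "dim (S i) < DIM('a)" using dim_subset_UNIV[of "S i"] by linarith
  qed
  then have "negligible (\<Union>i\<in>I. S i)" using assms(1) by (intro negligible_Union) auto
  then show False using assms(3) by simp
qed

text \<open>Along every ray some selection function agrees with \<open>f\<close> at points arbitrarily close to \<open>y\<close>, so its
  directional derivative is that of \<open>f\<close>. The directions served by one selection function form a subspace;
  finitely many subspaces cover all directions, so one of them is everything.\<close>
lemma finite_selection_derivative:
  fixes f :: "'a::euclidean_space \<Rightarrow> 'b::real_normed_vector"
  assumes "finite H" and h': "\<And>h. h \<in> H \<Longrightarrow> (h has_derivative h' h) (at y)"
    and F: "(f has_derivative F) (at y)"
    and sel: "\<forall>\<^sub>F z in nhds y. \<exists>h\<in>H. f z = h z"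
  shows "\<exists>h\<in>H. h y = f y \<and> F = h' h"
proof -
  have "\<exists>h\<in>H. h y = f y \<and> F d = h' h d" for d
  proof -
    define G :: "real filter" where "G = at_right 0"
    have lim: "((\<lambda>t. y + t *\<^sub>R d) \<longlongrightarrow> y) G"
      unfolding G_def by (auto intro!: tendsto_eq_intros)
    have evG: "\<forall>\<^sub>F t in G. \<exists>h\<in>H. f (y + t *\<^sub>R d) = h (y + t *\<^sub>R d)"
      using eventually_compose_filterlim[OF sel lim] .
    have "\<not> (\<forall>\<^sub>F t in G. \<forall>h\<in>H. f (y + t *\<^sub>R d) \<noteq> h (y + t *\<^sub>R d))"
    proof
      assume "\<forall>\<^sub>F t in G. \<forall>h\<in>H. f (y + t *\<^sub>R d) \<noteq> h (y + t *\<^sub>R d)"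
      with evG have "\<forall>\<^sub>F t in G. False" by eventually_elim auto
      then show False by (simp add: G_def)
    qed
    then obtain h where h: "h \<in> H" "\<not> (\<forall>\<^sub>F t in G. f (y + t *\<^sub>R d) \<noteq> h (y + t *\<^sub>R d))"
      using eventually_ball_finite[OF \<open>finite H\<close>, of "\<lambda>t h. f (y + t *\<^sub>R d) \<noteq> h (y + t *\<^sub>R d)" G] by blast
    (* G' restricts the limit t -> 0 to those t at which h is active; it is proper since they accumulate at 0. *)
    define G' where "G' = inf G (principal {t. f (y + t *\<^sub>R d) = h (y + t *\<^sub>R d)})"
    have G': "G' \<noteq> bot" "G' \<le> G" and ev: "\<forall>\<^sub>F t in G'. f (y + t *\<^sub>R d) = h (y + t *\<^sub>R d)"
      using h(2) by (auto simp: G'_def trivial_limit_def eventually_inf_principal)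
    have fl: "((\<lambda>t. f (y + t *\<^sub>R d)) \<longlongrightarrow> f y) G'"
      by (rule isCont_tendsto_compose[OF has_derivative_continuous[OF F] tendsto_mono[OF G'(2) lim]])
    have hl: "((\<lambda>t. h (y + t *\<^sub>R d)) \<longlongrightarrow> h y) G'"
      by (rule isCont_tendsto_compose[OF has_derivative_continuous[OF h'[OF h(1)]] tendsto_mono[OF G'(2) lim]])
    have eq: "h y = f y"
      using tendsto_unique[OF G'(1) hl Lim_transform_eventually[OF fl ev]] .
    have "((\<lambda>t. (h (y + t *\<^sub>R d) - h y) /\<^sub>R t) \<longlongrightarrow> h' h d) G'"
      using tendsto_mono[OF G'(2)[unfolded G_def] directional_quotient_tendsto[OF h'[OF h(1)]]] .
    moreover have "\<forall>\<^sub>F t in G'. (h (y + t *\<^sub>R d) - h y) /\<^sub>R t = (f (y + t *\<^sub>R d) - f y) /\<^sub>R t"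
      using ev by eventually_elim (simp add: eq)
    ultimately have "((\<lambda>t. (f (y + t *\<^sub>R d) - f y) /\<^sub>R t) \<longlongrightarrow> h' h d) G'"
      by (rule Lim_transform_eventually)
    moreover have "((\<lambda>t. (f (y + t *\<^sub>R d) - f y) /\<^sub>R t) \<longlongrightarrow> F d) G'"
      using tendsto_mono[OF G'(2)[unfolded G_def] directional_quotient_tendsto[OF F]] .
    ultimately have "F d = h' h d" by (metis tendsto_unique[OF G'(1)])
    then show ?thesis using h(1) eq by blast
  qed
  then have "(\<Union>h\<in>{h\<in>H. h y = f y}. {d. F d = h' h d}) = UNIV" by blast
  moreover have "subspace {d. F d = h' h d}" if "h \<in> {h\<in>H. h y = f y}" for h
  proof -
    have "linear F" using F has_derivative_linear by blast
    moreover have "linear (h' h)" using h' that has_derivative_linear by blast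
    ultimately show ?thesis
      by (auto simp: subspace_def linear_0 linear_add linear_scale)
  qed
  ultimately obtain h where "h \<in> H" "h y = f y" "{d. F d = h' h d} = UNIV"
    using subspace_cover_finite[of "{h\<in>H. h y = f y}" "\<lambda>h. {d. F d = h' h d}"] \<open>finite H\<close> by auto
  then show ?thesis by blast
qed

lemma C1_on_cball_lipschitz:
  assumes "C1_on (ball x r) h" "e < r"
  shows "\<exists>L\<ge>0. L-lipschitz_on (cball x e) h"
proof -
  obtain h' where h': "\<And>y. y \<in> ball x r \<Longrightarrow> (h has_derivative (\<lambda>s. h' y *v s)) (at y)"
    "continuous_on (ball x r) h'" using assms(1) unfolding C1_on_def by blast
  have sub: "cball x e \<subseteq> ball x r" using assms(2) by auto
  have "bounded (h' ` cball x e)"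
    using compact_continuous_image[OF continuous_on_subset[OF h'(2) sub] compact_cball]
    by (rule compact_imp_bounded)
  then obtain B where "\<forall>z\<in>h' ` cball x e. norm z \<le> B" "B > 0"
    unfolding bounded_pos by blast
  then have B: "\<And>y. y \<in> cball x e \<Longrightarrow> norm (h' y) \<le> B" "B > 0" by blast+
  have "B-lipschitz_on (cball x e) h"
  proof (rule bounded_derivative_imp_lipschitz)
    fix y assume y: "y \<in> cball x e"
    show "(h has_derivative (\<lambda>s. h' y *v s)) (at y within cball x e)"
      by (rule has_derivative_at_withinI[OF h'(1)[OF subsetD[OF sub y]]])
    have "norm (h' y *v s) \<le> B * norm s" for s
      using norm_matrix_vector_mult_le[of "h' y" s] mult_right_mono[OF B(1)[OF y], of "norm s"]
      by simp
    then show "onorm (\<lambda>s. h' y *v s) \<le> B" by (rule onorm_le)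
  qed (use B in auto)
  then show ?thesis using B(2) by (intro exI[of _ B]) simp
qed

text \<open>On a segment, the parameters at which a given selection function is active form a closed set on
  which \<open>f\<close> is Lipschitz; finitely many such sets cover the segment.\<close>
lemma selection_lipschitz:
  fixes f :: "'a::euclidean_space \<Rightarrow> 'b::euclidean_space"
  assumes "finite H" and L: "\<And>h. h \<in> H \<Longrightarrow> L-lipschitz_on S h" and "L \<ge> 0" and "convex S"
    and f: "continuous_on S f" and sel: "\<And>y. y \<in> S \<Longrightarrow> \<exists>h\<in>H. f y = h y"
  shows "L-lipschitz_on S f"
proof (rule lipschitz_onI)
  fix y z assume yz: "y \<in> S" "z \<in> S"
  define c where "c t = y + t *\<^sub>R (z - y)" for t :: real
  have c: "c t \<in> S" if "t \<in> {0..1}" for t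
    using convexD_alt[OF \<open>convex S\<close> yz, of t] that by (simp add: c_def algebra_simps)
  have cc: "continuous_on {0..1} c" unfolding c_def by (intro continuous_intros)
  have clip: "dist (c s) (c t) = dist s t * dist y z" for s t
    by (simp add: c_def dist_norm norm_minus_commute flip: scaleR_left_diff_distrib)
  define U where "U h = {t \<in> {0..1}. f (c t) - h (c t) = 0}" for h
  have "(L * dist y z)-lipschitz_on {0..1} (f \<circ> c)"
  proof (rule lipschitz_on_closed_Union[where I = H and U = U])
    fix h assume h: "h \<in> H"
    have "continuous_on {0..1} (\<lambda>t. f (c t) - h (c t))"
      using c by (intro continuous_intros continuous_on_compose2[OF f cc]
          continuous_on_compose2[OF lipschitz_on_continuous_on[OF L[OF h]] cc]) (use c in auto)
    then show "closed (U h)" unfolding U_def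
      by (rule continuous_closed_preimage_constant) auto
    show "(L * dist y z)-lipschitz_on (U h) (f \<circ> c)"
    proof (rule lipschitz_onI)
      fix s t assume "s \<in> U h" "t \<in> U h"
      then show "dist ((f \<circ> c) s) ((f \<circ> c) t) \<le> L * dist y z * dist s t"
        using lipschitz_onD[OF L[OF h] c c, of s t] by (simp add: U_def clip mult_ac)
    qed (use \<open>L \<ge> 0\<close> in auto)
  next
    show "{0..1} \<subseteq> (\<Union>h\<in>H. U h)" using sel c by (fastforce simp: U_def)
  qed (use assms in auto)
  from lipschitz_onD[OF this, of 0 1] show "dist (f y) (f z) \<le> L * dist y z"
    by (simp add: c_def)
qed fact

lemma PC1_lipschitz_near:
  assumes "PC1 f" shows "lipschitz_near f x"
proof -
  obtain r H where rH: "r > 0" "finite H" "\<And>h. h \<in> H \<Longrightarrow> C1_on (ball x r) h"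
    "\<And>y. y \<in> ball x r \<Longrightarrow> \<exists>h\<in>H. f y = h y" using PC1_active[OF assms] by metis
  have "\<exists>L\<ge>0. L-lipschitz_on (cball x (r/2)) h" if "h \<in> H" for h
    using C1_on_cball_lipschitz[OF rH(3)[OF that]] rH(1) by simp
  then obtain L where L: "\<And>h. h \<in> H \<Longrightarrow> 0 \<le> L h \<and> (L h)-lipschitz_on (cball x (r/2)) h" by metis
  have "(\<Sum>h\<in>H. L h)-lipschitz_on (cball x (r/2)) f"
  proof (rule selection_lipschitz[OF rH(2)])
    fix h assume h: "h \<in> H"
    then have "L h \<le> (\<Sum>h\<in>H. L h)" using L rH(2) by (intro member_le_sum) auto
    then show "(\<Sum>h\<in>H. L h)-lipschitz_on (cball x (r/2)) h"
      using L[OF h] by (auto intro: lipschitz_on_le)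
  next
    show "continuous_on (cball x (r/2)) f" using assms by (auto simp: PC1_def intro: continuous_on_subset)
    fix y assume "y \<in> cball x (r/2)" then show "\<exists>h\<in>H. f y = h y" using rH(1) by (intro rH(4)) auto
  qed (use L in \<open>auto intro: sum_nonneg\<close>)
  then have "(\<Sum>h\<in>H. L h)-lipschitz_on (ball x (r/2)) f"
    by (rule lipschitz_on_subset) auto
  then show ?thesis unfolding lipschitz_near_def using rH(1)
    by (intro exI[of _ "r/2"] conjI exI[of _ "\<Sum>h\<in>H. L h"]) auto
qed

lemma finite_separated:
  fixes Q :: "'a::metric_space set"
  assumes "finite Q"
  obtains e where "e > 0" "\<And>a b. a \<in> Q \<Longrightarrow> b \<in> Q \<Longrightarrow> dist a b < e \<Longrightarrow> a = b"
proof -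
  have "\<exists>e>0. \<forall>b\<in>Q. b \<noteq> a \<longrightarrow> e \<le> dist a b" for a
    using finite_set_avoid[OF assms, of a] by (metis dist_commute)
  then obtain d where d: "\<And>a. d a > 0" "\<And>a b. b \<in> Q \<Longrightarrow> b \<noteq> a \<Longrightarrow> d a \<le> dist a b" by metis
  define e where "e = Min (insert 1 (d ` Q))"
  have "e > 0" using assms d(1) by (auto simp: e_def)
  moreover have "a = b" if "a \<in> Q" "b \<in> Q" "dist a b < e" for a b
  proof (rule ccontr)
    assume "a \<noteq> b"
    then have "d a \<le> dist a b" using d(2) that(2) by metis
    moreover have "e \<le> d a" using assms that(1) by (simp add: e_def)
    ultimately show False using that(3) by linarith
  qed
  ultimately show thesis using that by blast
qed

text \<open>Close to \<open>0\<close> the function \<open>\<phi>\<close> only takes values near the finitely many limits \<open>l i\<close>. By connectedness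
  of its image it stays near a single one.\<close>
lemma finite_selection_tendsto:
  fixes \<phi> :: "real \<Rightarrow> 'b::metric_space"
  assumes "finite I" "\<delta> > 0" and cont: "continuous_on {0<..<\<delta>} \<phi>"
    and lim: "\<And>i. i \<in> I \<Longrightarrow> ((\<lambda>t. \<psi> i t) \<longlongrightarrow> l i) (at_right 0)"
    and sel: "\<And>t. t \<in> {0<..<\<delta>} \<Longrightarrow> \<exists>i\<in>I. \<phi> t = \<psi> i t"
  shows "\<exists>q. (\<phi> \<longlongrightarrow> q) (at_right 0)"
proof -
  obtain \<eta> where \<eta>: "\<eta> > 0" "\<And>a b. a \<in> l ` I \<Longrightarrow> b \<in> l ` I \<Longrightarrow> dist a b < \<eta> \<Longrightarrow> a = b"
    using finite_separated[of "l ` I"] \<open>finite I\<close> by blast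
  have near: "\<forall>\<^sub>F t in at_right 0. t \<in> {0<..<\<delta>} \<and> (\<exists>a\<in>l ` I. dist (\<phi> t) a < e)" if "e > 0" for e
  proof -
    have "\<forall>\<^sub>F t in at_right 0. \<forall>i\<in>I. dist (\<psi> i t) (l i) < e"
      using \<open>finite I\<close> tendstoD[OF lim \<open>e > 0\<close>] by (intro eventually_ball_finite) auto
    moreover have "\<forall>\<^sub>F t in at_right 0. t \<in> {0<..<\<delta>}"
      using \<open>\<delta> > 0\<close> eventually_at_right_real by blast
    ultimately show ?thesis
    proof eventually_elim
      case (elim t)
      then obtain i where "i \<in> I" "\<phi> t = \<psi> i t" using sel by blast
      then show ?case using elim by auto
    qed
  qed
  from near[of "\<eta>/2"] \<eta>(1) obtain b where b: "b > 0"
      "\<And>t. t \<in> {0<..<b} \<Longrightarrow> t \<in> {0<..<\<delta>} \<and> (\<exists>a\<in>l ` I. dist (\<phi> t) a < \<eta>/2)"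
    by (auto simp: eventually_at_right_field)
  then have "b/2 \<in> {0<..<b}" by simp
  from b(2)[OF this] obtain q where q: "q \<in> l ` I" "dist (\<phi> (b/2)) q < \<eta>/2" by blast
  have close: "dist (\<phi> t) q < \<eta>/2" if tb: "t \<in> {0<..<b}" for t
  proof (rule ccontr)
    assume t: "\<not> ?thesis"
    have c1: "connected (\<phi> ` {0<..<b})"
      using b(2) by (intro connected_continuous_image continuous_on_subset[OF cont]) auto
    have c2: "open (\<Union>a\<in>l ` I - {q}. ball a (\<eta>/2))" "open (ball q (\<eta>/2))" by auto
    have c3: "\<phi> ` {0<..<b} \<subseteq> ball q (\<eta>/2) \<union> (\<Union>a\<in>l ` I - {q}. ball a (\<eta>/2))"
      using b(2) by (fastforce simp: dist_commute)
    have c4: "ball q (\<eta>/2) \<inter> (\<Union>a\<in>l ` I - {q}. ball a (\<eta>/2)) \<inter> \<phi> ` {0<..<b} = {}"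
    proof -
      have "ball q (\<eta>/2) \<inter> ball a (\<eta>/2) = {}" if "a \<in> l ` I" "a \<noteq> q" for a
        using \<eta>(2)[OF q(1) that(1)] that(2) by (intro disjoint_ballI) force
      then show ?thesis by blast
    qed
    have c5: "ball q (\<eta>/2) \<inter> \<phi> ` {0<..<b} \<noteq> {}"
      using q(2) b(1) by (force simp: dist_commute)
    have c6: "(\<Union>a\<in>l ` I - {q}. ball a (\<eta>/2)) \<inter> \<phi> ` {0<..<b} \<noteq> {}"
    proof -
      obtain a where "a \<in> l ` I" "dist (\<phi> t) a < \<eta>/2" using b(2)[OF tb] by blast
      moreover from this t have "a \<noteq> q" by blast
      ultimately have "\<phi> t \<in> (\<Union>a\<in>l ` I - {q}. ball a (\<eta>/2))" by (auto simp: dist_commute)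
      then show ?thesis using tb by blast
    qed
    show False using connectedD[OF c1 c2(2) c2(1) c4 c3] c5 c6 by simp
  qed
  have "(\<phi> \<longlongrightarrow> q) (at_right 0)"
  proof (rule tendstoI)
    fix e :: real assume "e > 0"
    have "\<forall>\<^sub>F t in at_right 0. t \<in> {0<..<b}" using b(1) eventually_at_right_real by blast
    with near[of "min e (\<eta>/2)"] have "\<forall>\<^sub>F t in at_right 0. t \<in> {0<..<b} \<and> (\<exists>a\<in>l ` I. dist (\<phi> t) a < min e (\<eta>/2))"
      using \<open>e > 0\<close> \<eta>(1) by (auto elim: eventually_elim2)
    then show "\<forall>\<^sub>F t in at_right 0. dist (\<phi> t) q < e"
    proof eventually_elim
      case (elim t)
      then obtain a where a: "a \<in> l ` I" "dist (\<phi> t) a < min e (\<eta>/2)" by blast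
      have "dist a q \<le> dist (\<phi> t) a + dist (\<phi> t) q" by (rule dist_triangle3)
      also have "\<dots> < \<eta>" using a(2) close[of t] elim by simp
      finally have "a = q" using \<eta>(2) a(1) q(1) by blast
      then show ?case using a(2) by simp
    qed
  qed
  then show ?thesis ..
qed

lemma PC1_directionally_differentiable:
  fixes f :: "real^'n \<Rightarrow> real^'m"
  assumes "PC1 f" shows "directionally_differentiable_at f x"
  unfolding directionally_differentiable_at_def
proof
  fix s :: "real^'n"
  obtain r H where rH: "r > 0" "finite H" "\<And>h. h \<in> H \<Longrightarrow> C1_on (ball x r) h"
    "\<And>h. h \<in> H \<Longrightarrow> h x = f x" "\<And>y. y \<in> ball x r \<Longrightarrow> \<exists>h\<in>H. f y = h y"
    using PC1_active[OF assms] by metis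
  have "\<exists>F. (h has_derivative F) (at x)" if "h \<in> H" for h
    using rH(3)[OF that] rH(1) by (auto simp: C1_on_def)
  then obtain F where F: "\<And>h. h \<in> H \<Longrightarrow> (h has_derivative F h) (at x)" by metis
  define \<delta> where "\<delta> = r / (norm s + 1)"
  have \<delta>: "\<delta> > 0" using rH(1) by (simp add: \<delta>_def add_nonneg_pos)
  have inb: "x + t *\<^sub>R s \<in> ball x r" if "t \<in> {0<..<\<delta>}" for t
  proof -
    have "t * norm s \<le> t * (norm s + 1)" using that by (intro mult_left_mono) auto
    also have "\<dots> < \<delta> * (norm s + 1)" using that by (intro mult_strict_right_mono) (auto simp: add_nonneg_pos)
    also have "\<dots> = r" by (simp add: \<delta>_def add_nonneg_eq_0_iff)
    finally show ?thesis using that by (simp add: dist_norm)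
  qed
  show "\<exists>l. ((\<lambda>t. (f (x + t *\<^sub>R s) - f x) /\<^sub>R t) \<longlongrightarrow> l) (at_right 0)"
  proof (rule finite_selection_tendsto[where \<psi> = "\<lambda>h t. (h (x + t *\<^sub>R s) - h x) /\<^sub>R t" and I = H and \<delta> = \<delta>])
    show "continuous_on {0<..<\<delta>} (\<lambda>t. (f (x + t *\<^sub>R s) - f x) /\<^sub>R t)"
      using assms by (auto simp: PC1_def intro!: continuous_intros continuous_on_compose2[of UNIV f])
    fix h assume "h \<in> H"
    then show "((\<lambda>t. (h (x + t *\<^sub>R s) - h x) /\<^sub>R t) \<longlongrightarrow> F h s) (at_right 0)"
      using directional_quotient_tendsto[OF F] by blast
  next
    fix t assume "t \<in> {0<..<\<delta>}"
    then obtain h where "h \<in> H" "f (x + t *\<^sub>R s) = h (x + t *\<^sub>R s)" using rH(5) inb by blast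
    then show "\<exists>h\<in>H. (f (x + t *\<^sub>R s) - f x) /\<^sub>R t = (h (x + t *\<^sub>R s) - h x) /\<^sub>R t"
      using rH(4) by force
  qed (use rH \<delta> in auto)
qed

text \<open>Along a sequence of points of differentiability one selection function provides the derivative
  infinitely often; by continuity it is still active, with the limit as its derivative, at \<open>z\<close>.\<close>
lemma clarke_jacobian_selection:
  assumes "finite H" and f: "isCont f z" and U: "open U" "z \<in> U"
    and h': "\<And>h y. h \<in> H \<Longrightarrow> y \<in> U \<Longrightarrow> (h has_derivative (\<lambda>s. h' h y *v s)) (at y)"
    and h'_cont: "\<And>h. h \<in> H \<Longrightarrow> continuous_on U (h' h)"
    and sel: "\<And>y. y \<in> U \<Longrightarrow> \<exists>h\<in>H. f y = h y"
  shows "clarke_jacobian f z \<subseteq> convex hull {h' h z |h. h \<in> H \<and> h z = f z}"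
  unfolding clarke_jacobian_def
proof (rule hull_mono, safe)
  fix M X Ms
  assume X: "X \<longlonglongrightarrow> z" and Ms: "\<forall>k. (f has_derivative (\<lambda>s. Ms k *v s)) (at (X k))" "Ms \<longlonglongrightarrow> M"
  have XU: "\<forall>\<^sub>F k in sequentially. X k \<in> U" using topological_tendstoD[OF X U] .
  have ev: "\<forall>\<^sub>F k in sequentially. \<exists>h\<in>H. h (X k) = f (X k) \<and> Ms k = h' h (X k)"
    using XU
  proof eventually_elim
    case (elim k)
    have "\<exists>h\<in>H. h (X k) = f (X k) \<and> (\<lambda>s. Ms k *v s) = (\<lambda>s. h' h (X k) *v s)"
    proof (rule finite_selection_derivative[OF \<open>finite H\<close>])
      show "\<forall>\<^sub>F z in nhds (X k). \<exists>h\<in>H. f z = h z"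
        using eventually_nhds_in_open[OF U(1) elim] by eventually_elim (rule sel)
    qed (use h' elim Ms in auto)
    then show ?case by (metis matrix_eq)
  qed
  have "\<not> (\<forall>\<^sub>F k in sequentially. \<forall>h\<in>H. \<not> (h (X k) = f (X k) \<and> Ms k = h' h (X k)))"
  proof
    assume "\<forall>\<^sub>F k in sequentially. \<forall>h\<in>H. \<not> (h (X k) = f (X k) \<and> Ms k = h' h (X k))"
    with ev have "\<forall>\<^sub>F k in sequentially. False" by eventually_elim blast
    then show False by simp
  qed
  then obtain h where h: "h \<in> H" "\<not> (\<forall>\<^sub>F k in sequentially. \<not> (h (X k) = f (X k) \<and> Ms k = h' h (X k)))"
    using eventually_ball_finite[OF \<open>finite H\<close>, of "\<lambda>k h. \<not> (h (X k) = f (X k) \<and> Ms k = h' h (X k))" sequentially] by blast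
  define G where "G = inf sequentially (principal {k. h (X k) = f (X k) \<and> Ms k = h' h (X k)})"
  have G: "G \<noteq> bot" "G \<le> sequentially"
    and evG: "\<forall>\<^sub>F k in G. h (X k) = f (X k)" "\<forall>\<^sub>F k in G. h' h (X k) = Ms k"
    using h(2) by (auto simp: G_def trivial_limit_def eventually_inf_principal)
  have XG: "(X \<longlongrightarrow> z) G" by (rule tendsto_mono[OF G(2) X])
  have "((\<lambda>k. h (X k)) \<longlongrightarrow> h z) G"
    by (rule isCont_tendsto_compose[OF has_derivative_continuous[OF h'[OF h(1) U(2)]] XG])
  then have "((\<lambda>k. f (X k)) \<longlongrightarrow> h z) G"
    using evG(1) by (rule Lim_transform_eventually)
  then have eq: "h z = f z"
    using isCont_tendsto_compose[OF f XG] G(1) by (metis tendsto_unique)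
  have "isCont (h' h) z" using h'_cont[OF h(1)] U by (simp add: continuous_on_eq_continuous_at)
  then have "((\<lambda>k. h' h (X k)) \<longlongrightarrow> h' h z) G" using XG by (rule isCont_tendsto_compose)
  then have "(Ms \<longlongrightarrow> h' h z) G" using evG(2) by (rule Lim_transform_eventually)
  then have "M = h' h z" using tendsto_mono[OF G(2) Ms(2)] G(1) by (metis tendsto_unique)
  then show "\<exists>h. M = h' h z \<and> h \<in> H \<and> h z = f z" using h(1) eq by blast
qed

text \<open>The derivative may be taken at the far end of the increment because it is continuous.\<close>
lemma C1_derivative_at_nearby_point:
  fixes h :: "real^'n \<Rightarrow> real^'m"
  assumes r: "r > 0" and h': "\<And>y. y \<in> ball x r \<Longrightarrow> (h has_derivative (\<lambda>s. h' y *v s)) (at y)"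
    and h'_cont: "continuous_on (ball x r) h'" and "e > 0"
  shows "\<exists>d>0. \<forall>s. norm s < d \<longrightarrow> norm (h (x + s) - h x - h' (x + s) *v s) \<le> e * norm s"
proof -
  have "x \<in> ball x r" using r by simp
  from h'[OF this] obtain d1 where d1: "d1 > 0"
      "\<And>y. norm (y - x) < d1 \<Longrightarrow> norm (h y - h x - h' x *v (y - x)) \<le> e/2 * norm (y - x)"
    unfolding has_derivative_at_alt using \<open>e > 0\<close> half_gt_zero by metis
  have "isCont h' x" using h'_cont r by (simp add: continuous_on_eq_continuous_at)
  then obtain d2 where d2: "d2 > 0" "\<And>y. dist y x < d2 \<Longrightarrow> dist (h' y) (h' x) < e/2"
    using \<open>e > 0\<close> half_gt_zero unfolding continuous_at_eps_delta by metis
  have "norm (h (x + s) - h x - h' (x + s) *v s) \<le> e * norm s" if s: "norm s < min d1 d2" for s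
  proof -
    have "h (x + s) - h x - h' (x + s) *v s = (h (x + s) - h x - h' x *v s) - (h' (x + s) - h' x) *v s"
      using matrix_vector_mult_diff_rdistrib[of "h' (x + s)" "h' x" s] by simp
    also have "norm \<dots> \<le> norm (h (x + s) - h x - h' x *v s) + norm ((h' (x + s) - h' x) *v s)"
      by (rule norm_triangle_ineq4)
    also have "norm (h (x + s) - h x - h' x *v s) \<le> e/2 * norm s" using d1(2)[of "x + s"] s by simp
    also have "norm ((h' (x + s) - h' x) *v s) \<le> norm (h' (x + s) - h' x) * norm s"
      by (rule norm_matrix_vector_mult_le)
    also have "\<dots> \<le> e/2 * norm s"
      using d2(2)[of "x + s"] s by (intro mult_right_mono) (auto simp: dist_norm)
    finally show ?thesis by simp
  qed
  then show ?thesis using d1(1) d2(1) by (intro exI[of _ "min d1 d2"]) auto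
qed

text \<open>For each of the finitely many selection functions active at \<open>x\<close>, the increment is approximated by the
  derivative at \<open>x + s\<close> up to \<open>e * norm s\<close>. This bound is a convex condition on the derivative, so it passes
  to the convex hull and hence to the generalized Jacobian.\<close>
theorem PC1_imp_semismooth:
  fixes f :: "real^'n \<Rightarrow> real^'m"
  assumes "PC1 f" shows "semismooth f"
  unfolding semismooth_def
proof (intro allI conjI impI)
  fix x and e :: real assume "e > 0"
  obtain r H where rH: "r > 0" "finite H" "\<And>h. h \<in> H \<Longrightarrow> C1_on (ball x r) h"
    "\<And>h. h \<in> H \<Longrightarrow> h x = f x" "\<And>y. y \<in> ball x r \<Longrightarrow> \<exists>h\<in>H. f y = h y"
    using PC1_active[OF assms] by metis
  from rH(3) obtain h' where h': "\<And>h y. h \<in> H \<Longrightarrow> y \<in> ball x r \<Longrightarrow> (h has_derivative (\<lambda>s. h' h y *v s)) (at y)"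
    "\<And>h. h \<in> H \<Longrightarrow> continuous_on (ball x r) (h' h)" unfolding C1_on_def by metis
  have "\<exists>d>0. \<forall>s. norm s < d \<longrightarrow> norm (h (x + s) - h x - h' h (x + s) *v s) \<le> e * norm s" if "h \<in> H" for h
    using C1_derivative_at_nearby_point[OF rH(1) h'(1)[OF that] h'(2)[OF that] \<open>e > 0\<close>] .
  then obtain d where d: "\<And>h. h \<in> H \<Longrightarrow> d h > 0"
    "\<And>h s. h \<in> H \<Longrightarrow> norm s < d h \<Longrightarrow> norm (h (x + s) - h x - h' h (x + s) *v s) \<le> e * norm s" by metis
  define \<delta> where "\<delta> = Min (insert r (d ` H))"
  have \<delta>: "\<delta> > 0" "\<delta> \<le> r" "\<And>h. h \<in> H \<Longrightarrow> \<delta> \<le> d h" using rH(1,2) d(1) by (auto simp: \<delta>_def)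
  have "norm (f (x + s) - f x - M *v s) \<le> e * norm s"
    if s: "norm s < \<delta>" and M: "M \<in> clarke_jacobian f (x + s)" for s M
  proof -
    define C where "C = {M. norm (f (x + s) - f x - M *v s) \<le> e * norm s}"
    have "linear (\<lambda>M :: real^'n^'m. M *v s)"
      by (rule linearI) (simp_all add: matrix_vector_mult_add_rdistrib scaleR_matrix_vector_assoc)
    then have "convex ((\<lambda>M. M *v s) -` cball (f (x + s) - f x) (e * norm s))"
      by (rule convex_linear_vimage) simp
    also have "(\<lambda>M. M *v s) -` cball (f (x + s) - f x) (e * norm s) = C"
      by (auto simp: C_def dist_norm)
    finally have "convex C" .
    moreover have "{h' h (x + s) |h. h \<in> H \<and> h (x + s) = f (x + s)} \<subseteq> C"
    proof safe
      fix h assume h: "h \<in> H" "h (x + s) = f (x + s)"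
      then show "h' h (x + s) \<in> C" using d(2)[of h s] s \<delta>(3)[OF h(1)] rH(4)[OF h(1)] by (simp add: C_def)
    qed
    ultimately have "convex hull {h' h (x + s) |h. h \<in> H \<and> h (x + s) = f (x + s)} \<subseteq> C"
      by (simp add: hull_minimal)
    moreover have "clarke_jacobian f (x + s) \<subseteq> convex hull {h' h (x + s) |h. h \<in> H \<and> h (x + s) = f (x + s)}"
      using assms s \<delta>(2)
      by (intro clarke_jacobian_selection[OF rH(2), of _ _ "ball x r"] h' rH(5))
         (auto simp: PC1_def continuous_on_eq_continuous_at dist_norm)
    ultimately show ?thesis using M by (auto simp: C_def)
  qed
  then show "\<exists>d>0. \<forall>s. norm s < d \<longrightarrow> (\<forall>M\<in>clarke_jacobian f (x + s). norm (f (x + s) - f x - M *v s) \<le> e * norm s)"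
    using \<delta>(1) by blast
qed (use assms PC1_lipschitz_near PC1_directionally_differentiable in blast)+

section \<open>Finite selections of continuously differentiable functions\<close>
definition C1_real :: "(real^'n \<Rightarrow> real) \<Rightarrow> bool" where
  "C1_real h \<longleftrightarrow> (\<exists>G. (\<forall>x. (h has_derivative (\<lambda>s. G x \<bullet> s)) (at x)) \<and> continuous_on UNIV G)"

lemma C1_realI:
  assumes "\<And>x. (h has_derivative (\<lambda>s. G x \<bullet> s)) (at x)" "continuous_on UNIV G"
  shows "C1_real h"
  using assms unfolding C1_real_def by blast

lemma C1_realE:
  assumes "C1_real h"
  obtains G where "\<And>x. (h has_derivative (\<lambda>s. G x \<bullet> s)) (at x)" "continuous_on UNIV G"
  using assms unfolding C1_real_def by blast

lemma C1_real_continuous: "C1_real h \<Longrightarrow> continuous_on UNIV h"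
  by (auto elim!: C1_realE simp: continuous_on_eq_continuous_at intro: has_derivative_continuous)

lemma C1_real_const: "C1_real (\<lambda>x. c)"
  by (rule C1_realI[where G = "\<lambda>x. 0"]) auto

lemma C1_real_inner: "C1_real (\<lambda>x. c \<bullet> x)"
  by (rule C1_realI[where G = "\<lambda>x. c"]) (auto intro!: derivative_eq_intros)

lemma C1_real_nth: "C1_real (\<lambda>x. x $ i)"
  using C1_real_inner[of "axis i 1"] by (simp add: inner_axis' )

lemma C1_real_add: "C1_real f \<Longrightarrow> C1_real g \<Longrightarrow> C1_real (\<lambda>x. f x + g x)"
proof (elim C1_realE)
  fix F G assume "\<And>x. (f has_derivative (\<lambda>s. F x \<bullet> s)) (at x)" "continuous_on UNIV F"
    "\<And>x. (g has_derivative (\<lambda>s. G x \<bullet> s)) (at x)" "continuous_on UNIV G"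
  then show ?thesis
    by (intro C1_realI[where G = "\<lambda>x. F x + G x"])
       (auto intro!: has_derivative_add continuous_intros simp: inner_add_left)
qed

lemma C1_real_mult: "C1_real f \<Longrightarrow> C1_real g \<Longrightarrow> C1_real (\<lambda>x. f x * g x)"
proof -
  assume fg: "C1_real f" "C1_real g"
  obtain F where F: "\<And>x. (f has_derivative (\<lambda>s. F x \<bullet> s)) (at x)" "continuous_on UNIV F"
    using fg(1) unfolding C1_real_def by blast
  obtain G where G: "\<And>x. (g has_derivative (\<lambda>s. G x \<bullet> s)) (at x)" "continuous_on UNIV G"
    using fg(2) unfolding C1_real_def by blast
  show ?thesis
  proof (rule C1_realI)
    show "((\<lambda>x. f x * g x) has_derivative (\<lambda>s. (f x *\<^sub>R G x + g x *\<^sub>R F x) \<bullet> s)) (at x)" for x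
      using has_derivative_mult[OF F(1)[of x] G(1)[of x]] by (simp add: inner_add_left mult_ac)
    show "continuous_on UNIV (\<lambda>x. f x *\<^sub>R G x + g x *\<^sub>R F x)"
      by (intro continuous_intros F G C1_real_continuous fg)
  qed
qed

lemma C1_real_diff: "C1_real f \<Longrightarrow> C1_real g \<Longrightarrow> C1_real (\<lambda>x. f x - g x)"
  using C1_real_add[OF _ C1_real_mult[OF C1_real_const[of "-1"]], of f g] by simp

lemma C1_real_divide_const: "C1_real f \<Longrightarrow> C1_real (\<lambda>x. f x / c)"
  using C1_real_mult[OF C1_real_const[of "1/c"], of f] by simp

lemma has_derivative_vec_lambda:
  fixes f :: "'m::finite \<Rightarrow> 'a::real_normed_vector \<Rightarrow> real"
  assumes "\<And>i. (f i has_derivative f' i) F"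
  shows "((\<lambda>x. \<chi> i. f i x) has_derivative (\<lambda>s. \<chi> i. f' i s)) F"
proof -
  have eq: "(\<chi> i. c i) = (\<Sum>i\<in>UNIV. c i *\<^sub>R axis i 1)" for c :: "'m \<Rightarrow> real"
    by (simp add: vec_eq_iff axis_def if_distrib cong: if_cong)
  show ?thesis unfolding eq
    by (intro has_derivative_sum has_derivative_scaleR_left assms)
qed

lemma C1_real_compose_vec:
  assumes K: "\<And>i. C1_real (K i)"
    and g: "\<And>v. (g has_derivative (\<lambda>s. G v \<bullet> s)) (at v)" "continuous_on UNIV G"
  shows "C1_real (\<lambda>x. g (\<chi> i. K i x))"
proof -
  from K obtain \<Gamma> where \<Gamma>: "\<And>i x. (K i has_derivative (\<lambda>s. \<Gamma> i x \<bullet> s)) (at x)"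
      "\<And>i. continuous_on UNIV (\<Gamma> i)" unfolding C1_real_def by metis
  have dv: "((\<lambda>x. \<chi> i. K i x) has_derivative (\<lambda>s. \<chi> i. \<Gamma> i x \<bullet> s)) (at x)" for x
    by (rule has_derivative_vec_lambda) (rule \<Gamma>)
  show ?thesis
  proof (rule C1_realI)
    fix x
    have "((\<lambda>x. g (\<chi> i. K i x)) has_derivative (\<lambda>s. G (\<chi> i. K i x) \<bullet> (\<chi> i. \<Gamma> i x \<bullet> s))) (at x)"
      using has_derivative_compose[OF dv g(1)] .
    also have "(\<lambda>s. G (\<chi> i. K i x) \<bullet> (\<chi> i. \<Gamma> i x \<bullet> s)) = (\<lambda>s. (\<Sum>i\<in>UNIV. G (\<chi> i. K i x) $ i *\<^sub>R \<Gamma> i x) \<bullet> s)"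
      by (auto simp: inner_vec_def[of "G _"] inner_sum_left)
    finally show "((\<lambda>x. g (\<chi> i. K i x)) has_derivative (\<lambda>s. (\<Sum>i\<in>UNIV. G (\<chi> i. K i x) $ i *\<^sub>R \<Gamma> i x) \<bullet> s)) (at x)" .
  next
    have "continuous_on UNIV (\<lambda>x. G (\<chi> i. K i x))"
      by (rule continuous_on_compose2[OF g(2)])
         (auto intro!: continuous_on_vec_lambda C1_real_continuous K)
    then show "continuous_on UNIV (\<lambda>x. \<Sum>i\<in>UNIV. G (\<chi> i. K i x) $ i *\<^sub>R \<Gamma> i x)"
      by (intro continuous_intros \<Gamma>)
  qed
qed

text \<open>The functions of this class may be discontinuous, which makes it closed under case distinctions into
  finitely many members; continuity is established separately.\<close>
definition C1_selection :: "(real^'n \<Rightarrow> real) \<Rightarrow> bool" where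
  "C1_selection f \<longleftrightarrow> (\<exists>H. finite H \<and> (\<forall>h\<in>H. C1_real h) \<and> (\<forall>x. \<exists>h\<in>H. f x = h x))"

lemma C1_real_imp_selection: "C1_real f \<Longrightarrow> C1_selection f"
  unfolding C1_selection_def by (intro exI[of _ "{f}"]) auto

lemma C1_selection_of_selections:
  assumes "finite K" "\<And>k. k \<in> K \<Longrightarrow> C1_selection k" "\<And>x. \<exists>k\<in>K. f x = k x"
  shows "C1_selection f"
proof -
  from assms(2) obtain H where H: "\<And>k. k \<in> K \<Longrightarrow> finite (H k)" "\<And>k h. k \<in> K \<Longrightarrow> h \<in> H k \<Longrightarrow> C1_real h"
    "\<And>k x. k \<in> K \<Longrightarrow> \<exists>h\<in>H k. k x = h x" unfolding C1_selection_def by metis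
  have "\<exists>h\<in>(\<Union>k\<in>K. H k). f x = h x" for x
    using assms(3)[of x] H(3) by (metis UN_I)
  then show ?thesis unfolding C1_selection_def using assms(1) H(1,2)
    by (intro exI[of _ "\<Union>k\<in>K. H k"]) auto
qed

lemma C1_selection_binary:
  fixes f g :: "real^'n \<Rightarrow> real"
  assumes "C1_selection f" "C1_selection g"
    and op: "\<And>h k :: real^'n \<Rightarrow> real. C1_real h \<Longrightarrow> C1_real k \<Longrightarrow> C1_real (\<lambda>x. op (h x) (k x))"
  shows "C1_selection (\<lambda>x. op (f x) (g x))"
proof -
  obtain H where H: "finite H" "\<And>h. h \<in> H \<Longrightarrow> C1_real h" "\<And>x. \<exists>h\<in>H. f x = h x"
    using assms(1) unfolding C1_selection_def by blast
  obtain K where K: "finite K" "\<And>h. h \<in> K \<Longrightarrow> C1_real h" "\<And>x. \<exists>h\<in>K. g x = h x"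
    using assms(2) unfolding C1_selection_def by blast
  show ?thesis
  proof (rule C1_selection_of_selections)
    show "finite ((\<lambda>(h, k) x. op (h x) (k x)) ` (H \<times> K))" using H K by simp
    show "C1_selection k" if "k \<in> (\<lambda>(h, k) x. op (h x) (k x)) ` (H \<times> K)" for k
    proof -
      from that obtain h h' where "h \<in> H" "h' \<in> K" "k = (\<lambda>x. op (h x) (h' x))" by auto
      then show ?thesis using C1_real_imp_selection[OF op[OF H(2) K(2)]] by simp
    qed
    show "\<exists>k\<in>(\<lambda>(h, k) x. op (h x) (k x)) ` (H \<times> K). op (f x) (g x) = k x" for x
      using H(3)[of x] K(3)[of x] by force
  qed
qed

lemmas C1_selection_add = C1_selection_binary[where op = "(+)", OF _ _ C1_real_add]
lemmas C1_selection_diff = C1_selection_binary[where op = "(-)", OF _ _ C1_real_diff]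
lemmas C1_selection_mult = C1_selection_binary[where op = "(*)", OF _ _ C1_real_mult]

lemma C1_selection_sum: "(\<And>i. i \<in> I \<Longrightarrow> C1_selection (f i)) \<Longrightarrow> C1_selection (\<lambda>x. \<Sum>i\<in>I. f i x)"
  by (induction I rule: infinite_finite_induct)
     (auto intro: C1_selection_add C1_real_imp_selection C1_real_const)

lemma C1_selection_components:
  fixes f :: "real^'n \<Rightarrow> real^'m"
  assumes "\<And>i. C1_selection (\<lambda>x. f x $ i)"
  obtains H :: "('m \<Rightarrow> real^'n \<Rightarrow> real) set" where
    "finite H" "\<And>K i. K \<in> H \<Longrightarrow> C1_real (K i)" "\<And>x. \<exists>K\<in>H. f x = (\<chi> i. K i x)"
proof -
  from assms have "\<forall>i. \<exists>H. finite H \<and> (\<forall>h\<in>H. C1_real h) \<and> (\<forall>x. \<exists>h\<in>H. f x $ i = h x)"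
    unfolding C1_selection_def by blast
  then obtain H where H: "\<And>i. finite (H i)" "\<And>i h. h \<in> H i \<Longrightarrow> C1_real h" "\<And>i x. \<exists>h\<in>H i. f x $ i = h x"
    by metis
  show thesis
  proof (rule that[of "PiE UNIV H"])
    show "finite (PiE UNIV H)" using H(1) by (intro finite_PiE) auto
    show "C1_real (K i)" if "K \<in> PiE UNIV H" for K i using that H(2) by blast
    fix x
    have "\<forall>i. \<exists>h\<in>H i. f x $ i = h x" using H(3) by blast
    then obtain K where "\<And>i. K i \<in> H i \<and> f x $ i = K i x" by metis
    then show "\<exists>K\<in>PiE UNIV H. f x = (\<chi> i. K i x)" by (intro bexI[of _ K]) (auto simp: vec_eq_iff)
  qed
qed

lemma C1_selection_compose:
  fixes f :: "real^'n \<Rightarrow> real^'m"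
  assumes f: "\<And>i. C1_selection (\<lambda>x. f x $ i)"
    and g: "\<And>v. (g has_derivative (\<lambda>s. G v \<bullet> s)) (at v)" "continuous_on UNIV G"
  shows "C1_selection (\<lambda>x. g (f x))"
proof -
  obtain H where H: "finite H" "\<And>K i. K \<in> H \<Longrightarrow> C1_real (K i)" "\<And>x. \<exists>K\<in>H. f x = (\<chi> i. K i x)"
    using C1_selection_components[OF f] by blast
  show ?thesis
  proof (rule C1_selection_of_selections)
    show "finite ((\<lambda>K x. g (\<chi> i. K i x)) ` H)" using H(1) by simp
    show "C1_selection k" if "k \<in> (\<lambda>K x. g (\<chi> i. K i x)) ` H" for k
    proof -
      from that obtain K where "K \<in> H" "k = (\<lambda>x. g (\<chi> i. K i x))" by blast
      then show ?thesis using C1_real_imp_selection[OF C1_real_compose_vec[OF H(2) g]] by simp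
    qed
    show "\<exists>k\<in>(\<lambda>K x. g (\<chi> i. K i x)) ` H. g (f x) = k x" for x using H(3)[of x] by auto
  qed
qed

text \<open>Choose a selection function for every component independently; there are finitely many combinations.\<close>
lemma C1_selection_imp_PC1:
  fixes f :: "real^'n \<Rightarrow> real^'m"
  assumes f: "\<And>i. C1_selection (\<lambda>x. f x $ i)" and cont: "continuous_on UNIV f"
  shows "PC1 f"
proof -
  obtain H where H: "finite H" "\<And>K i. K \<in> H \<Longrightarrow> C1_real (K i)" "\<And>x. \<exists>K\<in>H. f x = (\<chi> i. K i x)"
    using C1_selection_components[OF f] by blast
  have "C1_on UNIV (\<lambda>x. \<chi> i. K i x)" if "K \<in> H" for K
  proof -
    from H(2)[OF that] obtain \<Gamma> where \<Gamma>: "\<And>i x. (K i has_derivative (\<lambda>s. \<Gamma> i x \<bullet> s)) (at x)"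
      "\<And>i. continuous_on UNIV (\<Gamma> i)" unfolding C1_real_def by metis
    have "((\<lambda>x. \<chi> i. K i x) has_derivative (\<lambda>s. (\<chi> i. \<Gamma> i x) *v s)) (at x)" for x
    proof -
      have "((\<lambda>x. \<chi> i. K i x) has_derivative (\<lambda>s. \<chi> i. \<Gamma> i x \<bullet> s)) (at x)"
        by (rule has_derivative_vec_lambda) (rule \<Gamma>)
      moreover have "(\<chi> i. \<Gamma> i x) *v s = (\<chi> i. \<Gamma> i x \<bullet> s)" for s
        by (simp add: vec_eq_iff matrix_vector_mul_component)
      ultimately show ?thesis by simp
    qed
    then show ?thesis unfolding C1_on_def
      by (intro exI[of _ "\<lambda>x. \<chi> i. \<Gamma> i x"] conjI ballI continuous_on_vec_lambda \<Gamma>)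
  qed
  then show ?thesis unfolding PC1_def using cont H
    by (intro conjI allI exI[of _ UNIV] exI[of _ "(\<lambda>K x. \<chi> i. K i x) ` H"]) fastforce+
qed

section \<open>Signed integrals\<close>

text \<open>The integral from \<open>0\<close> to \<open>t\<close>, with the usual sign for \<open>t < 0\<close>. It is a primitive of \<open>f\<close> on the whole
  line, which keeps all selection functions globally defined.\<close>
definition sint :: "(real \<Rightarrow> real) \<Rightarrow> real \<Rightarrow> real" where
  "sint f t = integral {0..t} f - integral {t..0} f"

lemma sint_0 [simp]: "sint f 0 = 0"
  by (simp add: sint_def)

lemma sint_eq:
  assumes "continuous_on UNIV f" "\<bar>t\<bar> \<le> B"
  shows "sint f t = integral {-B..t} f - integral {-B..0} f"
proof -
  have int: "f integrable_on {a..b}" for a b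
    using assms(1) continuous_on_subset integrable_continuous_real by blast
  show ?thesis
  proof (cases "t \<ge> 0")
    case True
    then have "integral {t..0} f = 0" by (cases "t = 0") auto
    moreover have "integral {-B..0} f + integral {0..t} f = integral {-B..t} f"
      using assms(2) True by (intro Henstock_Kurzweil_Integration.integral_combine int) auto
    ultimately show ?thesis by (simp add: sint_def)
  next
    case False
    then have "integral {-B..t} f + integral {t..0} f = integral {-B..0} f"
      using assms(2) by (intro Henstock_Kurzweil_Integration.integral_combine int) auto
    then show ?thesis using False by (simp add: sint_def)
  qed
qed

lemma sint_diff:
  assumes "continuous_on UNIV f" "a \<le> b"
  shows "integral {a..b} f = sint f b - sint f a"
proof -
  define B where "B = \<bar>a\<bar> + \<bar>b\<bar>"
  have int: "f integrable_on {a..b}" for a b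
    using assms(1) continuous_on_subset integrable_continuous_real by blast
  have "integral {-B..a} f + integral {a..b} f = integral {-B..b} f"
    using assms(2) by (intro Henstock_Kurzweil_Integration.integral_combine int) (auto simp: B_def)
  moreover have "sint f a = integral {-B..a} f - integral {-B..0} f" "sint f b = integral {-B..b} f - integral {-B..0} f"
    by (rule sint_eq[OF assms(1)], simp add: B_def)+
  ultimately show ?thesis by simp
qed

lemma sint_has_real_derivative:
  assumes "continuous_on UNIV f"
  shows "(sint f has_real_derivative f t) (at t within S)"
proof -
  define B where "B = \<bar>t\<bar> + 1"
  have t: "t \<in> {-B<..<B}" by (auto simp: B_def)
  have "((\<lambda>x. integral {-B..x} f) has_real_derivative f t) (at t within {-B..B})"
    using t by (intro integral_has_real_derivative continuous_on_subset[OF assms]) auto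
  then have "((\<lambda>x. integral {-B..x} f) has_real_derivative f t) (at t)"
    using t at_within_Icc_at[of "-B" t B] by simp
  then have "((\<lambda>x. integral {-B..x} f - integral {-B..0} f) has_real_derivative f t) (at t)"
    by (auto intro!: derivative_eq_intros)
  then have "(sint f has_real_derivative f t) (at t)"
    by (rule has_field_derivative_transform_within_open[where S = "{-B<..<B}"])
       (use t in \<open>auto simp: sint_eq[OF assms, where B = B]\<close>)
  then show ?thesis by (rule has_field_derivative_at_within)
qed

text \<open>Rescaling to a fixed interval of integration reduces joint continuity and differentiation in parameters to
  the standard theorems.\<close>
lemma sint_scaled:
  assumes "continuous_on UNIV f"
  shows "sint f t = t * integral {0..1} (\<lambda>v. f (t * v))"
proof -
  have "((\<lambda>v. t * f (t * v)) has_integral sint f (t * 1) - sint f (t * 0)) {0..1}"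
  proof (rule fundamental_theorem_of_calculus)
    fix v :: real
    have "((\<lambda>v. sint f (t * v)) has_real_derivative f (t * v) * t) (at v within {0..1})"
      by (rule DERIV_chain2[OF sint_has_real_derivative[OF assms]]) (auto intro!: derivative_eq_intros)
    then show "((\<lambda>v. sint f (t * v)) has_vector_derivative t * f (t * v)) (at v within {0..1})"
      by (simp add: has_real_derivative_iff_has_vector_derivative mult.commute)
  qed simp
  then show ?thesis by (simp add: integral_unique flip: integral_mult_right)
qed

lemma continuous_on_apply2:
  assumes "continuous_on UNIV (\<lambda>(x, s). f x s)" "continuous_on A g" "continuous_on A h"
  shows "continuous_on A (\<lambda>z. f (g z) (h z))"
  using continuous_on_compose2[OF assms(1) continuous_on_Pair[OF assms(2,3)]] by simp

lemma continuous_on_section: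
  assumes "continuous_on UNIV (\<lambda>(x, s). f x s)" shows "continuous_on UNIV (f x)"
  using continuous_on_apply2[OF assms continuous_on_const continuous_on_id, of UNIV x] by simp

lemma continuous_sint:
  fixes f :: "'a::topological_space \<Rightarrow> real \<Rightarrow> real"
  assumes f: "continuous_on UNIV (\<lambda>(x, s). f x s)"
  shows "continuous_on UNIV (\<lambda>(x, t). sint (f x) t)"
proof -
  have "continuous_on UNIV (\<lambda>z :: 'a \<times> real. integral (cbox 0 1) (\<lambda>v. f (fst z) (snd z * v)))"
    by (rule integral_continuous_on_param)
       (auto simp: split_beta intro!: continuous_on_apply2[OF f] continuous_intros)
  then have "continuous_on UNIV (\<lambda>z :: 'a \<times> real. snd z * integral {0..1} (\<lambda>v. f (fst z) (snd z * v)))"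
    by (intro continuous_intros) simp
  then show ?thesis
    by (simp add: split_beta sint_scaled[OF continuous_on_section[OF f]])
qed

lemma sint_param_derivative:
  fixes f fp :: "real \<Rightarrow> real \<Rightarrow> real"
  assumes f: "continuous_on UNIV (\<lambda>(p, s). f p s)"
    and fp: "\<And>p s. ((\<lambda>p. f p s) has_real_derivative fp p s) (at p)"
    and fpc: "continuous_on UNIV (\<lambda>(p, s). fp p s)"
  shows "((\<lambda>(p, t). sint (f p) t) has_derivative (\<lambda>(dp, dt). sint (fp p) t * dp + f p t * dt)) (at (p, t))"
proof -
  have 1: "((\<lambda>p. sint (f p) t) has_derivative (\<lambda>dp. sint (fp p) t * dp)) (at p within UNIV)"
  proof -
    have "((\<lambda>p. integral (cbox 0 1) (\<lambda>v. f p (t * v))) has_real_derivative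
        integral (cbox 0 1) (\<lambda>v. fp p (t * v))) (at p within UNIV)"
    proof (rule leibniz_rule_field_derivative)
      show "(\<lambda>v. f p (t * v)) integrable_on cbox 0 1" for p
        by (intro integrable_continuous continuous_on_compose2[OF continuous_on_section[OF f]])
           (auto intro!: continuous_intros)
      show "continuous_on (UNIV \<times> cbox 0 1) (\<lambda>(p, v). fp p (t * v))"
        by (auto simp: split_beta intro!: continuous_on_apply2[OF fpc] continuous_intros)
    qed (use fp in auto)
    then have "((\<lambda>p. t * integral {0..1} (\<lambda>v. f p (t * v))) has_real_derivative
        t * integral {0..1} (\<lambda>v. fp p (t * v))) (at p)"
      by (intro DERIV_cmult) simp
    then show ?thesis
      by (simp add: sint_scaled[OF continuous_on_section[OF f]] sint_scaled[OF continuous_on_section[OF fpc]]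
          has_field_derivative_def)
  qed
  have "((\<lambda>(p, t). sint (f p) t) has_derivative (\<lambda>(dp, dt). sint (fp p) t * dp + blinfun_apply (f p t *\<^sub>R id_blinfun) dt))
      (at (p, t) within UNIV \<times> UNIV)"
  proof (rule has_derivative_partialsI[where X = UNIV and f = "\<lambda>p t. sint (f p) t"
        and fy = "\<lambda>p t. f p t *\<^sub>R id_blinfun", OF 1])
    fix p t :: real
    show "((\<lambda>t. sint (f p) t) has_derivative blinfun_apply (f p t *\<^sub>R id_blinfun)) (at t within UNIV)"
      using sint_has_real_derivative[OF continuous_on_section[OF f], of p t UNIV]
      by (simp add: has_field_derivative_def scaleR_blinfun.rep_eq)
  next
    have "continuous_on UNIV (\<lambda>z. (case z of (p, t) \<Rightarrow> f p t) *\<^sub>R (id_blinfun :: real \<Rightarrow>\<^sub>L real))"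
      by (intro continuous_intros f)
    then show "continuous (at (p, t) within UNIV \<times> UNIV) (\<lambda>(p, t). f p t *\<^sub>R (id_blinfun :: real \<Rightarrow>\<^sub>L real))"
      by (simp add: continuous_on_eq_continuous_at case_prod_unfold)
  qed auto
  then show ?thesis by (simp add: scaleR_blinfun.rep_eq)
qed

lemma C1_real_sint:
  fixes f fp :: "real \<Rightarrow> real \<Rightarrow> real" and P T :: "real^'n \<Rightarrow> real"
  assumes f: "continuous_on UNIV (\<lambda>(p, s). f p s)"
    and fp: "\<And>p s. ((\<lambda>p. f p s) has_real_derivative fp p s) (at p)"
    and fpc: "continuous_on UNIV (\<lambda>(p, s). fp p s)"
    and P: "C1_real P" and T: "C1_real T"
  shows "C1_real (\<lambda>x. sint (f (P x)) (T x))"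
proof -
  obtain P' where P': "\<And>x. (P has_derivative (\<lambda>s. P' x \<bullet> s)) (at x)" "continuous_on UNIV P'"
    using P unfolding C1_real_def by blast
  obtain T' where T': "\<And>x. (T has_derivative (\<lambda>s. T' x \<bullet> s)) (at x)" "continuous_on UNIV T'"
    using T unfolding C1_real_def by blast
  show ?thesis
  proof (rule C1_realI)
    fix x
    have "((\<lambda>x. (P x, T x)) has_derivative (\<lambda>s. (P' x \<bullet> s, T' x \<bullet> s))) (at x)"
      by (intro has_derivative_Pair P' T')
    from has_derivative_compose[OF this sint_param_derivative[OF f fp fpc]]
    show "((\<lambda>x. sint (f (P x)) (T x)) has_derivative
        (\<lambda>s. (sint (fp (P x)) (T x) *\<^sub>R P' x + f (P x) (T x) *\<^sub>R T' x) \<bullet> s)) (at x)"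
      by (simp add: inner_add_left)
  next
    have c: "continuous_on UNIV (\<lambda>x. (P x, T x))"
      by (intro continuous_intros C1_real_continuous P T)
    have "continuous_on UNIV (\<lambda>x. sint (fp (P x)) (T x))" "continuous_on UNIV (\<lambda>x. f (P x) (T x))"
      using continuous_on_compose2[OF continuous_sint[OF fpc] c] continuous_on_compose2[OF f c] by auto
    then show "continuous_on UNIV (\<lambda>x. sint (fp (P x)) (T x) *\<^sub>R P' x + f (P x) (T x) *\<^sub>R T' x)"
      by (intro continuous_intros P' T')
  qed
qed

section \<open>The mass of a polygon with moving sides\<close>
lemma continuous_on_Max:
  fixes f :: "'i \<Rightarrow> 'a::topological_space \<Rightarrow> real"
  assumes "finite I" "I \<noteq> {}" "\<And>i. i \<in> I \<Longrightarrow> continuous_on A (f i)"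
  shows "continuous_on A (\<lambda>x. Max ((\<lambda>i. f i x) ` I))"
  using assms by (induction rule: finite_ne_induct) (auto intro!: continuous_intros)

lemma continuous_on_Min:
  fixes f :: "'i \<Rightarrow> 'a::topological_space \<Rightarrow> real"
  assumes "finite I" "I \<noteq> {}" "\<And>i. i \<in> I \<Longrightarrow> continuous_on A (f i)"
  shows "continuous_on A (\<lambda>x. Min ((\<lambda>i. f i x) ` I))"
  using assms by (induction rule: finite_ne_induct) (auto intro!: continuous_intros)

lemma Max_image_diff_le:
  fixes f g :: "'i \<Rightarrow> real"
  assumes "finite I" "I \<noteq> {}" "\<And>i. i \<in> I \<Longrightarrow> \<bar>f i - g i\<bar> \<le> c"
  shows "\<bar>Max (f ` I) - Max (g ` I)\<bar> \<le> c"
  using assms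
proof (induction rule: finite_ne_induct)
  case (insert x F)
  have "\<bar>f x - g x\<bar> \<le> c" "\<bar>Max (f ` F) - Max (g ` F)\<bar> \<le> c" using insert by auto
  moreover have "Max (f ` insert x F) = max (f x) (Max (f ` F))" "Max (g ` insert x F) = max (g x) (Max (g ` F))"
    using insert.hyps by auto
  ultimately show ?case by linarith
qed simp

lemma Min_image_diff_le:
  fixes f g :: "'i \<Rightarrow> real"
  assumes "finite I" "I \<noteq> {}" "\<And>i. i \<in> I \<Longrightarrow> \<bar>f i - g i\<bar> \<le> c"
  shows "\<bar>Min (f ` I) - Min (g ` I)\<bar> \<le> c"
  using assms
proof (induction rule: finite_ne_induct)
  case (insert x F)
  have "\<bar>f x - g x\<bar> \<le> c" "\<bar>Min (f ` F) - Min (g ` F)\<bar> \<le> c" using insert by auto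
  moreover have "Min (f ` insert x F) = min (f x) (Min (f ` F))" "Min (g ` insert x F) = min (g x) (Min (g ` F))"
    using insert.hyps by auto
  ultimately show ?case by linarith
qed simp

lemma sum_if_unique:
  fixes f :: "'i \<Rightarrow> 'b::comm_monoid_add"
  assumes "finite A" "l \<in> A" "P l" "\<And>k. k \<in> A \<Longrightarrow> P k \<Longrightarrow> k = l"
  shows "(\<Sum>k\<in>A. if P k then f k else 0) = f l"
proof -
  have "(if P k then f k else 0) = (if k = l then f k else 0)" if "k \<in> A" for k
    using assms(3) assms(4)[OF that] by metis
  then have "(\<Sum>k\<in>A. if P k then f k else 0) = (\<Sum>k\<in>A. if k = l then f k else 0)"
    by (rule sum.cong[OF refl])
  also have "\<dots> = f l" using assms(1,2) by simp
  finally show ?thesis .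
qed

lemma sint_lipschitz:
  assumes f: "continuous_on UNIV f" and M: "\<And>t. \<bar>f t\<bar> \<le> M"
  shows "\<bar>sint f a - sint f b\<bar> \<le> M * \<bar>a - b\<bar>"
proof -
  have *: "\<bar>sint f b - sint f a\<bar> \<le> M * (b - a)" if "a \<le> b" for a b
    using integral_bound[OF that continuous_on_subset[OF f], of M] M by (simp add: sint_diff[OF f that])
  show ?thesis using *[of a b] *[of b a] by (cases "a \<le> b") (auto simp: abs_minus_commute)
qed

text \<open>Each linear inequality cuts the interval at its own boundary point, if at all.\<close>
lemma halflines_inter_interval:
  fixes C :: "(real \<times> real) set"
  assumes "finite C" and "A \<le> B" and "{A, B} \<subseteq> E" and "\<And>\<alpha> \<beta>. (\<alpha>, \<beta>) \<in> C \<Longrightarrow> \<alpha> \<noteq> 0 \<Longrightarrow> \<beta> / \<alpha> \<in> E"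
  shows "{s\<in>{A..B}. \<forall>(\<alpha>, \<beta>)\<in>C. \<alpha> * s \<le> \<beta>} = {} \<or>
    (\<exists>a\<in>E. \<exists>b\<in>E. a \<le> b \<and> {s\<in>{A..B}. \<forall>(\<alpha>, \<beta>)\<in>C. \<alpha> * s \<le> \<beta>} = {a..b})"
  using assms(1,4)
proof (induction rule: finite_induct)
  case empty
  then show ?case using assms(2,3) by force
next
  case (insert c C)
  obtain \<alpha> \<beta> where c: "c = (\<alpha>, \<beta>)" by force
  define S where "S = {s\<in>{A..B}. \<forall>(\<alpha>, \<beta>)\<in>C. \<alpha> * s \<le> \<beta>}"
  have split: "{s\<in>{A..B}. \<forall>(\<alpha>, \<beta>)\<in>insert c C. \<alpha> * s \<le> \<beta>} = S \<inter> {s. \<alpha> * s \<le> \<beta>}"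
    by (auto simp: S_def c)
  have "S = {} \<or> (\<exists>a\<in>E. \<exists>b\<in>E. a \<le> b \<and> S = {a..b})"
    unfolding S_def by (rule insert.IH) (use insert.prems in blast)
  then show ?case
  proof
    assume "S = {}" then show ?thesis unfolding split by blast
  next
    assume "\<exists>a\<in>E. \<exists>b\<in>E. a \<le> b \<and> S = {a..b}"
    then obtain a b where ab: "a \<in> E" "b \<in> E" "a \<le> b" "S = {a..b}" by blast
    consider "\<alpha> = 0" | "\<alpha> > 0" | "\<alpha> < 0" by linarith
    then show ?thesis
    proof cases
      case 1
      then show ?thesis unfolding split using ab by (cases "0 \<le> \<beta>") auto
    next
      case 2
      then have "S \<inter> {s. \<alpha> * s \<le> \<beta>} = {a..min b (\<beta>/\<alpha>)}"
        unfolding ab by (auto simp: field_simps)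
      moreover have "min b (\<beta>/\<alpha>) \<in> E" using insert.prems[of \<alpha> \<beta>] c ab(2) 2 by (auto simp: min_def)
      ultimately show ?thesis unfolding split using ab(1) by (cases "a \<le> min b (\<beta>/\<alpha>)") auto
    next
      case 3
      then have "S \<inter> {s. \<alpha> * s \<le> \<beta>} = {max a (\<beta>/\<alpha>)..b}"
        unfolding ab by (auto simp: field_simps)
      moreover have "max a (\<beta>/\<alpha>) \<in> E" using insert.prems[of \<alpha> \<beta>] c ab(1) 3 by (auto simp: max_def)
      ultimately show ?thesis unfolding split using ab(2) by (cases "max a (\<beta>/\<alpha>) \<le> b") auto
    qed
  qed
qed

text \<open>Differentiation under the integral sign when the integrand is uniformly Lipschitz and differentiable at
  \<open>\<eta>\<close> for all but finitely many \<open>s\<close>: the difference quotients are dominated by a constant.\<close>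
lemma has_derivative_integral_dominated:
  fixes f :: "'a::euclidean_space \<Rightarrow> real \<Rightarrow> real" and D :: "real \<Rightarrow> 'a"
  assumes "finite N"
    and deriv: "\<And>s. s \<in> {a..b} - N \<Longrightarrow> ((\<lambda>\<xi>. f \<xi> s) has_derivative (\<lambda>h. D s \<bullet> h)) (at \<eta>)"
    and int: "\<And>\<xi>. f \<xi> integrable_on {a..b}" and Dint: "\<And>h. (\<lambda>s. D s \<bullet> h) integrable_on {a..b}"
    and lip: "\<And>\<xi> s. s \<in> {a..b} \<Longrightarrow> \<bar>f \<xi> s - f \<eta> s\<bar> \<le> C * norm (\<xi> - \<eta>)"
    and Db: "\<And>s. s \<in> {a..b} \<Longrightarrow> norm (D s) \<le> C'"
  shows "((\<lambda>\<xi>. integral {a..b} (f \<xi>)) has_derivative (\<lambda>h. integral {a..b} (\<lambda>s. D s \<bullet> h))) (at \<eta>)"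
  unfolding has_derivative_at2
proof
  have "linear (\<lambda>h. integral {a..b} (\<lambda>s. D s \<bullet> h))"
    by (rule linearI) (simp_all add: inner_add_right Dint integral_add)
  then show "bounded_linear (\<lambda>h. integral {a..b} (\<lambda>s. D s \<bullet> h))"
    by (simp add: linear_conv_bounded_linear)
  define q where "q \<xi> s = (1 / norm (\<xi> - \<eta>)) *\<^sub>R (f \<xi> s - (f \<eta> s + D s \<bullet> (\<xi> - \<eta>)))" for \<xi> s
  have qint: "q \<xi> integrable_on {a..b}" for \<xi>
    unfolding q_def by (intro integrable_cmul integrable_diff integrable_add int Dint)
  have q: "(1 / norm (\<xi> - \<eta>)) *\<^sub>R (integral {a..b} (f \<xi>) - (integral {a..b} (f \<eta>) + integral {a..b} (\<lambda>s. D s \<bullet> (\<xi> - \<eta>))))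
      = integral {a..b} (\<lambda>s. if s \<in> N then 0 else q \<xi> s)" for \<xi>
  proof -
    have "integral {a..b} (\<lambda>s. if s \<in> N then 0 else q \<xi> s) = integral {a..b} (q \<xi>)"
      by (rule integral_spike[OF negligible_finite[OF \<open>finite N\<close>]]) auto
    also have "\<dots> = (1 / norm (\<xi> - \<eta>)) *\<^sub>R integral {a..b} (\<lambda>s. f \<xi> s - (f \<eta> s + D s \<bullet> (\<xi> - \<eta>)))"
      unfolding q_def by (rule integral_cmul)
    also have "integral {a..b} (\<lambda>s. f \<xi> s - (f \<eta> s + D s \<bullet> (\<xi> - \<eta>)))
        = integral {a..b} (f \<xi>) - (integral {a..b} (f \<eta>) + integral {a..b} (\<lambda>s. D s \<bullet> (\<xi> - \<eta>)))"
      by (subst integral_diff) (auto simp: integral_add int Dint intro!: integrable_add)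
    finally show ?thesis by simp
  qed
  show "(\<lambda>\<xi>. (1 / norm (\<xi> - \<eta>)) *\<^sub>R (integral {a..b} (f \<xi>) - (integral {a..b} (f \<eta>) +
      integral {a..b} (\<lambda>s. D s \<bullet> (\<xi> - \<eta>))))) \<midarrow>\<eta>\<rightarrow> 0"
    unfolding q tendsto_at_iff_sequentially comp_def
  proof (intro allI impI)
    fix X assume X: "\<forall>i. X i \<in> UNIV - {\<eta>}" "X \<longlonglongrightarrow> \<eta>"
    have "(\<lambda>k. integral {a..b} (\<lambda>s. if s \<in> N then 0 else q (X k) s)) \<longlonglongrightarrow> integral {a..b} (\<lambda>s. 0 :: real)"
    proof (rule dominated_convergence(2)[where h = "\<lambda>s. C + C'"])
      fix k
      show "(\<lambda>s. if s \<in> N then 0 else q (X k) s) integrable_on {a..b}"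
        by (rule integrable_spike_finite[OF \<open>finite N\<close> _ qint]) auto
      fix s assume s: "s \<in> {a..b}"
      have n0: "norm (X k - \<eta>) > 0" using X(1)[rule_format, of k] by simp
      have "\<bar>f (X k) s - (f \<eta> s + D s \<bullet> (X k - \<eta>))\<bar> \<le> \<bar>f (X k) s - f \<eta> s\<bar> + \<bar>D s \<bullet> (X k - \<eta>)\<bar>" by linarith
      also have "\<dots> \<le> C * norm (X k - \<eta>) + C' * norm (X k - \<eta>)"
        using lip[OF s, of "X k"] Cauchy_Schwarz_ineq2[of "D s" "X k - \<eta>"]
          mult_right_mono[OF Db[OF s], of "norm (X k - \<eta>)"] by simp
      finally have "\<bar>q (X k) s\<bar> \<le> C + C'"
        using n0 by (simp add: q_def abs_mult field_simps)
      moreover have "0 \<le> \<bar>f (X k) s - f \<eta> s\<bar>" by simp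
      moreover have "0 \<le> C * norm (X k - \<eta>)" using lip[OF s, of "X k"] by linarith
      moreover have "C \<ge> 0" using calculation(3) n0 by (simp add: zero_le_mult_iff)
      moreover have "C' \<ge> 0" using Db[OF s] norm_ge_zero order_trans by blast
      ultimately show "norm (if s \<in> N then 0 else q (X k) s) \<le> C + C'" by simp
    next
      fix s assume s: "s \<in> {a..b}"
      show "(\<lambda>k. if s \<in> N then 0 else q (X k) s) \<longlonglongrightarrow> 0"
      proof (cases "s \<in> N")
        case False
        have "(\<lambda>\<xi>. q \<xi> s) \<midarrow>\<eta>\<rightarrow> 0"
          using deriv[of s] s False unfolding has_derivative_at2 q_def by blast
        then show ?thesis using X False unfolding tendsto_at_iff_sequentially comp_def by simp
      qed simp
    qed auto
    then show "(\<lambda>k. integral {a..b} (\<lambda>s. if s \<in> N then 0 else q (X k) s)) \<longlonglongrightarrow> 0" by simp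
  qed
qed

lemma has_derivative_eventually_eq:
  assumes "(g has_derivative D) (at x)" and ev: "\<forall>\<^sub>F y in nhds x. f y = g y"
  shows "(f has_derivative D) (at x)"
proof (rule has_derivative_transform_eventually[OF assms(1)])
  show "\<forall>\<^sub>F y in at x. g y = f y"
    using ev unfolding eventually_nhds_conv_at by (auto elim: eventually_mono)
  show "g x = f x" using eventually_nhds_x_imp_x[OF ev] by simp
qed simp

lemma continuous_on_tendsto_nhds:
  fixes f :: "'a::t2_space \<Rightarrow> 'b::topological_space"
  assumes "continuous_on UNIV f" shows "(f \<longlongrightarrow> f x) (nhds x)"
proof -
  have "isCont f x" using assms by (simp add: continuous_on_eq_continuous_at)
  then show ?thesis unfolding isCont_def by (simp only: tendsto_at_iff_tendsto_nhds)
qed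

text \<open>A non-vertical line is given by its slope and by its intercept as a function of a parameter \<open>\<xi>\<close>.\<close>
definition line :: "real \<times> ('a \<Rightarrow> real) \<Rightarrow> 'a \<Rightarrow> real \<Rightarrow> real" where
  "line l \<xi> s = snd l \<xi> + fst l * s"

text \<open>The polygon at \<open>\<xi>\<close> consists of the points \<open>(s, y)\<close> that lie below all lines of \<open>U\<close>, above all lines of
  \<open>Lo\<close>, and satisfy \<open>\<bar>s\<bar> \<le> R\<close>. The density \<open>rho\<close> lives on the whole plane, so that primitives along the lines
  make sense also where they have left the polygon.\<close>
locale moving_polygon =
  fixes rho :: "real \<Rightarrow> real \<Rightarrow> real" and U Lo :: "(real \<times> (real^'n \<Rightarrow> real)) set" and R :: real
  assumes rho_cont: "continuous_on UNIV (\<lambda>(s, y). rho s y)"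
    and fin: "finite U" "finite Lo" and ne: "U \<noteq> {}" "Lo \<noteq> {}"
    and C1: "\<And>l. l \<in> U \<union> Lo \<Longrightarrow> C1_real (snd l)" and R: "0 \<le> R"
begin

definition "lo \<xi> s = Max ((\<lambda>l. line l \<xi> s) ` Lo)"
definition "hi \<xi> s = Min ((\<lambda>l. line l \<xi> s) ` U)"
text \<open>The parameters \<open>s\<close> at which the line \<open>l\<close> runs along the polygon.\<close>
definition "edge l \<xi> = {s \<in> {-R..R}. lo \<xi> s \<le> line l \<xi> s \<and> line l \<xi> s \<le> hi \<xi> s}"
definition "slice \<xi> s = integral {lo \<xi> s..hi \<xi> s} (rho s)"
definition "mass \<xi> = integral {-R..R} (slice \<xi>)"
definition "crossings \<xi> = {s. \<exists>l\<in>U \<union> Lo. \<exists>l'\<in>U \<union> Lo. fst l \<noteq> fst l' \<and> line l \<xi> s = line l' \<xi> s}"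
text \<open>For parallel lines the quotient is \<open>0\<close>, a harmless additional candidate.\<close>
definition "endpoints l = insert (\<lambda>_. R) (insert (\<lambda>_. -R)
  ((\<lambda>l' \<xi>. (snd l' \<xi> - snd l \<xi>) / (fst l - fst l')) ` (U \<union> Lo)))"

lemma rho_section: "continuous_on UNIV (rho s)"
  by (rule continuous_on_section[OF rho_cont])

text \<open>The maximum lets an empty slice have mass \<open>0\<close>.\<close>
lemma slice_eq: "slice \<xi> s = sint (rho s) (max (lo \<xi> s) (hi \<xi> s)) - sint (rho s) (lo \<xi> s)"
  using sint_diff[OF rho_section, of "lo \<xi> s" "hi \<xi> s" s]
  by (cases "lo \<xi> s \<le> hi \<xi> s") (auto simp: slice_def max_def)

lemma line_continuous: "l \<in> U \<union> Lo \<Longrightarrow> continuous_on UNIV (\<lambda>(\<xi>, s). line l \<xi> s)"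
  unfolding line_def split_beta
  by (intro continuous_intros continuous_on_compose2[OF C1_real_continuous[OF C1]]) auto

lemma lo_hi_continuous: "continuous_on UNIV (\<lambda>(\<xi>, s). lo \<xi> s)" "continuous_on UNIV (\<lambda>(\<xi>, s). hi \<xi> s)"
  unfolding lo_def hi_def split_beta
  by (intro continuous_on_Max continuous_on_Min fin ne line_continuous[unfolded split_beta]; simp)+

lemma slice_continuous: "continuous_on UNIV (\<lambda>(\<xi>, s). slice \<xi> s)"
proof -
  note lh = lo_hi_continuous[unfolded split_beta]
  show ?thesis unfolding slice_eq split_beta
    by (intro continuous_intros continuous_on_apply2[OF continuous_sint[OF rho_cont]] lh)
qed

lemma mass_continuous: "continuous_on UNIV mass"
proof -
  have "continuous_on UNIV (\<lambda>\<xi>. integral (cbox (-R) R) (slice \<xi>))"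
    by (rule integral_continuous_on_param) (rule continuous_on_subset[OF slice_continuous], simp)
  then show ?thesis by (simp add: mass_def[abs_def])
qed

lemma slice_integrable: "slice \<xi> integrable_on {-R..R}"
  by (intro integrable_continuous_real continuous_on_subset[OF continuous_on_section[OF slice_continuous]]) simp

lemma finite_crossings: "finite (crossings \<xi>)"
proof -
  have "crossings \<xi> \<subseteq> (\<lambda>(l, l'). (snd l' \<xi> - snd l \<xi>) / (fst l - fst l')) ` ((U \<union> Lo) \<times> (U \<union> Lo))"
  proof
    fix s assume "s \<in> crossings \<xi>"
    then obtain l l' where l: "l \<in> U \<union> Lo" "l' \<in> U \<union> Lo" "fst l \<noteq> fst l'" "line l \<xi> s = line l' \<xi> s"
      unfolding crossings_def by blast
    then have "s = (snd l' \<xi> - snd l \<xi>) / (fst l - fst l')"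
      by (simp add: line_def field_simps)
    then show "s \<in> (\<lambda>(l, l'). (snd l' \<xi> - snd l \<xi>) / (fst l - fst l')) ` ((U \<union> Lo) \<times> (U \<union> Lo))"
      using l(1,2) by force
  qed
  then show ?thesis using fin by (meson finite_SigmaI finite_UnI finite_imageI finite_subset)
qed

lemma edge_iff: "s \<in> edge l \<xi> \<longleftrightarrow> s \<in> {-R..R} \<and> (\<forall>l'\<in>U. line l \<xi> s \<le> line l' \<xi> s) \<and> (\<forall>l'\<in>Lo. line l' \<xi> s \<le> line l \<xi> s)"
  using fin ne by (auto simp: edge_def lo_def hi_def)

lemma edge_interval:
  assumes "l \<in> U \<union> Lo"
  shows "edge l \<xi> = {} \<or> (\<exists>a\<in>endpoints l. \<exists>b\<in>endpoints l. a \<xi> \<le> b \<xi> \<and> edge l \<xi> = {a \<xi>..b \<xi>})"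
proof -
  define C where "C = (\<lambda>l'. (fst l - fst l', snd l' \<xi> - snd l \<xi>)) ` U \<union> (\<lambda>l'. (fst l' - fst l, snd l \<xi> - snd l' \<xi>)) ` Lo"
  define E where "E = (\<lambda>e. e \<xi>) ` endpoints l"
  have eq: "edge l \<xi> = {s\<in>{-R..R}. \<forall>(\<alpha>, \<beta>)\<in>C. \<alpha> * s \<le> \<beta>}"
  proof -
    have U: "(fst l - fst l') * s \<le> snd l' \<xi> - snd l \<xi> \<longleftrightarrow> line l \<xi> s \<le> line l' \<xi> s"
      and L: "(fst l' - fst l) * s \<le> snd l \<xi> - snd l' \<xi> \<longleftrightarrow> line l' \<xi> s \<le> line l \<xi> s" for l' s
      by (auto simp: line_def algebra_simps)
    show ?thesis unfolding C_def ball_Un ball_simps prod.case U L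
      by (rule set_eqI) (simp only: edge_iff mem_Collect_eq)
  qed
  have "\<beta> / \<alpha> \<in> E" if "(\<alpha>, \<beta>) \<in> C" for \<alpha> \<beta>
  proof -
    from that consider l' where "l' \<in> U" "\<alpha> = fst l - fst l'" "\<beta> = snd l' \<xi> - snd l \<xi>"
      | l' where "l' \<in> Lo" "\<alpha> = fst l' - fst l" "\<beta> = snd l \<xi> - snd l' \<xi>"
      unfolding C_def by blast
    then obtain l' where l': "l' \<in> U \<union> Lo" "\<beta> / \<alpha> = (snd l' \<xi> - snd l \<xi>) / (fst l - fst l')"
      by cases (metis UnI1, metis UnI2 minus_diff_eq minus_divide_divide)
    then show ?thesis unfolding E_def endpoints_def by (auto simp: image_image)
  qed
  then have "edge l \<xi> = {} \<or> (\<exists>a\<in>E. \<exists>b\<in>E. a \<le> b \<and> edge l \<xi> = {a..b})"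
    unfolding eq using fin R
    by (intro halflines_inter_interval) (auto simp: C_def E_def endpoints_def)
  then show ?thesis unfolding E_def by blast
qed

lemma edge_integral_if:
  assumes "l \<in> U \<union> Lo" "continuous_on UNIV f"
  shows "(\<lambda>s. if s \<in> edge l \<xi> then f s else 0 :: real) integrable_on {-R..R}"
    "integral {-R..R} (\<lambda>s. if s \<in> edge l \<xi> then f s else 0) = integral (edge l \<xi>) f"
proof -
  have "edge l \<xi> \<inter> {-R..R} = edge l \<xi>" by (auto simp: edge_def)
  moreover have "f integrable_on edge l \<xi>"
    using edge_interval[OF assms(1), of \<xi>] continuous_on_subset[OF assms(2)]
    by (auto intro!: integrable_continuous_real)
  ultimately show "(\<lambda>s. if s \<in> edge l \<xi> then f s else 0) integrable_on {-R..R}"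
    "integral {-R..R} (\<lambda>s. if s \<in> edge l \<xi> then f s else 0) = integral (edge l \<xi>) f"
    by (simp_all add: Henstock_Kurzweil_Integration.integrable_restrict_Int
        Henstock_Kurzweil_Integration.integral_restrict_Int)
qed

lemma edge_primitive_continuous:
  assumes "l \<in> U \<union> Lo" shows "continuous_on UNIV (\<lambda>s. sint (rho s) (line l \<xi> s))"
  by (intro continuous_on_apply2[OF continuous_sint[OF rho_cont]] continuous_intros
      continuous_on_section[OF line_continuous[OF assms]])

text \<open>The ends of the edge are two of finitely many continuously differentiable functions of \<open>\<xi>\<close>, and for each
  choice of the ends the signed integral is continuously differentiable.\<close>
lemma C1_selection_edge_integral:
  assumes l: "l \<in> U \<union> Lo"
  shows "C1_selection (\<lambda>\<xi>. integral (edge l \<xi>) (\<lambda>s. sint (rho s) (line l \<xi> s)))"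
proof -
  define \<Psi> where "\<Psi> a \<xi> = sint (\<lambda>s. sint (rho s) (line l \<xi> s)) (a \<xi>)" for a \<xi>
  have \<Psi>: "C1_real (\<Psi> a)" if "C1_real a" for a
    unfolding \<Psi>_def line_def
  proof (rule C1_real_sint[where f = "\<lambda>p s. sint (rho s) (p + fst l * s)" and fp = "\<lambda>p s. rho s (p + fst l * s)"])
    show "continuous_on UNIV (\<lambda>(p, s). sint (rho s) (p + fst l * s))"
      unfolding split_beta
      by (intro continuous_on_apply2[OF continuous_sint[OF rho_cont]] continuous_intros)
    show "continuous_on UNIV (\<lambda>(p, s). rho s (p + fst l * s))"
      unfolding split_beta
      by (intro continuous_on_apply2[OF rho_cont] continuous_intros)
    show "((\<lambda>p. sint (rho s) (p + fst l * s)) has_real_derivative rho s (p + fst l * s)) (at p)" for p s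
    proof -
      have "((\<lambda>p. sint (rho s) (p + fst l * s)) has_real_derivative rho s (p + fst l * s) * 1) (at p)"
        by (rule DERIV_chain2[OF sint_has_real_derivative[OF rho_section]]) (auto intro!: derivative_eq_intros)
      then show ?thesis by simp
    qed
  qed (use l C1 that in auto)
  have endC1: "C1_real a" if a: "a \<in> endpoints l" for a
    using a unfolding endpoints_def
    by (auto intro!: C1_real_const C1_real_divide_const C1_real_diff C1 l simp del: Un_iff)
  show ?thesis
  proof (rule C1_selection_of_selections)
    show "finite (insert (\<lambda>\<xi>. 0) ((\<lambda>(a, b) \<xi>. \<Psi> b \<xi> - \<Psi> a \<xi>) ` (endpoints l \<times> endpoints l)))"
      using fin by (simp add: endpoints_def)
    show "C1_selection k" if k: "k \<in> insert (\<lambda>\<xi>. 0) ((\<lambda>(a, b) \<xi>. \<Psi> b \<xi> - \<Psi> a \<xi>) ` (endpoints l \<times> endpoints l))" for k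
    proof -
      from k consider "k = (\<lambda>\<xi>. 0)" | a b where "a \<in> endpoints l" "b \<in> endpoints l" "k = (\<lambda>\<xi>. \<Psi> b \<xi> - \<Psi> a \<xi>)"
        by auto
      then show ?thesis
      proof cases
        case 1
        then show ?thesis by (simp add: C1_real_imp_selection C1_real_const)
      next
        case 2
        then show ?thesis using C1_real_imp_selection[OF C1_real_diff[OF \<Psi>[OF endC1] \<Psi>[OF endC1]]] by simp
      qed
    qed
    show "\<exists>k\<in>insert (\<lambda>\<xi>. 0) ((\<lambda>(a, b) \<xi>. \<Psi> b \<xi> - \<Psi> a \<xi>) ` (endpoints l \<times> endpoints l)).
        integral (edge l \<xi>) (\<lambda>s. sint (rho s) (line l \<xi> s)) = k \<xi>" for \<xi>
      using edge_interval[OF l, of \<xi>]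
    proof (elim disjE bexE conjE)
      assume "edge l \<xi> = {}" then show ?thesis by simp
    next
      fix a b assume ab: "a \<in> endpoints l" "b \<in> endpoints l" "a \<xi> \<le> b \<xi>" "edge l \<xi> = {a \<xi>..b \<xi>}"
      have "integral (edge l \<xi>) (\<lambda>s. sint (rho s) (line l \<xi> s)) = \<Psi> b \<xi> - \<Psi> a \<xi>"
        unfolding \<Psi>_def ab(4) by (rule sint_diff[OF edge_primitive_continuous[OF l] ab(3)])
      then show ?thesis using ab(1,2) by auto
    qed
  qed
qed

text \<open>Away from the crossings, two lines that both bound the slice at \<open>s\<close> from the same side have the same
  slope and meet at \<open>s\<close>, so they coincide.\<close>
lemma active_line_unique:
  assumes "s \<in> edge l \<xi>" "s \<in> edge l' \<xi>" "s \<notin> crossings \<xi>" "{l, l'} \<subseteq> U \<or> {l, l'} \<subseteq> Lo"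
  shows "fst l = fst l'" "snd l \<xi> = snd l' \<xi>"
proof -
  have "line l \<xi> s = line l' \<xi> s" using assms(1,2,4) by (force simp: edge_iff)
  then show "fst l = fst l'" using assms(3,4) by (auto simp: crossings_def)
  with \<open>line l \<xi> s = line l' \<xi> s\<close> show "snd l \<xi> = snd l' \<xi>" by (simp add: line_def)
qed

lemma active_line_exists:
  assumes "s \<in> {-R..R}" "lo \<xi> s \<le> hi \<xi> s"
  obtains l m where "l \<in> U" "line l \<xi> s = hi \<xi> s" "s \<in> edge l \<xi>" "m \<in> Lo" "line m \<xi> s = lo \<xi> s" "s \<in> edge m \<xi>"
proof -
  have "Min ((\<lambda>l. line l \<xi> s) ` U) \<in> (\<lambda>l. line l \<xi> s) ` U" by (rule Min_in) (use fin ne in auto)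
  then obtain l where l: "l \<in> U" "hi \<xi> s = line l \<xi> s" unfolding hi_def by blast
  have "Max ((\<lambda>l. line l \<xi> s) ` Lo) \<in> (\<lambda>l. line l \<xi> s) ` Lo" by (rule Max_in) (use fin ne in auto)
  then obtain m where m: "m \<in> Lo" "lo \<xi> s = line m \<xi> s" unfolding lo_def by blast
  show thesis by (rule that[of l m]) (use assms l m in \<open>auto simp: edge_def\<close>)
qed

lemma edge_empty: "hi \<xi> s < lo \<xi> s \<Longrightarrow> s \<notin> edge l \<xi>"
  by (auto simp: edge_def)

text \<open>Lines that coincide at \<open>\<xi>\<close> must be counted once; \<open>U'\<close> and \<open>L'\<close> contain one representative of each. Then
  exactly one upper and one lower line bound a nonempty slice, apart from the crossings.\<close>
lemma slice_decomposition:
  assumes U': "U' \<subseteq> U" "inj_on (\<lambda>l. (fst l, snd l \<xi>)) U'" "(\<lambda>l. (fst l, snd l \<xi>)) ` U' = (\<lambda>l. (fst l, snd l \<xi>)) ` U"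
    and L': "L' \<subseteq> Lo" "inj_on (\<lambda>l. (fst l, snd l \<xi>)) L'" "(\<lambda>l. (fst l, snd l \<xi>)) ` L' = (\<lambda>l. (fst l, snd l \<xi>)) ` Lo"
    and s: "s \<in> {-R..R}" "s \<notin> crossings \<xi>"
  shows "slice \<xi> s = (\<Sum>l\<in>U'. if s \<in> edge l \<xi> then sint (rho s) (line l \<xi> s) else 0) -
    (\<Sum>l\<in>L'. if s \<in> edge l \<xi> then sint (rho s) (line l \<xi> s) else 0)"
proof (cases "lo \<xi> s \<le> hi \<xi> s")
  case False
  then show ?thesis by (simp add: slice_def edge_empty)
next
  case True
  then obtain l0 m0 where lm0: "l0 \<in> U" "line l0 \<xi> s = hi \<xi> s" "s \<in> edge l0 \<xi>" "m0 \<in> Lo" "line m0 \<xi> s = lo \<xi> s" "s \<in> edge m0 \<xi>"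
    using active_line_exists[OF s(1)] by blast
  obtain l where l: "l \<in> U'" "fst l = fst l0" "snd l \<xi> = snd l0 \<xi>" using lm0(1) U'(3) by (smt (verit) image_iff prod.inject)
  obtain m where m: "m \<in> L'" "fst m = fst m0" "snd m \<xi> = snd m0 \<xi>" using lm0(4) L'(3) by (smt (verit) image_iff prod.inject)
  have ll: "line l \<xi> s = hi \<xi> s" "line m \<xi> s = lo \<xi> s" "s \<in> edge l \<xi>" "s \<in> edge m \<xi>"
    using l m lm0 by (auto simp: line_def edge_def)
  have "(\<Sum>l\<in>U'. if s \<in> edge l \<xi> then sint (rho s) (line l \<xi> s) else 0) = sint (rho s) (line l \<xi> s)"
  proof (rule sum_if_unique)
    fix k assume k: "k \<in> U'" "s \<in> edge k \<xi>"
    then have "(fst k, snd k \<xi>) = (fst l, snd l \<xi>)"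
      using active_line_unique[OF k(2) ll(3) s(2)] U'(1) l(1) by auto
    then show "k = l" using U'(2) k(1) l(1) by (auto dest: inj_onD)
  qed (use fin U'(1) finite_subset l ll in auto)
  moreover have "(\<Sum>l\<in>L'. if s \<in> edge l \<xi> then sint (rho s) (line l \<xi> s) else 0) = sint (rho s) (line m \<xi> s)"
  proof (rule sum_if_unique)
    fix k assume k: "k \<in> L'" "s \<in> edge k \<xi>"
    then have "(fst k, snd k \<xi>) = (fst m, snd m \<xi>)"
      using active_line_unique[OF k(2) ll(4) s(2)] L'(1) m(1) by auto
    then show "k = m" using L'(2) k(1) m(1) by (auto dest: inj_onD)
  qed (use fin L'(1) finite_subset m ll in auto)
  ultimately show ?thesis using True by (simp add: slice_eq ll max_def)
qed

text \<open>Integrating the decomposition of the slices gives a signed sum of edge integrals over the representatives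
  \<open>U'\<close> and \<open>L'\<close>. These depend on \<open>\<xi>\<close>, but there are only finitely many subsets to choose from.\<close>
theorem mass_C1_selection: "C1_selection mass"
proof (rule C1_selection_of_selections)
  let ?E = "\<lambda>l \<xi>. integral (edge l \<xi>) (\<lambda>s. sint (rho s) (line l \<xi> s))"
  let ?K = "(\<lambda>(U', L') \<xi>. (\<Sum>l\<in>U'. ?E l \<xi>) - (\<Sum>l\<in>L'. ?E l \<xi>)) ` (Pow U \<times> Pow Lo)"
  show "finite ?K" using fin by simp
  show "C1_selection k" if k: "k \<in> ?K" for k
  proof -
    from k obtain U' L' where "U' \<subseteq> U" "L' \<subseteq> Lo" "k = (\<lambda>\<xi>. (\<Sum>l\<in>U'. ?E l \<xi>) - (\<Sum>l\<in>L'. ?E l \<xi>))" by auto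
    then show ?thesis
      by (auto intro!: C1_selection_diff C1_selection_sum C1_selection_edge_integral)
  qed
  show "\<exists>k\<in>?K. mass \<xi> = k \<xi>" for \<xi>
  proof -
    obtain U' where U': "U' \<subseteq> U" "inj_on (\<lambda>l. (fst l, snd l \<xi>)) U'" "(\<lambda>l. (fst l, snd l \<xi>)) ` U' = (\<lambda>l. (fst l, snd l \<xi>)) ` U"
      using subset_image_inj[of "(\<lambda>l. (fst l, snd l \<xi>)) ` U" "\<lambda>l. (fst l, snd l \<xi>)" U] by auto
    obtain L' where L': "L' \<subseteq> Lo" "inj_on (\<lambda>l. (fst l, snd l \<xi>)) L'" "(\<lambda>l. (fst l, snd l \<xi>)) ` L' = (\<lambda>l. (fst l, snd l \<xi>)) ` Lo"
      using subset_image_inj[of "(\<lambda>l. (fst l, snd l \<xi>)) ` Lo" "\<lambda>l. (fst l, snd l \<xi>)" Lo] by auto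
    have fin': "finite U'" "finite L'" using U'(1) L'(1) fin finite_subset by auto
    have "mass \<xi> = integral {-R..R} (\<lambda>s. (\<Sum>l\<in>U'. if s \<in> edge l \<xi> then sint (rho s) (line l \<xi> s) else 0) -
        (\<Sum>l\<in>L'. if s \<in> edge l \<xi> then sint (rho s) (line l \<xi> s) else 0))"
      unfolding mass_def
      by (rule integral_spike[OF negligible_finite[OF finite_crossings[of \<xi>]]])
         (use slice_decomposition[OF U' L'] in auto)
    also have "\<dots> = (\<Sum>l\<in>U'. ?E l \<xi>) - (\<Sum>l\<in>L'. ?E l \<xi>)"
    proof -
      have *: "((\<lambda>s. if s \<in> edge l \<xi> then sint (rho s) (line l \<xi> s) else 0) has_integral ?E l \<xi>) {-R..R}"
        if "l \<in> U' \<or> l \<in> L'" for l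
        using edge_integral_if[of l, OF _ edge_primitive_continuous[of l \<xi>], of \<xi>] that U'(1) L'(1) by (auto simp: has_integral_iff)
      have "((\<lambda>s. \<Sum>l\<in>U'. if s \<in> edge l \<xi> then sint (rho s) (line l \<xi> s) else 0) has_integral (\<Sum>l\<in>U'. ?E l \<xi>)) {-R..R}"
        "((\<lambda>s. \<Sum>l\<in>L'. if s \<in> edge l \<xi> then sint (rho s) (line l \<xi> s) else 0) has_integral (\<Sum>l\<in>L'. ?E l \<xi>)) {-R..R}"
        by (intro has_integral_sum fin' *; simp)+
      then show ?thesis by (intro integral_unique has_integral_diff)
    qed
    finally show ?thesis using U'(1) L'(1) by auto
  qed
qed

text \<open>Assume that lines that coincide at \<open>\<eta>\<close> carry no edge. Then, apart from the crossings, a slice that is not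
  empty at \<open>\<eta>\<close> has positive length and is bounded by the same two lines for all \<open>\<xi>\<close> near \<open>\<eta>\<close>; its mass is
  differentiable, with the density at its two ends times the velocities of these ends as derivative.\<close>
theorem mass_has_derivative:
  assumes G: "\<And>l. l \<in> U \<union> Lo \<Longrightarrow> (snd l has_derivative (\<lambda>h. G l \<bullet> h)) (at \<eta>)"
    and K: "\<And>l \<xi>. l \<in> U \<union> Lo \<Longrightarrow> \<bar>snd l \<xi> - snd l \<eta>\<bar> \<le> K * norm (\<xi> - \<eta>)"
    and M: "\<And>s y. \<bar>rho s y\<bar> \<le> M"
    and nondeg: "\<And>l l'. l \<in> U \<union> Lo \<Longrightarrow> l' \<in> U \<union> Lo \<Longrightarrow> l \<noteq> l' \<or> (l \<in> U \<and> l' \<in> Lo) \<Longrightarrow>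
      fst l = fst l' \<Longrightarrow> snd l \<eta> = snd l' \<eta> \<Longrightarrow> edge l \<eta> = {}"
  shows "(mass has_derivative (\<lambda>h. (\<Sum>l\<in>U. integral (edge l \<eta>) (\<lambda>s. rho s (line l \<eta> s)) * (G l \<bullet> h)) -
    (\<Sum>l\<in>Lo. integral (edge l \<eta>) (\<lambda>s. rho s (line l \<eta> s)) * (G l \<bullet> h)))) (at \<eta>)"
proof -
  define w where "w l s = rho s (line l \<eta> s)" for l s
  define D where "D s = (\<Sum>l\<in>U. if s \<in> edge l \<eta> then w l s *\<^sub>R G l else 0) -
    (\<Sum>l\<in>Lo. if s \<in> edge l \<eta> then w l s *\<^sub>R G l else 0)" for s
  have M0: "M \<ge> 0" using M[of 0 0] by linarith
  have wc: "continuous_on UNIV (w l)" if "l \<in> U \<union> Lo" for l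
    unfolding w_def
    by (intro continuous_on_apply2[OF rho_cont] continuous_intros continuous_on_section[OF line_continuous[OF that]])
  have Dh: "D s \<bullet> h = (\<Sum>l\<in>U. if s \<in> edge l \<eta> then w l s * (G l \<bullet> h) else 0) -
      (\<Sum>l\<in>Lo. if s \<in> edge l \<eta> then w l s * (G l \<bullet> h) else 0)" for s h
    by (auto simp: D_def inner_diff_left inner_sum_left if_distrib[of "\<lambda>x. x \<bullet> h"] intro!: arg_cong2[where f = minus] sum.cong)
  have int: "(\<lambda>s. if s \<in> edge l \<eta> then w l s * (G l \<bullet> h) else 0) integrable_on {-R..R}"
    "integral {-R..R} (\<lambda>s. if s \<in> edge l \<eta> then w l s * (G l \<bullet> h) else 0) = integral (edge l \<eta>) (w l) * (G l \<bullet> h)"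
    if "l \<in> U \<union> Lo" for l h
    using edge_integral_if[OF that continuous_on_mult[OF wc[OF that] continuous_on_const], of \<eta> "G l \<bullet> h"]
    by (auto simp: integral_mult_left)
  have "((\<lambda>\<xi>. integral {-R..R} (slice \<xi>)) has_derivative (\<lambda>h. integral {-R..R} (\<lambda>s. D s \<bullet> h))) (at \<eta>)"
  proof (rule has_derivative_integral_dominated[OF finite_crossings[of \<eta>] _ slice_integrable,
        where C = "2 * M * K" and C' = "(\<Sum>l\<in>U. M * norm (G l)) + (\<Sum>l\<in>Lo. M * norm (G l))"])
    show "(\<lambda>s. D s \<bullet> h) integrable_on {-R..R}" for h
      unfolding Dh by (intro integrable_diff integrable_sum int(1) fin) auto
  next
    fix s
    have "norm (\<Sum>l\<in>A. if s \<in> edge l \<eta> then w l s *\<^sub>R G l else 0) \<le> (\<Sum>l\<in>A. M * norm (G l))" for A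
      by (rule sum_norm_le) (use M M0 in \<open>auto simp: w_def intro!: mult_right_mono\<close>)
    then show "norm (D s) \<le> (\<Sum>l\<in>U. M * norm (G l)) + (\<Sum>l\<in>Lo. M * norm (G l))"
      unfolding D_def by (intro order_trans[OF norm_triangle_ineq4] add_mono)
  next
    fix \<xi> s
    have "\<bar>hi \<xi> s - hi \<eta> s\<bar> \<le> K * norm (\<xi> - \<eta>)" "\<bar>lo \<xi> s - lo \<eta> s\<bar> \<le> K * norm (\<xi> - \<eta>)"
      unfolding hi_def lo_def
      by (intro Min_image_diff_le Max_image_diff_le fin ne; use K in \<open>auto simp: line_def\<close>)+
    moreover from this have "\<bar>max (lo \<xi> s) (hi \<xi> s) - max (lo \<eta> s) (hi \<eta> s)\<bar> \<le> K * norm (\<xi> - \<eta>)" by linarith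
    ultimately have "M * \<bar>max (lo \<xi> s) (hi \<xi> s) - max (lo \<eta> s) (hi \<eta> s)\<bar> \<le> M * (K * norm (\<xi> - \<eta>))"
      "M * \<bar>lo \<xi> s - lo \<eta> s\<bar> \<le> M * (K * norm (\<xi> - \<eta>))"
      using M0 by (auto intro: mult_left_mono)
    note b = this
    have "\<bar>slice \<xi> s - slice \<eta> s\<bar> \<le> \<bar>sint (rho s) (max (lo \<xi> s) (hi \<xi> s)) - sint (rho s) (max (lo \<eta> s) (hi \<eta> s))\<bar>
        + \<bar>sint (rho s) (lo \<xi> s) - sint (rho s) (lo \<eta> s)\<bar>"
      unfolding slice_eq by linarith
    also have "\<dots> \<le> M * \<bar>max (lo \<xi> s) (hi \<xi> s) - max (lo \<eta> s) (hi \<eta> s)\<bar> + M * \<bar>lo \<xi> s - lo \<eta> s\<bar>"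
      by (intro add_mono sint_lipschitz rho_section M)
    also have "\<dots> \<le> M * (K * norm (\<xi> - \<eta>)) + M * (K * norm (\<xi> - \<eta>))"
      using b by (rule add_mono)
    also have "\<dots> = 2 * M * K * norm (\<xi> - \<eta>)" by simp
    finally show "\<bar>slice \<xi> s - slice \<eta> s\<bar> \<le> 2 * M * K * norm (\<xi> - \<eta>)" .
  next
    fix s assume s: "s \<in> {-R..R} - crossings \<eta>"
    have line_tendsto: "((\<lambda>\<xi>. line l \<xi> s) \<longlongrightarrow> line l \<eta> s) (nhds \<eta>)" if "l \<in> U \<union> Lo" for l
      unfolding line_def
      by (intro tendsto_intros continuous_on_tendsto_nhds C1_real_continuous C1 that)
    show "((\<lambda>\<xi>. slice \<xi> s) has_derivative (\<lambda>h. D s \<bullet> h)) (at \<eta>)"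
    proof (cases "lo \<eta> s \<le> hi \<eta> s")
      case False
      have "((\<lambda>\<xi>. lo \<xi> s - hi \<xi> s) \<longlongrightarrow> lo \<eta> s - hi \<eta> s) (nhds \<eta>)"
      proof -
        have "continuous_on UNIV (\<lambda>\<xi>. lo \<xi> s - hi \<xi> s)"
          by (intro continuous_intros continuous_on_apply2[OF lo_hi_continuous(1)] continuous_on_apply2[OF lo_hi_continuous(2)])
        then show ?thesis
          by (rule continuous_on_tendsto_nhds)
      qed
      then have "\<forall>\<^sub>F \<xi> in nhds \<eta>. lo \<xi> s - hi \<xi> s > 0" by (rule order_tendstoD) (use False in simp)
      then have ev: "\<forall>\<^sub>F \<xi> in nhds \<eta>. slice \<xi> s = 0" by eventually_elim (simp add: slice_def)
      have "D s = 0" unfolding D_def using False by (simp add: edge_empty)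
      then show ?thesis
        using has_derivative_eventually_eq[OF has_derivative_const ev] by simp
    next
      case True
      then obtain l m where lm: "l \<in> U" "line l \<eta> s = hi \<eta> s" "s \<in> edge l \<eta>" "m \<in> Lo" "line m \<eta> s = lo \<eta> s" "s \<in> edge m \<eta>"
        using active_line_exists[of s] s by blast
      have uU: "k = l" if "k \<in> U" "s \<in> edge k \<eta>" for k
        using active_line_unique[OF that(2) lm(3)] nondeg[of k l] that lm(1) s by auto
      have uL: "k = m" if "k \<in> Lo" "s \<in> edge k \<eta>" for k
        using active_line_unique[OF that(2) lm(6)] nondeg[of k m] that lm(4) s by auto
      have "line m \<eta> s \<noteq> line l \<eta> s"
      proof
        assume eq: "line m \<eta> s = line l \<eta> s"
        then have "fst l = fst m" using s lm(1,4) unfolding crossings_def by (metis (mono_tags, lifting) DiffD2 UnCI mem_Collect_eq)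
        moreover from this eq have "snd l \<eta> = snd m \<eta>" by (simp add: line_def)
        ultimately show False using nondeg[of l m] lm by auto
      qed
      then have lt: "line m \<eta> s < line l \<eta> s" using True lm by simp
      have e1: "\<forall>\<^sub>F \<xi> in nhds \<eta>. \<forall>k\<in>U. line l \<xi> s \<le> line k \<xi> s"
      proof (rule eventually_ball_finite[OF fin(1)], intro ballI)
        fix k assume k: "k \<in> U"
        show "\<forall>\<^sub>F \<xi> in nhds \<eta>. line l \<xi> s \<le> line k \<xi> s"
        proof (cases "k = l")
          case False
          then have "s \<notin> edge k \<eta>" using uU k by blast
          then have "line k \<eta> s \<noteq> line l \<eta> s" using lm(3) by (auto simp: edge_def)
          moreover have "line l \<eta> s \<le> line k \<eta> s" using lm(3) k by (auto simp: edge_iff)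
          ultimately have "\<forall>\<^sub>F \<xi> in nhds \<eta>. line k \<xi> s - line l \<xi> s > 0"
            using k lm(1) by (intro order_tendstoD(1)[OF tendsto_diff[OF line_tendsto line_tendsto]]) auto
          then show ?thesis by eventually_elim simp
        qed simp
      qed
      have e2: "\<forall>\<^sub>F \<xi> in nhds \<eta>. \<forall>k\<in>Lo. line k \<xi> s \<le> line m \<xi> s"
      proof (rule eventually_ball_finite[OF fin(2)], intro ballI)
        fix k assume k: "k \<in> Lo"
        show "\<forall>\<^sub>F \<xi> in nhds \<eta>. line k \<xi> s \<le> line m \<xi> s"
        proof (cases "k = m")
          case False
          then have "s \<notin> edge k \<eta>" using uL k by blast
          then have "line k \<eta> s \<noteq> line m \<eta> s" using lm(6) by (auto simp: edge_def)
          moreover have "line k \<eta> s \<le> line m \<eta> s" using lm(6) k by (auto simp: edge_iff)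
          ultimately have "\<forall>\<^sub>F \<xi> in nhds \<eta>. line m \<xi> s - line k \<xi> s > 0"
            using k lm(4) by (intro order_tendstoD(1)[OF tendsto_diff[OF line_tendsto line_tendsto]]) auto
          then show ?thesis by eventually_elim simp
        qed simp
      qed
      have e3: "\<forall>\<^sub>F \<xi> in nhds \<eta>. line l \<xi> s - line m \<xi> s > 0"
        using lm lt by (intro order_tendstoD(1)[OF tendsto_diff[OF line_tendsto line_tendsto]]) auto
      have ev: "\<forall>\<^sub>F \<xi> in nhds \<eta>. slice \<xi> s = sint (rho s) (line l \<xi> s) - sint (rho s) (line m \<xi> s)"
        using e1 e2 e3
      proof eventually_elim
        case (elim \<xi>)
        have "hi \<xi> s = line l \<xi> s" unfolding hi_def by (rule Min_eqI) (use fin lm elim in auto)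
        moreover have "lo \<xi> s = line m \<xi> s" unfolding lo_def by (rule Max_eqI) (use fin lm elim in auto)
        ultimately show ?case using elim by (simp add: slice_eq max_def)
      qed
      have sd: "((\<lambda>\<xi>. sint (rho s) (line k \<xi> s)) has_derivative (\<lambda>h. w k s * (G k \<bullet> h))) (at \<eta>)" if "k \<in> U \<union> Lo" for k
      proof -
        have "((\<lambda>\<xi>. line k \<xi> s) has_derivative (\<lambda>h. G k \<bullet> h)) (at \<eta>)"
          unfolding line_def using G[OF that] by (auto intro!: derivative_eq_intros)
        from has_derivative_compose[OF this sint_has_real_derivative[OF rho_section, unfolded has_field_derivative_def]]
        show ?thesis by (simp add: w_def)
      qed
      have Dlm: "D s \<bullet> h = w l s * (G l \<bullet> h) - w m s * (G m \<bullet> h)" for h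
      proof -
        have "(\<Sum>l\<in>U. if s \<in> edge l \<eta> then w l s * (G l \<bullet> h) else 0) = w l s * (G l \<bullet> h)"
          by (rule sum_if_unique[where A = U and l = l and f = "\<lambda>k. w k s * (G k \<bullet> h)" and P = "\<lambda>k. s \<in> edge k \<eta>", OF fin(1) lm(1) lm(3) uU])
        moreover have "(\<Sum>l\<in>Lo. if s \<in> edge l \<eta> then w l s * (G l \<bullet> h) else 0) = w m s * (G m \<bullet> h)"
          by (rule sum_if_unique[where A = Lo and l = m and f = "\<lambda>k. w k s * (G k \<bullet> h)" and P = "\<lambda>k. s \<in> edge k \<eta>", OF fin(2) lm(4) lm(6) uL])
        ultimately show ?thesis by (simp only: Dh)
      qed
      have sdlm: "((\<lambda>\<xi>. sint (rho s) (line l \<xi> s) - sint (rho s) (line m \<xi> s)) has_derivative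
          (\<lambda>h. w l s * (G l \<bullet> h) - w m s * (G m \<bullet> h))) (at \<eta>)"
        using lm(1,4) by (intro has_derivative_diff sd) auto
      show ?thesis unfolding Dlm by (rule has_derivative_eventually_eq[OF sdlm ev])
    qed
  qed
  moreover have "integral {-R..R} (\<lambda>s. D s \<bullet> h) = (\<Sum>l\<in>U. integral (edge l \<eta>) (w l) * (G l \<bullet> h)) -
      (\<Sum>l\<in>Lo. integral (edge l \<eta>) (w l) * (G l \<bullet> h))" for h
  proof -
    have "((\<lambda>s. if s \<in> edge l \<eta> then w l s * (G l \<bullet> h) else 0) has_integral integral (edge l \<eta>) (w l) * (G l \<bullet> h)) {-R..R}"
      if "l \<in> U \<union> Lo" for l
      using int[OF that] by (simp add: has_integral_iff)
    then show ?thesis unfolding Dh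
      by (intro integral_unique has_integral_diff has_integral_sum fin) auto
  qed
  ultimately show ?thesis by (simp add: mass_def[abs_def] w_def[abs_def])
qed

end

section \<open>The one-dimensional Hausdorff measure on segments\<close>
lemma hausdorff1_pre_le:
  "E \<subseteq> (\<Union>i. C i) \<Longrightarrow> (\<And>i. bounded (C i) \<and> diameter (C i) \<le> \<delta>) \<Longrightarrow>
    hausdorff1_pre \<delta> E \<le> (\<Sum>i. ennreal (diameter (C i)))"
  unfolding hausdorff1_pre_def by (rule INF_lower) auto

lemma hausdorff1_pre_mono: "E \<subseteq> F \<Longrightarrow> hausdorff1_pre \<delta> E \<le> hausdorff1_pre \<delta> F"
  unfolding hausdorff1_pre_def by (rule INF_superset_mono) auto

lemma hausdorff1_pre_antimono: "\<delta> \<le> \<delta>' \<Longrightarrow> hausdorff1_pre \<delta>' E \<le> hausdorff1_pre \<delta> E"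
  unfolding hausdorff1_pre_def by (rule INF_superset_mono) (auto intro: order_trans)

text \<open>Choose almost optimal coverings of the sets \<open>A i\<close> with errors \<open>e / 2 ^ (i + 1)\<close> and enumerate their union.\<close>
lemma hausdorff1_pre_Union:
  "hausdorff1_pre \<delta> (\<Union>i. A i) \<le> (\<Sum>i :: nat. hausdorff1_pre \<delta> (A i))"
proof (rule ennreal_le_epsilon)
  fix e :: real assume fin: "(\<Sum>i. hausdorff1_pre \<delta> (A i)) < top" and e: "0 < e"
  have finA: "hausdorff1_pre \<delta> (A i) < top" for i
    using ennreal_suminf_lessD[OF fin] .
  have "\<exists>C. A i \<subseteq> (\<Union>j. C j) \<and> (\<forall>j. bounded (C j) \<and> diameter (C j) \<le> \<delta>) \<and>
      (\<Sum>j. ennreal (diameter (C j))) \<le> hausdorff1_pre \<delta> (A i) + ennreal (e * (1/2) ^ Suc i)" for i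
  proof -
    have "hausdorff1_pre \<delta> (A i) < hausdorff1_pre \<delta> (A i) + ennreal (e * (1/2) ^ Suc i)"
      using finA[of i] e
      by (cases "hausdorff1_pre \<delta> (A i)" rule: ennreal_cases)
         (auto simp: ennreal_plus[symmetric] ennreal_less_iff simp del: ennreal_plus)
    then show ?thesis
      unfolding hausdorff1_pre_def[of \<delta> "A i"] INF_less_iff by (auto intro: less_imp_le)
  qed
  then obtain C where C: "\<And>i. A i \<subseteq> (\<Union>j. C i j)" "\<And>i j. bounded (C i j) \<and> diameter (C i j) \<le> \<delta>"
    "\<And>i. (\<Sum>j. ennreal (diameter (C i j))) \<le> hausdorff1_pre \<delta> (A i) + ennreal (e * (1/2) ^ Suc i)"
    by metis
  define C' where "C' n = case_prod C (prod_decode n)" for n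
  have "hausdorff1_pre \<delta> (\<Union>i. A i) \<le> (\<Sum>n. ennreal (diameter (C' n)))"
  proof (rule hausdorff1_pre_le)
    show "(\<Union>i. A i) \<subseteq> (\<Union>n. C' n)"
    proof
      fix x assume "x \<in> (\<Union>i. A i)"
      then obtain i j where "x \<in> C i j" using C(1) by blast
      then have "x \<in> C' (prod_encode (i, j))" by (simp add: C'_def)
      then show "x \<in> (\<Union>n. C' n)" by blast
    qed
    show "bounded (C' n) \<and> diameter (C' n) \<le> \<delta>" for n
      using C(2) by (simp add: C'_def split_beta)
  qed
  also have "\<dots> = (\<Sum>i. \<Sum>j. ennreal (diameter (C i j)))"
    using suminf_ennreal_2dimen[of "\<lambda>i. \<Sum>j. ennreal (diameter (C i j))" "\<lambda>(i, j). ennreal (diameter (C i j))"]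
    by (simp add: C'_def split_beta)
  also have "\<dots> \<le> (\<Sum>i. hausdorff1_pre \<delta> (A i) + ennreal (e * (1/2) ^ Suc i))"
    by (intro suminf_le C(3)) auto
  also have "\<dots> = (\<Sum>i. hausdorff1_pre \<delta> (A i)) + (\<Sum>i. ennreal (e * (1/2) ^ Suc i))"
    by (rule suminf_add[symmetric]) auto
  also have "(\<Sum>i. ennreal (e * (1/2) ^ Suc i)) = ennreal e"
    using sums_mult[OF power_half_series, of e] e by (intro suminf_ennreal_eq) auto
  finally show "hausdorff1_pre \<delta> (\<Union>i. A i) \<le> (\<Sum>i. hausdorff1_pre \<delta> (A i)) + ennreal e" .
qed

lemma hausdorff1_outer_seq: "hausdorff1_outer E = (SUP n. hausdorff1_pre (1 / real (Suc n)) E)"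
proof (rule antisym)
  show "hausdorff1_outer E \<le> (SUP n. hausdorff1_pre (1 / real (Suc n)) E)"
    unfolding hausdorff1_outer_def
  proof (rule SUP_least)
    fix \<delta> :: real assume "\<delta> \<in> {0<..}"
    then obtain n where "1 / real (Suc n) < \<delta>" using nat_approx_posE by auto
    then have "hausdorff1_pre \<delta> E \<le> hausdorff1_pre (1 / real (Suc n)) E"
      by (intro hausdorff1_pre_antimono) simp
    then show "hausdorff1_pre \<delta> E \<le> (SUP n. hausdorff1_pre (1 / real (Suc n)) E)"
      by (rule SUP_upper2[OF UNIV_I])
  qed
  show "(SUP n. hausdorff1_pre (1 / real (Suc n)) E) \<le> hausdorff1_outer E"
    unfolding hausdorff1_outer_def by (intro SUP_least SUP_upper) auto
qed

lemma incseq_hausdorff1_pre: "incseq (\<lambda>n. hausdorff1_pre (1 / real (Suc n)) E)"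
  by (intro monoI hausdorff1_pre_antimono) (simp add: frac_le)

lemma hausdorff1_outer_mono: "E \<subseteq> F \<Longrightarrow> hausdorff1_outer E \<le> hausdorff1_outer F"
  unfolding hausdorff1_outer_def by (intro SUP_mono) (auto intro: hausdorff1_pre_mono)

lemma hausdorff1_outer_empty [simp]: "hausdorff1_outer {} = 0"
proof -
  have "hausdorff1_pre \<delta> {} \<le> 0" if "\<delta> > 0" for \<delta>
    using hausdorff1_pre_le[of "{}" "\<lambda>_. {}" \<delta>] that by simp
  then have "hausdorff1_outer {} \<le> 0" unfolding hausdorff1_outer_def by (intro SUP_least) simp
  then show ?thesis by simp
qed

lemma hausdorff1_outer_Union:
  "hausdorff1_outer (\<Union>i. A i) \<le> (\<Sum>i :: nat. hausdorff1_outer (A i))"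
  unfolding hausdorff1_outer_def[of "\<Union>i. A i"]
proof (rule SUP_least)
  fix \<delta> :: real assume "\<delta> \<in> {0<..}"
  then have "hausdorff1_pre \<delta> (A i) \<le> hausdorff1_outer (A i)" for i
    unfolding hausdorff1_outer_def by (rule SUP_upper)
  then show "hausdorff1_pre \<delta> (\<Union>i. A i) \<le> (\<Sum>i. hausdorff1_outer (A i))"
    by (intro order_trans[OF hausdorff1_pre_Union] suminf_le) auto
qed

lemma hausdorff1_outer_Un: "hausdorff1_outer (A \<union> B) \<le> hausdorff1_outer A + hausdorff1_outer B"
proof -
  have "(\<Sum>i. hausdorff1_outer (binaryset A B i)) = hausdorff1_outer A + hausdorff1_outer B"
    by (rule suminf_binaryset_eq) simp
  then show ?thesis using hausdorff1_outer_Union[of "binaryset A B"] by (simp add: UN_binaryset_eq)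
qed

text \<open>Sets of diameter less than \<open>r\<close> cannot meet both \<open>A\<close> and \<open>B\<close>, so a fine covering of the union splits into
  coverings of the two parts.\<close>
lemma hausdorff1_outer_separated:
  assumes "r > 0" and sep: "\<And>x y. x \<in> A \<Longrightarrow> y \<in> B \<Longrightarrow> r \<le> dist x y"
  shows "hausdorff1_outer A + hausdorff1_outer B \<le> hausdorff1_outer (A \<union> B)"
proof -
  have pre: "hausdorff1_pre \<delta> A + hausdorff1_pre \<delta> B \<le> hausdorff1_pre \<delta> (A \<union> B)" if \<delta>: "0 < \<delta>" "\<delta> < r" for \<delta>
    unfolding hausdorff1_pre_def[of \<delta> "A \<union> B"]
  proof (rule INF_greatest)
    fix C :: "nat \<Rightarrow> 'a set" assume "C \<in> {C. A \<union> B \<subseteq> (\<Union>i. C i) \<and> (\<forall>i. bounded (C i) \<and> diameter (C i) \<le> \<delta>)}"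
    then have C: "A \<union> B \<subseteq> (\<Union>i. C i)" "\<And>i. bounded (C i)" "\<And>i. diameter (C i) \<le> \<delta>" by auto
    define P where "P S i = (if C i \<inter> S = {} then {} else C i)" for S i
    have pre_le: "hausdorff1_pre \<delta> S \<le> (\<Sum>i. ennreal (diameter (P S i)))" if SAB: "S \<subseteq> A \<union> B" for S
    proof (rule hausdorff1_pre_le)
      show "S \<subseteq> (\<Union>i. P S i)"
      proof
        fix x assume x: "x \<in> S"
        then obtain i where "x \<in> C i" using C(1) SAB by blast
        with x have "x \<in> P S i" by (auto simp: P_def)
        then show "x \<in> (\<Union>i. P S i)" by blast
      qed
      show "bounded (P S i) \<and> diameter (P S i) \<le> \<delta>" for i using C \<delta> by (simp add: P_def)
    qed
    have one: "diameter (P A i) + diameter (P B i) \<le> diameter (C i)" for i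
    proof -
      have "C i \<inter> A = {} \<or> C i \<inter> B = {}"
      proof (rule ccontr)
        assume "\<not> ?thesis"
        then obtain x y where "x \<in> C i" "x \<in> A" "y \<in> C i" "y \<in> B" by blast
        then show False using diameter_bounded_bound[OF C(2), of x i y] C(3)[of i] sep[of x y] \<delta>(2) by linarith
      qed
      then show ?thesis using diameter_ge_0[OF C(2)[of i]] by (auto simp: P_def)
    qed
    have "hausdorff1_pre \<delta> A + hausdorff1_pre \<delta> B \<le> (\<Sum>i. ennreal (diameter (P A i))) + (\<Sum>i. ennreal (diameter (P B i)))"
      by (intro add_mono pre_le) auto
    also have "\<dots> = (\<Sum>i. ennreal (diameter (P A i)) + ennreal (diameter (P B i)))"
      by (rule suminf_add) auto
    also have "\<dots> \<le> (\<Sum>i. ennreal (diameter (C i)))"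
    proof (intro suminf_le allI)
      fix i
      have "diameter (P A i) \<ge> 0" "diameter (P B i) \<ge> 0"
        using C(2) by (auto simp: P_def diameter_ge_0)
      then show "ennreal (diameter (P A i)) + ennreal (diameter (P B i)) \<le> ennreal (diameter (C i))"
        using one[of i] by (simp add: ennreal_plus[symmetric] ennreal_leI del: ennreal_plus)
    qed auto
    finally show "hausdorff1_pre \<delta> A + hausdorff1_pre \<delta> B \<le> (\<Sum>i. ennreal (diameter (C i)))" .
  qed
  have "hausdorff1_outer A + hausdorff1_outer B = (SUP n. hausdorff1_pre (1 / real (Suc n)) A + hausdorff1_pre (1 / real (Suc n)) B)"
    unfolding hausdorff1_outer_seq by (rule ennreal_SUP_add[symmetric]) (rule incseq_hausdorff1_pre)+
  also have "\<dots> \<le> hausdorff1_outer (A \<union> B)"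
  proof (rule SUP_least)
    fix n
    obtain m where m: "1 / real (Suc m) < r" using nat_approx_posE[OF assms(1)] by auto
    define \<delta> where "\<delta> = min (1 / real (Suc n)) (1 / real (Suc m))"
    have "hausdorff1_pre (1 / real (Suc n)) A + hausdorff1_pre (1 / real (Suc n)) B \<le> hausdorff1_pre \<delta> A + hausdorff1_pre \<delta> B"
      by (intro add_mono hausdorff1_pre_antimono) (auto simp: \<delta>_def)
    also have "\<dots> \<le> hausdorff1_pre \<delta> (A \<union> B)" using m by (intro pre) (auto simp: \<delta>_def)
    also have "\<dots> \<le> hausdorff1_outer (A \<union> B)"
      unfolding hausdorff1_outer_def by (rule SUP_upper) (simp add: \<delta>_def)
    finally show "hausdorff1_pre (1 / real (Suc n)) A + hausdorff1_pre (1 / real (Suc n)) B \<le> hausdorff1_outer (A \<union> B)" .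
  qed
  finally show ?thesis .
qed

lemma infdist_diff_le_dist: "infdist x C - infdist y C \<le> dist x y"
  using infdist_triangle[of x C y] by linarith

text \<open>The points of \<open>A\<close> at distance at least \<open>1 / (n + 1)\<close> from \<open>C\<close> are separated from \<open>A \<inter> C\<close>. They exhaust
  \<open>A - C\<close> also in outer measure, because the shells between consecutive distances have summable outer
  measures: every second shell is separated from the union of the preceding ones.\<close>
lemma hausdorff1_outer_closed_split:
  assumes "closed C" and "C \<noteq> {}"
  shows "hausdorff1_outer (A \<inter> C) + hausdorff1_outer (A - C) \<le> hausdorff1_outer A"
proof (cases "hausdorff1_outer A = \<infinity>")
  case False
  define d where "d x = infdist x C" for x
  define B where "B n = {x \<in> A - C. 1 / real (Suc n) \<le> d x}" for n
  define S where "S k = B (Suc k) - B k" for k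
  have Bmono: "B n \<subseteq> B m" if "n \<le> m" for n m
  proof -
    have "1 / real (Suc m) \<le> 1 / real (Suc n)" using that by (simp add: frac_le)
    then show ?thesis by (auto simp: B_def)
  qed
  have dpos: "d x > 0" if "x \<in> A - C" for x
    using that assms in_closed_iff_infdist_zero[OF assms] infdist_nonneg[of x C] by (auto simp: d_def less_le)
  have tele: "A - C = B n \<union> (\<Union>k. S (k + n))" for n
  proof
    show "B n \<union> (\<Union>k. S (k + n)) \<subseteq> A - C" by (auto simp: B_def S_def)
    show "A - C \<subseteq> B n \<union> (\<Union>k. S (k + n))"
    proof
      fix x assume x: "x \<in> A - C"
      obtain m0 where "1 / real (Suc m0) < d x" using nat_approx_posE[OF dpos[OF x]] by auto
      then have "x \<in> B m0" using x by (simp add: B_def)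
      define m where "m = (LEAST m. x \<in> B m)"
      have m: "x \<in> B m" unfolding m_def by (rule LeastI) fact
      show "x \<in> B n \<union> (\<Union>k. S (k + n))"
      proof (cases "m \<le> n")
        case True
        then show ?thesis using m Bmono by blast
      next
        case False
        then obtain k where k: "m = Suc (k + n)" by (metis add.commute add_Suc_right less_imp_Suc_add not_le)
        have "x \<notin> B (k + n)" using not_less_Least[of "k + n" "\<lambda>m. x \<in> B m"] k m_def by simp
        then have "x \<in> S (k + n)" using m k by (simp add: S_def)
        then show ?thesis by blast
      qed
    qed
  qed
  have dS: "1 / real (Suc (Suc k)) \<le> d x" "d x < 1 / real (Suc k)" if "x \<in> S k" for x k
    using that by (auto simp: S_def B_def)
  have alt: "(\<Sum>k<N. hausdorff1_outer (S (2 * k + j))) \<le> hausdorff1_outer A" for N j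
  proof -
    have "(\<Sum>k<N. hausdorff1_outer (S (2 * k + j))) \<le> hausdorff1_outer (\<Union>k<N. S (2 * k + j))"
    proof (induction N)
      case (Suc N)
      define r where "r = 1 / real (2 * N + j) - 1 / real (Suc (2 * N + j))"
      have "(\<Sum>k<Suc N. hausdorff1_outer (S (2 * k + j))) \<le> hausdorff1_outer (\<Union>k<N. S (2 * k + j)) + hausdorff1_outer (S (2 * N + j))"
        using Suc by (simp add: add_right_mono)
      also have "\<dots> \<le> hausdorff1_outer ((\<Union>k<N. S (2 * k + j)) \<union> S (2 * N + j))"
      proof (cases "N = 0")
        case False
        show ?thesis
        proof (rule hausdorff1_outer_separated)
          show "r > 0" using False by (simp add: r_def frac_less2)
          fix x y assume "x \<in> (\<Union>k<N. S (2 * k + j))" and y: "y \<in> S (2 * N + j)"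
          then obtain k where k: "k < N" "x \<in> S (2 * k + j)" by blast
          have "1 / real (2 * N + j) \<le> 1 / real (Suc (Suc (2 * k + j)))"
            using k(1) by (intro frac_le) auto
          then have "1 / real (2 * N + j) \<le> d x" using dS(1)[OF k(2)] by linarith
          then show "r \<le> dist x y" using dS(2)[OF y] infdist_diff_le_dist[of x C y] by (simp add: r_def d_def)
        qed
      qed simp
      also have "(\<Union>k<N. S (2 * k + j)) \<union> S (2 * N + j) = (\<Union>k<Suc N. S (2 * k + j))"
        by (auto simp: lessThan_Suc)
      finally show ?case .
    qed simp
    also have "\<dots> \<le> hausdorff1_outer A" by (intro hausdorff1_outer_mono) (auto simp: S_def B_def)
    finally show ?thesis .
  qed
  have "(\<Sum>k. hausdorff1_outer (S k)) \<le> 2 * hausdorff1_outer A"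
  proof (rule suminf_le_const)
    fix n
    have "(\<Sum>k<n. hausdorff1_outer (S k)) \<le> (\<Sum>k<2 * n. hausdorff1_outer (S k))"
      by (intro sum_mono2) auto
    also have "\<dots> = (\<Sum>k<n. hausdorff1_outer (S (2 * k + 0))) + (\<Sum>k<n. hausdorff1_outer (S (2 * k + 1)))"
      by (induction n) (auto simp: algebra_simps)
    also have "\<dots> \<le> hausdorff1_outer A + hausdorff1_outer A" by (intro add_mono alt)
    finally show "(\<Sum>k<n. hausdorff1_outer (S k)) \<le> 2 * hausdorff1_outer A" by (simp add: mult_2)
  qed auto
  then have fin: "(\<Sum>k. hausdorff1_outer (S k)) < top"
    using False by (metis ennreal_mult_less_top ennreal_numeral_less_top infinity_ennreal_def le_less_trans less_top)
  have finS: "hausdorff1_outer (S k) < top" for k using ennreal_suminf_lessD[OF fin] .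
  define g where "g k = enn2real (hausdorff1_outer (S k))" for k
  have gS: "hausdorff1_outer (S k) = ennreal (g k)" for k
    using finS by (simp add: g_def ennreal_enn2real_if less_top)
  have g0: "g k \<ge> 0" for k by (simp add: g_def)
  have gsum: "summable g" using fin g0 unfolding gS by (intro summable_suminf_not_top) (auto simp: less_top)
  show ?thesis
  proof (rule ennreal_le_epsilon)
    fix e :: real assume "e > 0"
    then obtain n where n: "norm (\<Sum>i. g (i + n)) < e"
      using suminf_exist_split[OF _ gsum] by blast
    have "hausdorff1_outer (A - C) \<le> hausdorff1_outer (B n) + hausdorff1_outer (\<Union>k. S (k + n))"
      unfolding tele[of n] by (rule hausdorff1_outer_Un)
    also have "hausdorff1_outer (\<Union>k. S (k + n)) \<le> (\<Sum>k. ennreal (g (k + n)))"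
      using hausdorff1_outer_Union[of "\<lambda>k. S (k + n)"] by (simp add: gS)
    also have "(\<Sum>k. ennreal (g (k + n))) = ennreal (\<Sum>k. g (k + n))"
      by (rule suminf_ennreal2) (use g0 gsum in \<open>auto simp: summable_iff_shift\<close>)
    also have "\<dots> \<le> ennreal e" using n by (intro ennreal_leI) simp
    finally have "hausdorff1_outer (A \<inter> C) + hausdorff1_outer (A - C) \<le> (hausdorff1_outer (A \<inter> C) + hausdorff1_outer (B n)) + ennreal e"
      by (simp add: add_mono add.assoc)
    also have "hausdorff1_outer (A \<inter> C) + hausdorff1_outer (B n) \<le> hausdorff1_outer (A \<inter> C \<union> B n)"
    proof (rule hausdorff1_outer_separated[of "1 / real (Suc n)"])
      fix x y assume "x \<in> A \<inter> C" "y \<in> B n"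
      then show "1 / real (Suc n) \<le> dist x y"
        using infdist_le[of x C y] by (auto simp: B_def d_def dist_commute)
    qed simp
    also have "\<dots> \<le> hausdorff1_outer A" by (rule hausdorff1_outer_mono) (auto simp: B_def)
    finally show "hausdorff1_outer (A \<inter> C) + hausdorff1_outer (A - C) \<le> hausdorff1_outer A + ennreal e"
      by (simp add: add_right_mono)
  qed
qed simp

text \<open>Caratheodory's criterion: the closed sets split every set additively, hence so do the Borel sets.\<close>
lemma emeasure_hausdorff1:
  assumes "B \<in> sets borel"
  shows "emeasure hausdorff1 B = hausdorff1_outer (B :: 'a::metric_space set)"
proof -
  let ?\<Lambda> = "lambda_system UNIV (Pow UNIV) (hausdorff1_outer :: 'a set \<Rightarrow> ennreal)"
  have oms: "outer_measure_space (Pow UNIV) (hausdorff1_outer :: 'a set \<Rightarrow> ennreal)"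
    by (auto simp: outer_measure_space_def positive_def increasing_def countably_subadditive_def
        intro: hausdorff1_outer_mono hausdorff1_outer_Union)
  interpret P: sigma_algebra "UNIV :: 'a set" "Pow UNIV" by (rule sigma_algebra_Pow)
  have ms: "measure_space UNIV ?\<Lambda> hausdorff1_outer"
    using P.caratheodory_lemma[OF oms] .
  have "C \<in> ?\<Lambda>" if "closed C" for C
  proof -
    have "hausdorff1_outer (x \<inter> C) + hausdorff1_outer (x - C) = hausdorff1_outer x" for x
    proof (rule antisym)
      show "hausdorff1_outer (x \<inter> C) + hausdorff1_outer (x - C) \<le> hausdorff1_outer x"
        using hausdorff1_outer_closed_split[OF that] by (cases "C = {}") auto
      show "hausdorff1_outer x \<le> hausdorff1_outer (x \<inter> C) + hausdorff1_outer (x - C)"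
        using hausdorff1_outer_Un[of "x \<inter> C" "x - C"] by (simp add: Int_Diff_Un)
    qed
    then show ?thesis unfolding P.lambda_system_eq by simp
  qed
  then have "sigma_sets UNIV (Collect closed) \<subseteq> ?\<Lambda>"
    using ms by (intro sigma_algebra.sigma_sets_subset) (auto simp: measure_space_def)
  then have sub: "sets borel \<subseteq> ?\<Lambda>" by (simp add: borel_eq_closed)
  have "countably_additive (sets borel) (hausdorff1_outer :: 'a set \<Rightarrow> ennreal)"
    using ms sub unfolding measure_space_def countably_additive_def by (meson order_trans subsetD)
  then show ?thesis unfolding hausdorff1_def
    using assms sets.sigma_algebra_axioms[of "borel :: 'a measure"]
    by (intro emeasure_measure_of_sigma) (auto simp: positive_def)
qed

lemma sets_hausdorff1 [simp]: "sets hausdorff1 = sets borel" and space_hausdorff1 [simp]: "space hausdorff1 = UNIV"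
  using sets.sigma_sets_eq[of borel] by (auto simp: hausdorff1_def sets_measure_of_conv space_measure_of_conv)

text \<open>A set of diameter \<open>d\<close> meets the line in a piece contained in a parameter interval of length \<open>d / norm v\<close>.\<close>
lemma hausdorff1_outer_line_ge:
  fixes p v :: "'a::real_inner"
  assumes v: "v \<noteq> 0" and E: "E \<in> sets borel"
  shows "ennreal (norm v) * emeasure lborel E \<le> hausdorff1_outer ((\<lambda>t. p + t *\<^sub>R v) ` E)"
proof -
  define \<gamma> where "\<gamma> t = p + t *\<^sub>R v" for t
  have \<gamma>d: "dist (\<gamma> s) (\<gamma> t) = norm v * \<bar>s - t\<bar>" for s t
    by (simp add: \<gamma>_def dist_norm mult.commute flip: scaleR_left_diff_distrib)
  have nv: "norm v > 0" using v by simp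
  have "ennreal (norm v) * emeasure lborel E \<le> hausdorff1_pre 1 (\<gamma> ` E)"
    unfolding hausdorff1_pre_def
  proof (rule INF_greatest)
    fix C :: "nat \<Rightarrow> 'a set" assume "C \<in> {C. \<gamma> ` E \<subseteq> (\<Union>i. C i) \<and> (\<forall>i. bounded (C i) \<and> diameter (C i) \<le> 1)}"
    then have C: "\<gamma> ` E \<subseteq> (\<Union>i. C i)" "\<And>i. bounded (C i)" by auto
    have "\<exists>a. \<gamma> -` C i \<subseteq> {a..a + diameter (C i) / norm v}" for i
    proof (cases "\<gamma> -` C i = {}")
      case False
      have close: "\<bar>s - t\<bar> \<le> diameter (C i) / norm v" if "s \<in> \<gamma> -` C i" "t \<in> \<gamma> -` C i" for s t
        using diameter_bounded_bound[OF C(2), of "\<gamma> s" i "\<gamma> t"] that nv by (simp add: \<gamma>d field_simps)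
      obtain t0 where t0: "t0 \<in> \<gamma> -` C i" using False by blast
      have bdd: "bdd_below (\<gamma> -` C i)"
      proof (rule bdd_belowI)
        fix t assume "t \<in> \<gamma> -` C i"
        then show "t0 - diameter (C i) / norm v \<le> t" using close[OF t0] by fastforce
      qed
      have "s \<le> Inf (\<gamma> -` C i) + diameter (C i) / norm v" if "s \<in> \<gamma> -` C i" for s
      proof -
        have "s - diameter (C i) / norm v \<le> Inf (\<gamma> -` C i)"
        proof (rule cInf_greatest[OF False])
          fix t assume "t \<in> \<gamma> -` C i"
          then show "s - diameter (C i) / norm v \<le> t" using close[OF that] by fastforce
        qed
        then show ?thesis by linarith
      qed
      then show ?thesis using cInf_lower[OF _ bdd] by (intro exI[of _ "Inf (\<gamma> -` C i)"]) auto
    qed auto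
    then obtain a where a: "\<And>i. \<gamma> -` C i \<subseteq> {a i..a i + diameter (C i) / norm v}" by metis
    have "E \<subseteq> (\<Union>i. {a i..a i + diameter (C i) / norm v})"
    proof
      fix t assume "t \<in> E"
      then obtain i where "\<gamma> t \<in> C i" using C(1) by blast
      then show "t \<in> (\<Union>i. {a i..a i + diameter (C i) / norm v})" using a[of i] by blast
    qed
    then have "emeasure lborel E \<le> emeasure lborel (\<Union>i. {a i..a i + diameter (C i) / norm v})"
      by (rule emeasure_mono) auto
    also have "\<dots> \<le> (\<Sum>i. emeasure lborel {a i..a i + diameter (C i) / norm v})"
      by (rule emeasure_subadditive_countably) auto
    also have "\<dots> = (\<Sum>i. ennreal (diameter (C i) / norm v))"
      using C(2) by (simp add: diameter_ge_0)
    finally have "ennreal (norm v) * emeasure lborel E \<le> ennreal (norm v) * (\<Sum>i. ennreal (diameter (C i) / norm v))"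
      by (rule mult_left_mono) simp
    also have "\<dots> = (\<Sum>i. ennreal (norm v) * ennreal (diameter (C i) / norm v))" by simp
    also have "\<dots> = (\<Sum>i. ennreal (diameter (C i)))"
      using nv by (simp add: ennreal_mult'[symmetric])
    finally show "ennreal (norm v) * emeasure lborel E \<le> (\<Sum>i. ennreal (diameter (C i)))" .
  qed
  also have "\<dots> \<le> hausdorff1_outer (\<gamma> ` E)"
    unfolding hausdorff1_outer_def by (rule SUP_upper) simp
  finally show ?thesis by (simp add: \<gamma>_def[abs_def])
qed

text \<open>Cover by \<open>n\<close> equal pieces.\<close>
lemma hausdorff1_outer_segment_le:
  fixes p v :: "'a::real_inner"
  assumes ab: "a \<le> b"
  shows "hausdorff1_outer ((\<lambda>t. p + t *\<^sub>R v) ` {a..b}) \<le> ennreal (norm v * (b - a))"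
  unfolding hausdorff1_outer_def
proof (rule SUP_least)
  fix \<delta> :: real assume "\<delta> \<in> {0<..}"
  define \<gamma> where "\<gamma> t = p + t *\<^sub>R v" for t
  have \<gamma>d: "dist (\<gamma> s) (\<gamma> t) = norm v * \<bar>s - t\<bar>" for s t
    by (simp add: \<gamma>_def dist_norm mult.commute flip: scaleR_left_diff_distrib)
  obtain n0 :: nat where n0: "norm v * (b - a) / \<delta> < real n0" using reals_Archimedean2 by blast
  define n where "n = Suc n0"
  have n: "norm v * (b - a) / \<delta> < real n" "n > 0" using n0 by (auto simp: n_def)
  define h where "h = (b - a) / real n"
  have h: "h \<ge> 0" "real n * h = b - a" using ab n(2) by (auto simp: h_def)
  have "norm v * (b - a) < \<delta> * real n" using n \<open>\<delta> \<in> _\<close> by (simp add: field_simps)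
  then have "norm v * h * real n < \<delta> * real n" by (simp add: mult_ac flip: h(2))
  then have h\<delta>: "norm v * h \<le> \<delta>" using n(2) by simp
  define C where "C i = (if i < n then \<gamma> ` {a + real i * h..a + real (Suc i) * h} else {})" for i
  have bC: "bounded (C i)" for i
  proof -
    have "continuous_on {a + real i * h..a + real (Suc i) * h} \<gamma>" unfolding \<gamma>_def by (intro continuous_intros)
    then show ?thesis unfolding C_def using compact_imp_bounded[OF compact_continuous_image] by (auto simp del: of_nat_Suc)
  qed
  have dC: "diameter (C i) \<le> norm v * h" for i
  proof (rule diameter_le)
    show "C i \<noteq> {} \<or> 0 \<le> norm v * h" using h(1) by simp
    fix x y assume "x \<in> C i" "y \<in> C i"
    then obtain s t where st: "x = \<gamma> s" "y = \<gamma> t" "s \<in> {a + real i * h..a + real (Suc i) * h}" "t \<in> {a + real i * h..a + real (Suc i) * h}"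
      by (auto simp: C_def split: if_splits)
    then have "\<bar>s - t\<bar> \<le> h" by (auto simp: algebra_simps)
    then show "norm (x - y) \<le> norm v * h" using \<gamma>d[of s t] st by (simp add: dist_norm mult_left_mono)
  qed
  have "\<gamma> ` {a..b} \<subseteq> (\<Union>i. C i)"
  proof
    fix x assume "x \<in> \<gamma> ` {a..b}"
    then obtain t where t: "t \<in> {a..b}" "x = \<gamma> t" by blast
    have "\<exists>i<n. t \<in> {a + real i * h..a + real (Suc i) * h}"
    proof -
      define i where "i = (LEAST i. t \<le> a + real (Suc i) * h)"
      have ex: "t \<le> a + real (Suc (n - 1)) * h" using t(1) h(2) n(2) by simp
      have i: "t \<le> a + real (Suc i) * h" unfolding i_def by (rule LeastI) (rule ex)
      have "i \<le> n - 1" unfolding i_def by (rule Least_le) (rule ex)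
      moreover have "a + real i * h \<le> t"
      proof (cases i)
        case 0 then show ?thesis using t(1) by simp
      next
        case (Suc j)
        then have "\<not> t \<le> a + real (Suc j) * h" unfolding i_def using not_less_Least lessI by metis
        then show ?thesis using Suc by simp
      qed
      ultimately show ?thesis using i n(2) by (intro exI[of _ i]) auto
    qed
    then show "x \<in> (\<Union>i. C i)" using t(2) by (auto simp: C_def simp del: of_nat_Suc)
  qed
  then have "hausdorff1_pre \<delta> (\<gamma> ` {a..b}) \<le> (\<Sum>i. ennreal (diameter (C i)))"
    using bC order_trans[OF dC h\<delta>] by (intro hausdorff1_pre_le) auto
  also have "\<dots> = (\<Sum>i<n. ennreal (diameter (C i)))"
    by (rule suminf_finite) (auto simp: C_def)
  also have "\<dots> \<le> (\<Sum>i<n. ennreal (norm v * h))"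
    using dC by (intro sum_mono ennreal_leI)
  also have "\<dots> = ennreal (norm v * (b - a))"
    using h by (simp add: ennreal_of_nat_eq_real_of_nat ennreal_mult''[symmetric] flip: h(2))
  finally show "hausdorff1_pre \<delta> ((\<lambda>t. p + t *\<^sub>R v) ` {a..b}) \<le> ennreal (norm v * (b - a))"
    by (simp add: \<gamma>_def[abs_def])
qed

lemma line_image_borel:
  fixes p v :: "'a::euclidean_space"
  assumes v: "v \<noteq> 0" and E: "E \<in> sets borel"
  shows "(\<lambda>t. p + t *\<^sub>R v) ` E \<in> sets borel"
proof -
  define \<pi> where "\<pi> x = ((x - p) \<bullet> v) / (v \<bullet> v)" for x
  have \<pi>c: "continuous_on UNIV \<pi>" unfolding \<pi>_def by (intro continuous_intros) (use v in auto)
  have "(\<lambda>t. p + t *\<^sub>R v) ` E = {x. p + \<pi> x *\<^sub>R v = x} \<inter> \<pi> -` E"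
  proof safe
    fix t assume "t \<in> E"
    have "\<pi> (p + t *\<^sub>R v) = t" using v by (simp add: \<pi>_def)
    then show "p + \<pi> (p + t *\<^sub>R v) *\<^sub>R v = p + t *\<^sub>R v" "p + t *\<^sub>R v \<in> \<pi> -` E" using \<open>t \<in> E\<close> by auto
  next
    fix x assume "p + \<pi> x *\<^sub>R v = x" "\<pi> x \<in> E"
    then show "x \<in> (\<lambda>t. p + t *\<^sub>R v) ` E" by (metis imageI)
  qed
  moreover have "closed {x. p + \<pi> x *\<^sub>R v = x}"
    by (intro closed_Collect_eq continuous_intros \<pi>c)
  moreover have "\<pi> -` E \<in> sets borel"
    using measurable_sets[OF borel_measurable_continuous_onI[OF \<pi>c] E] by simp
  ultimately show ?thesis by (auto intro: borel_closed)
qed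

text \<open>Both \<open>E\<close> and its complement in \<open>{a..b}\<close> satisfy the lower bound, and their sum satisfies the upper
  bound; hence equality holds for both.\<close>
lemma emeasure_hausdorff1_line:
  fixes p v :: "'a::euclidean_space"
  assumes v: "v \<noteq> 0" and E: "E \<in> sets borel" "E \<subseteq> {a..b}" and ab: "a \<le> b"
  shows "emeasure hausdorff1 ((\<lambda>t. p + t *\<^sub>R v) ` E) = ennreal (norm v) * emeasure lborel E"
proof -
  define \<gamma> where "\<gamma> t = p + t *\<^sub>R v" for t
  have bor: "\<gamma> ` F \<in> sets borel" if "F \<in> sets borel" for F
    using line_image_borel[OF v that, of p] by (simp add: \<gamma>_def[abs_def])
  have ge: "ennreal (norm v) * emeasure lborel F \<le> emeasure hausdorff1 (\<gamma> ` F)" if "F \<in> sets borel" for F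
    using hausdorff1_outer_line_ge[OF v that, of p] unfolding emeasure_hausdorff1[OF bor[OF that]] by (simp add: \<gamma>_def[abs_def])
  define F where "F = {a..b} - E"
  have F: "F \<in> sets borel" using E by (simp add: F_def)
  have inj: "inj \<gamma>" using v by (auto simp: inj_def \<gamma>_def)
  have "emeasure hausdorff1 (\<gamma> ` E) + emeasure hausdorff1 (\<gamma> ` F) = emeasure hausdorff1 (\<gamma> ` {a..b})"
  proof -
    have "\<gamma> ` E \<union> \<gamma> ` F = \<gamma> ` {a..b}" using E(2) by (auto simp: F_def)
    moreover have "\<gamma> ` E \<inter> \<gamma> ` F = {}" using inj by (auto simp: F_def inj_eq)
    ultimately show ?thesis using plus_emeasure[of "\<gamma> ` E" hausdorff1 "\<gamma> ` F"] bor E F by simp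
  qed
  also have "\<dots> \<le> ennreal (norm v * (b - a))"
    using hausdorff1_outer_segment_le[OF ab, of p v] by (subst emeasure_hausdorff1[OF bor]) (simp_all add: \<gamma>_def[abs_def])
  also have "\<dots> = ennreal (norm v) * (emeasure lborel E + emeasure lborel F)"
    using plus_emeasure[of E lborel F] E F ab by (simp add: F_def Un_absorb1 ennreal_mult)
  finally have le: "emeasure hausdorff1 (\<gamma> ` E) + emeasure hausdorff1 (\<gamma> ` F) \<le>
      ennreal (norm v) * emeasure lborel E + ennreal (norm v) * emeasure lborel F"
    by (simp add: distrib_left)
  have "emeasure lborel F \<le> emeasure lborel {a..b}" by (rule emeasure_mono) (auto simp: F_def)
  then have "ennreal (norm v) * emeasure lborel F < top"
    using ab by (simp add: ennreal_mult_less_top order_le_less_trans)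
  moreover have "emeasure hausdorff1 (\<gamma> ` E) + ennreal (norm v) * emeasure lborel F \<le>
      ennreal (norm v) * emeasure lborel E + ennreal (norm v) * emeasure lborel F"
    using le ge[OF F] by (meson add_left_mono order_trans)
  ultimately have "emeasure hausdorff1 (\<gamma> ` E) \<le> ennreal (norm v) * emeasure lborel E"
    using ennreal_add_left_cancel_le[of "ennreal (norm v) * emeasure lborel F"]
    by (auto simp: less_top add.commute)
  then show ?thesis using ge[OF E(1)] by (simp add: \<gamma>_def[abs_def] antisym)
qed

theorem hausdorff1_segment_integral:
  fixes p v :: "'a::euclidean_space" and f :: "'a \<Rightarrow> real"
  assumes v: "v \<noteq> 0" and ab: "a \<le> b" and f: "continuous_on UNIV f"
  shows "(LINT x:(\<lambda>t. p + t *\<^sub>R v) ` {a..b}|hausdorff1. f x) = norm v * integral {a..b} (\<lambda>t. f (p + t *\<^sub>R v))"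
proof -
  define \<gamma> where "\<gamma> t = p + t *\<^sub>R v" for t
  define w where "w t = norm v * indicator {a..b} t" for t :: real
  have \<gamma>c: "continuous_on UNIV \<gamma>" unfolding \<gamma>_def by (intro continuous_intros)
  have \<gamma>m: "\<gamma> \<in> borel_measurable borel" by (rule borel_measurable_continuous_onI[OF \<gamma>c])
  have fm: "f \<in> borel_measurable borel" by (rule borel_measurable_continuous_onI[OF f])
  have S: "\<gamma> ` {a..b} \<in> sets borel"
    using line_image_borel[OF v, of "{a..b}" p] by (simp add: \<gamma>_def[abs_def])
  have eq: "density hausdorff1 (\<lambda>x. ennreal (indicator (\<gamma> ` {a..b}) x)) = distr (density lborel (\<lambda>t. ennreal (w t))) borel \<gamma>"
  proof (rule measure_eqI)
    fix B assume "B \<in> sets (density hausdorff1 (\<lambda>x. ennreal (indicator (\<gamma> ` {a..b}) x)))"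
    then have B: "B \<in> sets borel" by simp
    have \<gamma>B: "\<gamma> -` B \<in> sets borel" using measurable_sets[OF \<gamma>m B] by simp
    have "emeasure (density hausdorff1 (\<lambda>x. ennreal (indicator (\<gamma> ` {a..b}) x))) B = emeasure hausdorff1 (\<gamma> ` {a..b} \<inter> B)"
      using S B by (simp add: ennreal_indicator emeasure_restricted)
    also have "\<gamma> ` {a..b} \<inter> B = \<gamma> ` ({a..b} \<inter> \<gamma> -` B)" by auto
    also have "emeasure hausdorff1 \<dots> = ennreal (norm v) * emeasure lborel ({a..b} \<inter> \<gamma> -` B)"
      using emeasure_hausdorff1_line[OF v _ _ ab, of "{a..b} \<inter> \<gamma> -` B" p] \<gamma>B by (simp add: \<gamma>_def[abs_def])
    also have "\<dots> = (\<integral>\<^sup>+ t. ennreal (norm v) * indicator ({a..b} \<inter> \<gamma> -` B) t \<partial>lborel)"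
      using \<gamma>B by (simp add: nn_integral_cmult_indicator)
    also have "\<dots> = (\<integral>\<^sup>+ t. ennreal (w t) * indicator (\<gamma> -` B) t \<partial>lborel)"
      by (rule nn_integral_cong) (auto simp: w_def indicator_def)
    also have "\<dots> = emeasure (density lborel (\<lambda>t. ennreal (w t))) (\<gamma> -` B)"
      using \<gamma>B by (subst emeasure_density) (auto simp: w_def)
    also have "\<dots> = emeasure (distr (density lborel (\<lambda>t. ennreal (w t))) borel \<gamma>) B"
      using B \<gamma>m by (subst emeasure_distr) auto
    finally show "emeasure (density hausdorff1 (\<lambda>x. ennreal (indicator (\<gamma> ` {a..b}) x))) B =
        emeasure (distr (density lborel (\<lambda>t. ennreal (w t))) borel \<gamma>) B" .
  qed simp
  have "(LINT x:\<gamma> ` {a..b}|hausdorff1. f x) = integral\<^sup>L (density hausdorff1 (\<lambda>x. ennreal (indicator (\<gamma> ` {a..b}) x))) f"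
    unfolding set_lebesgue_integral_def
    by (rule integral_density[symmetric])
       (use fm S in \<open>auto simp: measurable_cong_sets[OF sets_hausdorff1 refl]\<close>)
  also have "\<dots> = (LINT t|density lborel (\<lambda>t. ennreal (w t)). f (\<gamma> t))"
    unfolding eq by (rule integral_distr) (use \<gamma>m fm in auto)
  also have "\<dots> = (LINT t|lborel. w t *\<^sub>R f (\<gamma> t))"
    by (rule integral_density) (use \<gamma>m fm in \<open>auto simp: w_def\<close>)
  also have "\<dots> = norm v * (LINT t:{a..b}|lborel. f (\<gamma> t))"
    by (simp add: set_lebesgue_integral_def w_def mult.assoc)
  also have "(LINT t:{a..b}|lborel. f (\<gamma> t)) = integral {a..b} (\<lambda>t. f (\<gamma> t))"
    by (intro set_borel_integral_eq_integral borel_integrable_atLeastAtMost' continuous_on_compose2[OF f]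
        continuous_on_subset[OF \<gamma>c]) auto
  finally show ?thesis by (simp add: \<gamma>_def[abs_def])
qed

section \<open>Sheared coordinates of the plane\<close>
text \<open>The lines of constant \<open>s\<close> have direction \<open>(\<kappa>, 1)\<close>, and areas are preserved.\<close>
definition shear :: "real \<Rightarrow> real \<Rightarrow> real \<Rightarrow> real^2" where
  "shear \<kappa> s y = vector [s + \<kappa> * y, y]"

lemma shear_nth [simp]: "shear \<kappa> s y $ 1 = s + \<kappa> * y" "shear \<kappa> s y $ 2 = y"
  by (simp_all add: shear_def)

lemma continuous_on_vector2 [continuous_intros]:
  fixes f g :: "'a::topological_space \<Rightarrow> real"
  assumes "continuous_on S f" "continuous_on S g"
  shows "continuous_on S (\<lambda>x. vector [f x, g x] :: real^2)"
proof -
  have eq: "(\<lambda>x. vector [f x, g x] :: real^2) = (\<lambda>x. \<chi> i. if i = 1 then f x else g x)"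
    by (auto simp: vec_eq_iff forall_2)
  have "continuous_on S (\<lambda>x. if i = 1 then f x else g x)" for i :: 2
    using assms by (cases "i = 1") auto
  then show ?thesis unfolding eq by (rule continuous_on_vec_lambda)
qed

lemma continuous_on_shear [continuous_intros]:
  "continuous_on S f \<Longrightarrow> continuous_on S g \<Longrightarrow> continuous_on S (\<lambda>x. shear \<kappa> (f x) (g x))"
  unfolding shear_def by (intro continuous_intros)

lemma lborel_vec2: "lborel = distr (lborel \<Otimes>\<^sub>M lborel) borel (\<lambda>(s, y). vector [s, y] :: real^2)"
proof (rule lborel_eqI)
  have m: "(\<lambda>(s, y). vector [s, y] :: real^2) \<in> (lborel \<Otimes>\<^sub>M lborel) \<rightarrow>\<^sub>M borel"
    unfolding lborel_prod
    by (simp add: case_prod_unfold) (intro borel_measurable_continuous_onI continuous_intros)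
  fix l u :: "real^2" assume lu: "\<And>b. b \<in> Basis \<Longrightarrow> l \<bullet> b \<le> u \<bullet> b"
  have le: "l $ i \<le> u $ i" for i using lu[of "axis i 1"] by (simp add: inner_axis axis_in_Basis_iff)
  have pre: "(\<lambda>(s, y). vector [s, y] :: real^2) -` box l u \<inter> space (lborel \<Otimes>\<^sub>M lborel) = {l$1<..<u$1} \<times> {l$2<..<u$2}"
    by (auto simp: mem_box_cart forall_2 space_pair_measure)
  have B: "(Basis :: (real^2) set) = (\<lambda>i. axis i 1) ` UNIV" by (auto simp: Basis_vec_def)
  have "emeasure (distr (lborel \<Otimes>\<^sub>M lborel) borel (\<lambda>(s, y). vector [s, y] :: real^2)) (box l u)
      = emeasure (lborel \<Otimes>\<^sub>M lborel) ({l$1<..<u$1} \<times> {l$2<..<u$2})"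
    using pre by (subst emeasure_distr[OF m]) auto
  also have "\<dots> = ennreal (u$1 - l$1) * ennreal (u$2 - l$2)"
    using le by (subst lborel.emeasure_pair_measure_Times) auto
  also have "\<dots> = (\<Prod>b\<in>Basis. (u - l) \<bullet> b)"
    unfolding B using le
    by (subst prod.reindex) (auto simp: inj_on_def axis_eq_axis UNIV_2 inner_axis ennreal_mult prod_ennreal)
  finally show "emeasure (distr (lborel \<Otimes>\<^sub>M lborel) borel (\<lambda>(s, y). vector [s, y] :: real^2)) (box l u) = (\<Prod>b\<in>Basis. (u - l) \<bullet> b)" .
qed simp

lemma nn_integral_shear:
  fixes F :: "real^2 \<Rightarrow> ennreal"
  assumes F: "F \<in> borel_measurable borel"
  shows "(\<integral>\<^sup>+ x. F x \<partial>lborel) = (\<integral>\<^sup>+ s. \<integral>\<^sup>+ y. F (shear \<kappa> s y) \<partial>lborel \<partial>lborel)"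
proof -
  have m: "(\<lambda>z :: real \<times> real. vector [fst z, snd z] :: real^2) \<in> borel_measurable borel"
    by (intro borel_measurable_continuous_onI continuous_intros)
  have Fm: "(\<lambda>z :: real \<times> real. F (vector [fst z, snd z])) \<in> borel_measurable (lborel \<Otimes>\<^sub>M lborel)"
    using measurable_compose[OF m F] by (simp add: lborel_prod)
  have m2: "(\<lambda>z :: real \<times> real. shear \<kappa> (fst z) (snd z)) \<in> borel_measurable borel"
    by (intro borel_measurable_continuous_onI continuous_intros)
  have Sm: "(\<lambda>z :: real \<times> real. F (shear \<kappa> (fst z) (snd z))) \<in> borel_measurable (lborel \<Otimes>\<^sub>M lborel)"
    using measurable_compose[OF m2 F] by (simp add: lborel_prod)
  have "(\<integral>\<^sup>+ x. F x \<partial>lborel) = (\<integral>\<^sup>+ z. F (vector [fst z, snd z]) \<partial>(lborel \<Otimes>\<^sub>M lborel))"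
    by (subst lborel_vec2, subst nn_integral_distr)
       (use F m in \<open>auto simp: split_beta lborel_prod\<close>)
  also have "\<dots> = (\<integral>\<^sup>+ y. \<integral>\<^sup>+ s. F (vector [s, y]) \<partial>lborel \<partial>lborel)"
    using lborel_pair.nn_integral_snd[OF Fm] by simp
  also have "\<dots> = (\<integral>\<^sup>+ y. \<integral>\<^sup>+ s. F (shear \<kappa> s y) \<partial>lborel \<partial>lborel)"
  proof (rule nn_integral_cong)
    fix y :: real
    have "(\<lambda>s. F (vector [s, y])) \<in> borel_measurable borel"
      by (rule measurable_compose[OF _ F]) (intro borel_measurable_continuous_onI continuous_intros)
    then show "(\<integral>\<^sup>+ s. F (vector [s, y]) \<partial>lborel) = (\<integral>\<^sup>+ s. F (shear \<kappa> s y) \<partial>lborel)"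
      using nn_integral_real_affine[of "\<lambda>s. F (vector [s, y])" 1 "\<kappa> * y"] by (simp add: shear_def add.commute)
  qed
  also have "\<dots> = (\<integral>\<^sup>+ s. \<integral>\<^sup>+ y. F (shear \<kappa> s y) \<partial>lborel \<partial>lborel)"
    using lborel_pair.Fubini'[of "\<lambda>s y. F (shear \<kappa> s y)"] Sm by (simp add: split_beta)
  finally show ?thesis .
qed

lemma nn_integral_continuous_interval:
  fixes f :: "real \<Rightarrow> real"
  assumes f: "continuous_on UNIV f" and pos: "\<And>x. 0 \<le> f x"
  shows "(\<integral>\<^sup>+ x. ennreal (f x) * indicator {a..b} x \<partial>lborel) = ennreal (integral {a..b} f)"
proof -
  have fm: "f \<in> borel_measurable borel" by (rule borel_measurable_continuous_onI[OF f])
  have "(\<integral>\<^sup>+ x. ennreal (f x) * indicator {a..b} x \<partial>lborel) = (\<integral>\<^sup>+ x. ennreal (if x \<in> {a..b} then f x else 0) \<partial>lborel)"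
    by (rule nn_integral_cong) (auto simp: indicator_def)
  also have "\<dots> = ennreal (integral {a..b} f)"
  proof (rule nn_integral_has_integral_lborel)
    show "((\<lambda>x. if x \<in> {a..b} then f x else 0) has_integral integral {a..b} f) UNIV"
      unfolding has_integral_restrict_UNIV
      by (intro integrable_integral integrable_continuous_real continuous_on_subset[OF f]) simp
  qed (use fm pos in auto)
  finally show ?thesis .
qed

text \<open>Each line excludes at most one value of \<open>\<kappa>\<close>.\<close>
lemma transversal_direction:
  fixes V :: "(real^2) set"
  assumes "finite V" "0 \<notin> V"
  obtains \<kappa> where "\<And>c. c \<in> V \<Longrightarrow> c$1 * \<kappa> + c$2 \<noteq> 0"
proof -
  have "\<exists>\<kappa>. \<kappa> \<notin> (\<lambda>c. - (c$2) / c$1) ` V"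
    using ex_new_if_finite[OF infinite_UNIV_char_0] assms(1) by blast
  then obtain \<kappa> where \<kappa>: "\<kappa> \<notin> (\<lambda>c. - (c$2) / c$1) ` V" by blast
  show thesis
  proof (rule that[of \<kappa>])
    fix c assume c: "c \<in> V"
    have "c = 0" if "c$1 = 0" "c$2 = 0" using that by (simp add: vec_eq_iff forall_2)
    then have nz: "c$1 \<noteq> 0 \<or> c$2 \<noteq> 0" using c assms(2) by blast
    show "c$1 * \<kappa> + c$2 \<noteq> 0"
    proof (cases "c$1 = 0")
      case False
      have "\<kappa> \<noteq> - (c$2) / c$1" using \<kappa> c by blast
      then show ?thesis using False by (auto simp: field_simps)
    qed (use nz in simp)
  qed
qed

section \<open>Cells as polygons with moving sides\<close>
locale semidiscrete =
  fixes a :: "'n::finite \<Rightarrow> real^2" and D :: "(real^2) set" and \<mu> :: "(real^2) measure" and \<rho> :: "real^2 \<Rightarrow> real"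
  assumes inj_a: "inj a" and polytope: "polytope D" and int_ne: "interior D \<noteq> {}"
    and dens_cont: "continuous_on D \<rho>" and dens_nonneg: "\<And>x. x \<in> D \<Longrightarrow> 0 \<le> \<rho> x"
    and \<mu>: "\<mu> = density (restrict_space lborel D) (\<lambda>x. ennreal (\<rho> x))"
begin

lemma D: "compact D" "convex D" "closed D" "D \<noteq> {}" "D \<in> sets borel" "bounded D"
  using polytope int_ne interior_subset
  by (auto simp: polytope_imp_compact polytope_imp_convex polytope_imp_closed polytope_imp_bounded)

text \<open>The density extended to a continuous bounded function on the whole plane.\<close>
definition dens :: "real^2 \<Rightarrow> real" where "dens x = \<rho> (closest_point D x)"

lemma dens_eq: "x \<in> D \<Longrightarrow> dens x = \<rho> x"
  by (simp add: dens_def closest_point_self)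

lemma dens_nn: "0 \<le> dens x"
  using D by (simp add: dens_def dens_nonneg closest_point_in_set)

lemma continuous_dens: "continuous_on UNIV dens"
  unfolding dens_def
  by (rule continuous_on_compose2[OF dens_cont continuous_on_closest_point])
     (use D closest_point_in_set in auto)

lemma dens_measurable [measurable]: "dens \<in> borel_measurable borel"
  by (rule borel_measurable_continuous_onI[OF continuous_dens])

lemma dens_bounded: obtains M where "\<And>x. \<bar>dens x\<bar> \<le> M"
proof -
  have "bounded (\<rho> ` D)"
    using compact_continuous_image[OF dens_cont D(1)] compact_imp_bounded by blast
  then obtain M where "\<And>x. x \<in> D \<Longrightarrow> norm (\<rho> x) \<le> M" by (auto simp: bounded_iff)
  then show thesis using that[of M] D closest_point_in_set by (auto simp: dens_def)
qed

lemma sets_\<mu> [simp]: "sets \<mu> = sets (restrict_space borel D)" and space_\<mu> [simp]: "space \<mu> = D"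
  by (simp_all add: \<mu> space_restrict_space sets_restrict_space)

lemma \<mu>_dens: "\<mu> = density (restrict_space lborel D) (\<lambda>x. ennreal (dens x))"
  unfolding \<mu>
proof (rule density_cong)
  show "(\<lambda>x. ennreal (\<rho> x)) \<in> borel_measurable (restrict_space lborel D)"
    using borel_measurable_continuous_on_restrict[OF dens_cont] by (simp cong: measurable_cong_sets add: sets_restrict_space)
  show "(\<lambda>x. ennreal (dens x)) \<in> borel_measurable (restrict_space lborel D)"
    by (intro measurable_restrict_space1) simp
  show "AE x in restrict_space lborel D. ennreal (\<rho> x) = ennreal (dens x)"
    by (rule AE_I2) (simp add: space_restrict_space dens_eq)
qed

lemma emeasure_\<mu>:
  assumes "B \<in> sets borel" "B \<subseteq> D"
  shows "emeasure \<mu> B = (\<integral>\<^sup>+ x. ennreal (dens x) * indicator B x \<partial>lborel)"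
proof -
  have B: "B \<in> sets (restrict_space lborel D)" using assms D by (simp add: sets_restrict_space_iff)
  have "emeasure \<mu> B = (\<integral>\<^sup>+ x. ennreal (dens x) * indicator B x \<partial>restrict_space lborel D)"
    unfolding \<mu>_dens by (rule emeasure_density[OF _ B]) (intro measurable_restrict_space1, simp)
  also have "\<dots> = (\<integral>\<^sup>+ x. ennreal (dens x) * indicator B x * indicator D x \<partial>lborel)"
    using D by (intro nn_integral_restrict_space) simp
  also have "\<dots> = (\<integral>\<^sup>+ x. ennreal (dens x) * indicator B x \<partial>lborel)"
    using assms(2) by (intro nn_integral_cong) (auto simp: indicator_def)
  finally show ?thesis .
qed

lemma AE_\<mu>: "AE x in lborel. P x \<Longrightarrow> AE x in \<mu>. P x"
  unfolding \<mu>_dens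
  using D by (subst AE_density) (auto simp: AE_restrict_space_iff intro: measurable_restrict_space1)

definition val :: "real^'n \<Rightarrow> 'n \<Rightarrow> real^2 \<Rightarrow> real" where "val \<xi> i x = a i \<bullet> x - \<xi> $ i"

text \<open>It differs from the cell by a null set. In contrast to the cell it may be a nonempty set without
  interior.\<close>
definition closed_cell :: "real^'n \<Rightarrow> 'n \<Rightarrow> (real^2) set" where
  "closed_cell \<xi> i = {x \<in> D. \<forall>j. val \<xi> j x \<le> val \<xi> i x}"

lemma cell_iff: "x \<in> cell D a \<xi> i \<longleftrightarrow> x \<in> interior D \<and> (\<forall>j. j \<noteq> i \<longrightarrow> val \<xi> j x < val \<xi> i x)"
  by (auto simp: cell_def val_def)

lemma cell_subset_closed_cell: "cell D a \<xi> i \<subseteq> closed_cell \<xi> i"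
proof
  fix x assume x: "x \<in> cell D a \<xi> i"
  have "val \<xi> j x \<le> val \<xi> i x" for j using x by (cases "j = i") (auto simp: cell_iff less_imp_le)
  then show "x \<in> closed_cell \<xi> i" using x interior_subset by (auto simp: cell_iff closed_cell_def)
qed

lemma cell_disjoint: "x \<in> cell D a \<xi> i \<Longrightarrow> x \<in> cell D a \<xi> j \<Longrightarrow> i = j"
  unfolding cell_iff by (metis less_asym)

lemma continuous_val: "continuous_on S (val \<xi> i)"
  unfolding val_def by (intro continuous_intros)

lemma open_cell: "open (cell D a \<xi> i)"
proof -
  have "cell D a \<xi> i = interior D \<inter> (\<Inter>j\<in>-{i}. {x. val \<xi> j x < val \<xi> i x})"
    by (auto simp: cell_iff)
  moreover have "open {x. val \<xi> j x < val \<xi> i x}" for j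
    by (intro open_Collect_less continuous_val)
  ultimately show ?thesis by (auto intro!: open_Int open_INT)
qed

lemma closed_cell_closed: "closed (closed_cell \<xi> i)"
proof -
  have "closed_cell \<xi> i = D \<inter> (\<Inter>j. {x. val \<xi> j x \<le> val \<xi> i x})" by (auto simp: closed_cell_def)
  moreover have "closed {x. val \<xi> j x \<le> val \<xi> i x}" for j
    by (intro closed_Collect_le continuous_val)
  ultimately show ?thesis using D by (simp add: closed_Int closed_INT)
qed

lemma sets_cell [simp]: "cell D a \<xi> i \<in> sets borel" "closed_cell \<xi> i \<in> sets borel"
  by (simp_all add: open_cell closed_cell_closed)

lemma cell_subset_D: "cell D a \<xi> i \<subseteq> D" "closed_cell \<xi> i \<subseteq> D"
  using interior_subset by (auto simp: cell_def closed_cell_def)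

text \<open>A null set that contains all points of \<open>D\<close> outside the cells.\<close>
definition ties :: "real^'n \<Rightarrow> (real^2) set" where
  "ties \<xi> = frontier D \<union> (\<Union>i. \<Union>j\<in>-{i}. {x. (a i - a j) \<bullet> x = \<xi> $ i - \<xi> $ j})"

lemma negligible_ties: "negligible (ties \<xi>)"
proof -
  have "negligible {x. (a i - a j) \<bullet> x = \<xi> $ i - \<xi> $ j}" if "j \<noteq> i" for i j
    using that inj_a by (intro negligible_hyperplane) (auto simp: inj_eq)
  then show ?thesis unfolding ties_def
    using D by (intro negligible_Un negligible_convex_frontier negligible_Union) (auto intro!: negligible_Union)
qed

lemma AE_ties: "AE x in lborel. x \<notin> ties \<xi>"
proof -
  have "AE x in lebesgue. x \<notin> ties \<xi>"
    using negligible_ties[of \<xi>] by (simp add: negligible_iff_null_sets AE_not_in)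
  then show ?thesis by (simp add: AE_completion_iff)
qed

lemma val_argmax: obtains i where "\<And>j. val \<xi> j x \<le> val \<xi> i x"
proof -
  have "Max (range (\<lambda>j. val \<xi> j x)) \<in> range (\<lambda>j. val \<xi> j x)" by (rule Max_in) auto
  then obtain i where "Max (range (\<lambda>j. val \<xi> j x)) = val \<xi> i x" unfolding image_iff by blast
  then have "val \<xi> j x \<le> val \<xi> i x" for j by (metis Max_ge finite_imageI finite_UNIV rangeI finite)
  then show thesis using that by blast
qed

lemma closed_cell_no_ties: "x \<in> closed_cell \<xi> i \<Longrightarrow> x \<notin> ties \<xi> \<Longrightarrow> x \<in> cell D a \<xi> i"
proof -
  assume x: "x \<in> closed_cell \<xi> i" "x \<notin> ties \<xi>"
  have "x \<in> interior D" using x D by (auto simp: ties_def closed_cell_def frontier_def)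
  moreover have "val \<xi> j x < val \<xi> i x" if "j \<noteq> i" for j
  proof -
    have "(a i - a j) \<bullet> x \<noteq> \<xi> $ i - \<xi> $ j" using x(2) that by (auto simp: ties_def)
    then have "val \<xi> j x \<noteq> val \<xi> i x" by (auto simp: val_def inner_diff_left)
    moreover have "val \<xi> j x \<le> val \<xi> i x" using x(1) by (simp add: closed_cell_def)
    ultimately show ?thesis by simp
  qed
  ultimately show ?thesis by (simp add: cell_iff)
qed

lemma D_subset_cells_ties: "x \<in> D \<Longrightarrow> x \<notin> ties \<xi> \<Longrightarrow> \<exists>i. x \<in> cell D a \<xi> i"
proof -
  assume x: "x \<in> D" "x \<notin> ties \<xi>"
  obtain i where "\<And>j. val \<xi> j x \<le> val \<xi> i x" using val_argmax by blast
  then have "x \<in> closed_cell \<xi> i" using x by (simp add: closed_cell_def)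
  then show ?thesis using closed_cell_no_ties x by blast
qed

lemma emeasure_cell: "emeasure \<mu> (cell D a \<xi> i) = (\<integral>\<^sup>+ x. ennreal (dens x) * indicator (closed_cell \<xi> i) x \<partial>lborel)"
proof -
  have "emeasure \<mu> (cell D a \<xi> i) = (\<integral>\<^sup>+ x. ennreal (dens x) * indicator (cell D a \<xi> i) x \<partial>lborel)"
    by (intro emeasure_\<mu> cell_subset_D) simp
  also have "\<dots> = (\<integral>\<^sup>+ x. ennreal (dens x) * indicator (closed_cell \<xi> i) x \<partial>lborel)"
  proof (rule nn_integral_cong_AE, rule AE_mp[OF AE_ties[of \<xi>]], intro AE_I2 impI)
    fix x assume "x \<notin> ties \<xi>"
    then have "x \<in> closed_cell \<xi> i \<longleftrightarrow> x \<in> cell D a \<xi> i" using closed_cell_no_ties cell_subset_closed_cell by blast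
    then show "ennreal (dens x) * indicator (cell D a \<xi> i) x = ennreal (dens x) * indicator (closed_cell \<xi> i) x"
      by (simp add: indicator_def)
  qed
  finally show ?thesis .
qed

end

text \<open>The polygon \<open>D\<close> is the intersection of the half-planes in \<open>HS\<close>, and the direction \<open>(\<kappa>, 1)\<close> is transversal to
  their boundaries and to all lines on which two indices tie. The two horizontal half-planes in \<open>HS\<close> ensure
  that every cell has an upper and a lower line.\<close>
locale semidiscrete_coords = semidiscrete a D \<mu> \<rho>
  for a :: "'n::finite \<Rightarrow> real^2" and D \<mu> \<rho> +
  fixes HS :: "((real^2) \<times> real) set" and \<kappa> R :: real
  assumes HS_fin: "finite HS" and D_eq: "D = {x. \<forall>(c, b)\<in>HS. c \<bullet> x \<le> b}"
    and HS_nz: "\<And>c b. (c, b) \<in> HS \<Longrightarrow> c \<noteq> 0"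
    and HS_box: "\<exists>b. (axis 2 1, b) \<in> HS" "\<exists>b. (- axis 2 1, b) \<in> HS"
    and \<kappa>: "\<And>c b. (c, b) \<in> HS \<Longrightarrow> c$1 * \<kappa> + c$2 \<noteq> 0" "\<And>i j. j \<noteq> i \<Longrightarrow> (a j - a i)$1 * \<kappa> + (a j - a i)$2 \<noteq> 0"
    and R: "\<And>x. x \<in> D \<Longrightarrow> \<bar>x$1 - \<kappa> * x$2\<bar> \<le> R" "0 \<le> R"

lemma (in semidiscrete) coords_exist: "\<exists>HS \<kappa> R. semidiscrete_coords a D \<mu> \<rho> HS \<kappa> R"
proof -
  have "polyhedron D" using polytope by (simp add: polytope_imp_polyhedron)
  then obtain F where F: "finite F" "D = \<Inter>F" "\<forall>h\<in>F. \<exists>c b. c \<noteq> 0 \<and> h = {x. c \<bullet> x \<le> b}"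
    unfolding polyhedron_def by blast
  then obtain c b where cb: "\<And>h. h \<in> F \<Longrightarrow> c h \<noteq> 0 \<and> h = {x. c h \<bullet> x \<le> b h}" by metis
  obtain B where B: "\<And>x. x \<in> D \<Longrightarrow> norm x \<le> B" using D(6) by (auto simp: bounded_iff)
  have B0: "B \<ge> 0" using B D(4) norm_ge_zero order_trans by blast
  define HS where "HS = (\<lambda>h. (c h, b h)) ` F \<union> {(axis 2 1, B), (- axis 2 1, B)}"
  have ax: "\<bar>x$2\<bar> \<le> B" "\<bar>x$1\<bar> \<le> B" if "x \<in> D" for x
    using B[OF that] component_le_norm_cart[of x 2] component_le_norm_cart[of x 1] by linarith+
  have D_eq: "D = {x. \<forall>(c, b)\<in>HS. c \<bullet> x \<le> b}"
  proof (intro set_eqI iffI)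
    fix x assume x: "x \<in> D"
    then have "c h \<bullet> x \<le> b h" if "h \<in> F" for h using F(2) cb[OF that] that by blast
    then show "x \<in> {x. \<forall>(c, b)\<in>HS. c \<bullet> x \<le> b}"
      using ax(1)[OF x] by (auto simp: HS_def inner_axis')
  next
    fix x assume "x \<in> {x. \<forall>(c, b)\<in>HS. c \<bullet> x \<le> b}"
    then have "c h \<bullet> x \<le> b h" if "h \<in> F" for h using that by (auto simp: HS_def)
    then show "x \<in> D" using F(2) cb by blast
  qed
  define V where "V = fst ` HS \<union> (\<lambda>(i, j). a j - a i) ` {(i, j). j \<noteq> i}"
  have HSnz: "d \<noteq> 0" if "(d, e) \<in> HS" for d e
    using that cb by (auto simp: HS_def axis_eq_0_iff)
  have "finite V" using F(1) by (simp add: V_def HS_def)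
  moreover have "0 \<notin> V" using HSnz inj_a by (force simp: V_def inj_eq)
  ultimately obtain \<kappa> where \<kappa>: "\<And>c. c \<in> V \<Longrightarrow> c$1 * \<kappa> + c$2 \<noteq> 0" using transversal_direction by blast
  have "semidiscrete_coords a D \<mu> \<rho> HS \<kappa> (B + \<bar>\<kappa>\<bar> * B)"
  proof
    show "finite HS" using F(1) by (simp add: HS_def)
    show "\<exists>b. (axis 2 1, b) \<in> HS" "\<exists>b. (- axis 2 1, b) \<in> HS" by (auto simp: HS_def)
    show "c$1 * \<kappa> + c$2 \<noteq> 0" if "(c, b) \<in> HS" for c b using that by (intro \<kappa>) (force simp: V_def)
    show "(a j - a i)$1 * \<kappa> + (a j - a i)$2 \<noteq> 0" if "j \<noteq> i" for i j using that by (intro \<kappa>) (force simp: V_def)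
    show "\<bar>x$1 - \<kappa> * x$2\<bar> \<le> B + \<bar>\<kappa>\<bar> * B" if "x \<in> D" for x
    proof -
      have "\<bar>x$1 - \<kappa> * x$2\<bar> \<le> \<bar>x$1\<bar> + \<bar>\<kappa>\<bar> * \<bar>x$2\<bar>" by (metis abs_mult abs_triangle_ineq4)
      also have "\<dots> \<le> B + \<bar>\<kappa>\<bar> * B" using ax[OF that] by (intro add_mono mult_left_mono) auto
      finally show ?thesis .
    qed
  qed (use D_eq HSnz B0 in auto)
  then show ?thesis by blast
qed

context semidiscrete_coords
begin

text \<open>The inner product with \<open>(\<kappa>, 1)\<close>. Its sign decides whether the constraint \<open>c \<bullet> x \<le> \<beta>\<close> bounds \<open>y\<close>
  from above or from below.\<close>
definition cf :: "real^2 \<Rightarrow> real" where "cf c = c$1 * \<kappa> + c$2"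

text \<open>A constraint \<open>fst k \<bullet> x \<le> snd k \<xi>\<close> solved for \<open>y\<close>.\<close>
definition tline :: "(real^2) \<times> (real^'n \<Rightarrow> real) \<Rightarrow> real \<times> (real^'n \<Rightarrow> real)" where
  "tline k = (- (fst k $ 1) / cf (fst k), \<lambda>\<xi>. snd k \<xi> / cf (fst k))"

definition tie :: "'n \<Rightarrow> 'n \<Rightarrow> (real^2) \<times> (real^'n \<Rightarrow> real)" where
  "tie i j = (a j - a i, \<lambda>\<xi>. \<xi> $ j - \<xi> $ i)"

definition wall :: "(real^2) \<times> real \<Rightarrow> (real^2) \<times> (real^'n \<Rightarrow> real)" where
  "wall h = (fst h, \<lambda>\<xi>. snd h)"

definition constraints :: "'n \<Rightarrow> ((real^2) \<times> (real^'n \<Rightarrow> real)) set" where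
  "constraints i = wall ` HS \<union> tie i ` (-{i})"

text \<open>Walls with the same boundary line yield equal pairs of slope and constant intercept, so that redundant
  half-planes in \<open>HS\<close> do not produce distinct coinciding lines.\<close>
definition upper :: "'n \<Rightarrow> (real \<times> (real^'n \<Rightarrow> real)) set" where
  "upper i = tline ` {k \<in> constraints i. cf (fst k) > 0}"

definition lower :: "'n \<Rightarrow> (real \<times> (real^'n \<Rightarrow> real)) set" where
  "lower i = tline ` {k \<in> constraints i. cf (fst k) < 0}"

abbreviation rhos :: "real \<Rightarrow> real \<Rightarrow> real" where "rhos s y \<equiv> dens (shear \<kappa> s y)"

lemma finite_con: "finite (constraints i)"
  using HS_fin by (simp add: constraints_def)

lemma cf_con: "k \<in> constraints i \<Longrightarrow> cf (fst k) \<noteq> 0"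
  unfolding constraints_def
proof (elim UnE imageE)
  fix h assume "h \<in> HS" "k = wall h"
  then show "cf (fst k) \<noteq> 0" using \<kappa>(1)[of "fst h" "snd h"] by (simp add: wall_def cf_def)
next
  fix j assume "j \<in> -{i}" "k = tie i j"
  then show "cf (fst k) \<noteq> 0" using \<kappa>(2)[of j i] by (simp add: tie_def cf_def)
qed

lemma inner_shear: "c \<bullet> shear \<kappa> s y = c$1 * s + cf c * y"
  by (simp add: inner_vec_def UNIV_2 cf_def algebra_simps)

lemma line_tline: "line (tline k) \<xi> s = (snd k \<xi> - fst k $ 1 * s) / cf (fst k)"
  by (simp add: line_def tline_def diff_divide_distrib)

lemma con_shear:
  "cf (fst k) > 0 \<Longrightarrow> fst k \<bullet> shear \<kappa> s y \<le> snd k \<xi> \<longleftrightarrow> y \<le> line (tline k) \<xi> s"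
  "cf (fst k) < 0 \<Longrightarrow> fst k \<bullet> shear \<kappa> s y \<le> snd k \<xi> \<longleftrightarrow> line (tline k) \<xi> s \<le> y"
  by (auto simp: inner_shear line_tline field_simps)

lemma con_shear_eq: "cf (fst k) \<noteq> 0 \<Longrightarrow> fst k \<bullet> shear \<kappa> s (line (tline k) \<xi> s) = snd k \<xi>"
  by (simp add: inner_shear line_tline)

lemma closed_cell_con: "x \<in> closed_cell \<xi> i \<longleftrightarrow> (\<forall>k\<in>constraints i. fst k \<bullet> x \<le> snd k \<xi>)"
proof -
  have "x \<in> D \<longleftrightarrow> (\<forall>k\<in>wall ` HS. fst k \<bullet> x \<le> snd k \<xi>)"
    using D_eq by (auto simp: wall_def split_beta)
  moreover have "(\<forall>j. val \<xi> j x \<le> val \<xi> i x) \<longleftrightarrow> (\<forall>j\<in>-{i}. fst (tie i j) \<bullet> x \<le> snd (tie i j) \<xi>)"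
  proof -
    have "val \<xi> j x \<le> val \<xi> i x \<longleftrightarrow> fst (tie i j) \<bullet> x \<le> snd (tie i j) \<xi>" for j
      by (auto simp: val_def tie_def inner_diff_left)
    then show ?thesis by force
  qed
  ultimately show ?thesis by (auto simp: closed_cell_def constraints_def)
qed

lemma upper_lower_C1: "l \<in> upper i \<union> lower i \<Longrightarrow> C1_real (snd l)"
  by (auto simp: upper_def lower_def tline_def constraints_def wall_def tie_def
      intro!: C1_real_divide_const C1_real_diff C1_real_nth C1_real_const)

lemma polygon: "moving_polygon rhos (upper i) (lower i) R"
proof
  show "continuous_on UNIV (\<lambda>(s, y). rhos s y)"
    unfolding case_prod_unfold by (intro continuous_on_compose2[OF continuous_dens] continuous_intros) auto
  obtain b where b: "(axis 2 1, b) \<in> HS" using HS_box(1) by blast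
  have "wall (axis 2 1, b) \<in> {k \<in> constraints i. cf (fst k) > 0}" using imageI[OF b, of wall] by (simp add: constraints_def) (simp add: wall_def cf_def axis_def)
  then show "upper i \<noteq> {}" unfolding upper_def by blast
  obtain b where b: "(- axis 2 1, b) \<in> HS" using HS_box(2) by blast
  have "wall (- axis 2 1, b) \<in> {k \<in> constraints i. cf (fst k) < 0}" using imageI[OF b, of wall] by (simp add: constraints_def) (simp add: wall_def cf_def axis_def)
  then show "lower i \<noteq> {}" unfolding lower_def by blast
qed (use finite_con upper_lower_C1 R(2) in \<open>auto simp: upper_def lower_def\<close>)

definition cell_mass :: "'n \<Rightarrow> real^'n \<Rightarrow> real" where "cell_mass i = moving_polygon.mass rhos (upper i) (lower i) R"

definition edge_params :: "'n \<Rightarrow> real \<times> (real^'n \<Rightarrow> real) \<Rightarrow> real^'n \<Rightarrow> real set" where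
  "edge_params i = moving_polygon.edge (upper i) (lower i) R"

lemma shear_closed_cell:
  "shear \<kappa> s y \<in> closed_cell \<xi> i \<longleftrightarrow> moving_polygon.lo (lower i) \<xi> s \<le> y \<and> y \<le> moving_polygon.hi (upper i) \<xi> s"
proof -
  interpret P: moving_polygon rhos "upper i" "lower i" R by (rule polygon)
  have "y \<le> P.hi \<xi> s \<longleftrightarrow> (\<forall>k\<in>constraints i. cf (fst k) > 0 \<longrightarrow> fst k \<bullet> shear \<kappa> s y \<le> snd k \<xi>)"
    using P.fin P.ne by (auto simp: P.hi_def con_shear(1)) (auto simp: upper_def con_shear(1))
  moreover have "P.lo \<xi> s \<le> y \<longleftrightarrow> (\<forall>k\<in>constraints i. cf (fst k) < 0 \<longrightarrow> fst k \<bullet> shear \<kappa> s y \<le> snd k \<xi>)"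
    using P.fin P.ne by (auto simp: P.lo_def con_shear(2)) (auto simp: lower_def con_shear(2))
  ultimately show ?thesis unfolding closed_cell_con using cf_con[of _ i] by (metis linorder_neqE_linordered_idom)
qed

lemma shear_D: "shear \<kappa> s y \<in> D \<Longrightarrow> s \<in> {-R..R}"
  using R(1)[of "shear \<kappa> s y"] by auto

lemma edge_params_iff: "s \<in> edge_params i l \<xi> \<longleftrightarrow> shear \<kappa> s (line l \<xi> s) \<in> closed_cell \<xi> i"
proof -
  interpret P: moving_polygon rhos "upper i" "lower i" R by (rule polygon)
  show ?thesis unfolding edge_params_def P.edge_def shear_closed_cell
    using shear_D[of s "line l \<xi> s"] shear_closed_cell[of s "line l \<xi> s" \<xi> i] by (auto simp: closed_cell_def)
qed

lemma nn_integral_closed_cell: "(\<integral>\<^sup>+ x. ennreal (dens x) * indicator (closed_cell \<xi> i) x \<partial>lborel) = ennreal (cell_mass i \<xi>)"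
proof -
  interpret P: moving_polygon rhos "upper i" "lower i" R by (rule polygon)
  have inner: "(\<integral>\<^sup>+ y. ennreal (rhos s y) * indicator (closed_cell \<xi> i) (shear \<kappa> s y) \<partial>lborel) =
      ennreal (P.slice \<xi> s) * indicator {-R..R} s" for s
  proof (cases "s \<in> {-R..R}")
    case True
    have "(\<integral>\<^sup>+ y. ennreal (rhos s y) * indicator (closed_cell \<xi> i) (shear \<kappa> s y) \<partial>lborel) =
        (\<integral>\<^sup>+ y. ennreal (rhos s y) * indicator {P.lo \<xi> s..P.hi \<xi> s} y \<partial>lborel)"
      by (rule nn_integral_cong) (auto simp: indicator_def shear_closed_cell)
    also have "\<dots> = ennreal (P.slice \<xi> s)"
      unfolding P.slice_def by (rule nn_integral_continuous_interval[OF P.rho_section dens_nn])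
    finally show ?thesis using True by simp
  next
    case False
    then have "shear \<kappa> s y \<notin> closed_cell \<xi> i" for y using shear_D cell_subset_D(2) by blast
    then show ?thesis using False by simp
  qed
  have nn: "P.slice \<xi> s \<ge> 0" for s
    unfolding P.slice_def
    by (intro integral_nonneg integrable_continuous_real continuous_on_subset[OF P.rho_section]) (auto simp: dens_nn)
  have "(\<integral>\<^sup>+ x. ennreal (dens x) * indicator (closed_cell \<xi> i) x \<partial>lborel) =
      (\<integral>\<^sup>+ s. \<integral>\<^sup>+ y. ennreal (rhos s y) * indicator (closed_cell \<xi> i) (shear \<kappa> s y) \<partial>lborel \<partial>lborel)"
    by (intro nn_integral_shear borel_measurable_times_ennreal borel_measurable_indicator) auto
  also have "\<dots> = ennreal (integral {-R..R} (P.slice \<xi>))"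
    unfolding inner
    by (rule nn_integral_continuous_interval[OF continuous_on_section[OF P.slice_continuous] nn])
  finally show ?thesis by (simp add: cell_mass_def P.mass_def)
qed

lemma cell_mass_nonneg: "0 \<le> cell_mass i \<xi>"
proof -
  interpret P: moving_polygon rhos "upper i" "lower i" R by (rule polygon)
  show ?thesis unfolding cell_mass_def P.mass_def
    by (intro integral_nonneg P.slice_integrable)
       (auto simp: P.slice_def dens_nn intro!: integral_nonneg integrable_continuous_real continuous_on_subset[OF P.rho_section])
qed

text \<open>The cell and the closed cell have equal mass, and the latter is a moving polygon.\<close>
lemma u_tilde_eq: "u_tilde D \<mu> a \<xi> = (\<chi> i. cell_mass i \<xi>)"
  by (simp add: u_tilde_def measure_def emeasure_cell nn_integral_closed_cell cell_mass_nonneg)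

lemma continuous_u_tilde: "continuous_on UNIV (u_tilde D \<mu> a)"
proof -
  have "continuous_on UNIV (cell_mass i)" for i
    unfolding cell_mass_def by (rule moving_polygon.mass_continuous[OF polygon])
  then show ?thesis unfolding u_tilde_eq[abs_def] by (intro continuous_on_vec_lambda)
qed

lemma C1_selection_u_tilde: "C1_selection (\<lambda>\<xi>. u_tilde D \<mu> a \<xi> $ i)"
  using moving_polygon.mass_C1_selection[OF polygon[of i]] by (simp add: u_tilde_eq cell_mass_def)

end

section \<open>Keeping empty cells empty\<close>
context semidiscrete
begin

text \<open>The cells are dense in \<open>D\<close>, and the closed cells with nonempty cell form a closed set.\<close>
lemma max_attained_on_nonempty_cell:
  assumes "x \<in> D" shows "\<exists>i. cell D a \<xi> i \<noteq> {} \<and> x \<in> closed_cell \<xi> i"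
proof -
  let ?C = "\<Union>i. cell D a \<xi> i"
  let ?K = "\<Union>i\<in>{i. cell D a \<xi> i \<noteq> {}}. closed_cell \<xi> i"
  have "interior D - closure ?C \<subseteq> ties \<xi>"
  proof
    fix x assume x: "x \<in> interior D - closure ?C"
    have "x \<notin> ?C" using x subsetD[OF closure_subset, of x ?C] by (rule_tac notI) simp
    moreover have "x \<in> D" using x subsetD[OF interior_subset, of x D] by simp
    ultimately show "x \<in> ties \<xi>" using D_subset_cells_ties[of x \<xi>] by (rule_tac ccontr) simp
  qed
  then have "negligible (interior D - closure ?C)" by (rule negligible_subset[OF negligible_ties])
  moreover have "open (interior D - closure ?C)" by (simp add: open_Diff)
  ultimately have "interior D - closure ?C = {}" by (metis open_not_negligible)
  moreover have "closed ?K" by (intro closed_UN) (auto simp: closed_cell_closed)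
  moreover have "?C \<subseteq> ?K" using cell_subset_closed_cell by blast
  moreover from calculation have "closure ?C \<subseteq> ?K" by (intro closure_minimal)
  ultimately have "interior D \<subseteq> ?K" by blast
  then have "closure (interior D) \<subseteq> ?K" using \<open>closed ?K\<close> by (rule closure_minimal)
  moreover have "closure (interior D) = D" using convex_closure_interior[OF D(2) int_ne] D(3) by simp
  ultimately show ?thesis using assms by blast
qed

text \<open>Moving from a point of the closed cell towards a point of the cell makes all inequalities strict.\<close>
lemma closure_cell:
  assumes "cell D a \<xi> i \<noteq> {}" shows "closure (cell D a \<xi> i) = closed_cell \<xi> i"
proof
  show "closure (cell D a \<xi> i) \<subseteq> closed_cell \<xi> i"
    by (rule closure_minimal[OF cell_subset_closed_cell closed_cell_closed])
  obtain z where z: "z \<in> cell D a \<xi> i" using assms by blast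
  show "closed_cell \<xi> i \<subseteq> closure (cell D a \<xi> i)"
  proof
    fix x assume x: "x \<in> closed_cell \<xi> i"
    have inc: "x - e *\<^sub>R (x - z) \<in> cell D a \<xi> i" if e: "0 < e" "e \<le> 1" for e
      unfolding cell_iff
    proof (intro conjI allI impI)
      show "x - e *\<^sub>R (x - z) \<in> interior D"
        using x z e D(2) by (intro mem_interior_convex_shrink) (auto simp: cell_iff closed_cell_def)
      fix j assume "j \<noteq> i"
      then have "e * val \<xi> j z < e * val \<xi> i z" using z e by (simp add: cell_iff)
      moreover have "(1 - e) * val \<xi> j x \<le> (1 - e) * val \<xi> i x" using x e by (intro mult_left_mono) (auto simp: closed_cell_def)
      moreover have "val \<xi> k (x - e *\<^sub>R (x - z)) = (1 - e) * val \<xi> k x + e * val \<xi> k z" for k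
        by (simp add: val_def inner_diff_right algebra_simps)
      ultimately show "val \<xi> j (x - e *\<^sub>R (x - z)) < val \<xi> i (x - e *\<^sub>R (x - z))" by simp
    qed
    show "x \<in> closure (cell D a \<xi> i)"
    proof (unfold closure_approachable, intro allI impI)
      fix d :: real assume d: "d > 0"
      define e where "e = min 1 (d / (2 * (norm (x - z) + 1)))"
      have e: "0 < e" "e \<le> 1" using d by (auto simp: e_def add_nonneg_pos)
      have "e * norm (x - z) \<le> d / (2 * (norm (x - z) + 1)) * norm (x - z)"
        by (intro mult_right_mono) (auto simp: e_def)
      also have "\<dots> < d" using d by (simp add: field_simps add_pos_nonneg)
      finally have "dist (x - e *\<^sub>R (x - z)) x < d" using e by (simp add: dist_norm)
      then show "\<exists>y\<in>cell D a \<xi> i. dist y x < d" using inc[OF e] by blast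
    qed
  qed
qed

text \<open>Raising the weights of the empty cells does not change the partition, but makes the empty cells stay
  empty under small perturbations.\<close>
definition bump :: "real^'n \<Rightarrow> real \<Rightarrow> real^'n" where
  "bump \<xi> \<epsilon> = \<xi> + \<epsilon> *\<^sub>R (\<chi> k. if cell D a \<xi> k = {} then 1 else 0)"

lemma val_bump:
  "cell D a \<xi> k \<noteq> {} \<Longrightarrow> val (bump \<xi> \<epsilon>) k x = val \<xi> k x"
  "cell D a \<xi> k = {} \<Longrightarrow> val (bump \<xi> \<epsilon>) k x = val \<xi> k x - \<epsilon>"
  by (auto simp: val_def bump_def)

text \<open>A nonempty cell attains the maximum at \<open>x\<close>, and its weight was not raised.\<close>
lemma bump_gap:
  assumes "cell D a \<xi> k = {}" "x \<in> D"
  shows "\<exists>i. cell D a \<xi> i \<noteq> {} \<and> val (bump \<xi> \<epsilon>) k x + \<epsilon> \<le> val (bump \<xi> \<epsilon>) i x"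
proof -
  obtain i where i: "cell D a \<xi> i \<noteq> {}" "x \<in> closed_cell \<xi> i" using max_attained_on_nonempty_cell[OF assms(2)] by blast
  then have "val \<xi> k x \<le> val \<xi> i x" by (simp add: closed_cell_def)
  then show ?thesis using i assms by (intro exI[of _ i]) (simp add: val_bump)
qed

lemma closed_cell_near_bump_empty:
  assumes k: "cell D a \<xi> k = {}" and near: "2 * norm (\<zeta> - bump \<xi> \<epsilon>) < \<epsilon>"
  shows "closed_cell \<zeta> k = {}"
proof (rule ccontr)
  assume "closed_cell \<zeta> k \<noteq> {}"
  then obtain x where "x \<in> closed_cell \<zeta> k" by blast
  then have x: "x \<in> D" "\<And>j. val \<zeta> j x \<le> val \<zeta> k x" unfolding closed_cell_def by blast+
  obtain i where i: "val (bump \<xi> \<epsilon>) k x + \<epsilon> \<le> val (bump \<xi> \<epsilon>) i x" using bump_gap[OF k x(1)] by blast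
  have "\<bar>val \<zeta> j x - val (bump \<xi> \<epsilon>) j x\<bar> \<le> norm (\<zeta> - bump \<xi> \<epsilon>)" for j
    using component_le_norm_cart[of "\<zeta> - bump \<xi> \<epsilon>" j] by (simp add: val_def)
  from this[of i] this[of k] show False using i x(2)[of i] near by linarith
qed

lemma closed_cell_bump:
  assumes "\<epsilon> > 0" and i: "cell D a \<xi> i \<noteq> {}"
  shows "closed_cell (bump \<xi> \<epsilon>) i = closed_cell \<xi> i"
proof (intro set_eqI iffI)
  fix x assume x: "x \<in> closed_cell \<xi> i"
  have "val (bump \<xi> \<epsilon>) j x \<le> val (bump \<xi> \<epsilon>) i x" for j
  proof -
    have "val \<xi> j x \<le> val \<xi> i x" using x by (simp add: closed_cell_def)
    then show ?thesis using i assms(1) by (cases "cell D a \<xi> j = {}") (auto simp: val_bump)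
  qed
  then show "x \<in> closed_cell (bump \<xi> \<epsilon>) i" using x by (simp add: closed_cell_def)
next
  fix x assume x: "x \<in> closed_cell (bump \<xi> \<epsilon>) i"
  then have "x \<in> D" by (simp add: closed_cell_def)
  then obtain k where k: "cell D a \<xi> k \<noteq> {}" "x \<in> closed_cell \<xi> k" using max_attained_on_nonempty_cell by blast
  have "val \<xi> j x \<le> val \<xi> i x" for j
  proof -
    have "val \<xi> j x \<le> val \<xi> k x" using k by (simp add: closed_cell_def)
    also have "\<dots> = val (bump \<xi> \<epsilon>) k x" using k by (simp add: val_bump)
    also have "\<dots> \<le> val (bump \<xi> \<epsilon>) i x" using x by (simp add: closed_cell_def)
    also have "\<dots> = val \<xi> i x" using i by (simp add: val_bump)
    finally show ?thesis .
  qed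
  then show "x \<in> closed_cell \<xi> i" using \<open>x \<in> D\<close> by (simp add: closed_cell_def)
qed

lemma cell_bump_nonempty:
  assumes "\<epsilon> > 0" "cell D a \<xi> i \<noteq> {}" shows "cell D a (bump \<xi> \<epsilon>) i \<noteq> {}"
proof -
  obtain z where z: "z \<in> cell D a \<xi> i" using assms(2) by blast
  have "val (bump \<xi> \<epsilon>) j z < val (bump \<xi> \<epsilon>) i z" if "j \<noteq> i" for j
    using z that assms by (cases "cell D a \<xi> j = {}") (auto simp: cell_iff val_bump intro: less_trans[of "_ - \<epsilon>"])
  then have "z \<in> cell D a (bump \<xi> \<epsilon>) i" using z by (simp add: cell_iff)
  then show ?thesis by blast
qed

lemma closed_cell_bump_empty: "\<epsilon> > 0 \<Longrightarrow> cell D a \<xi> k = {} \<Longrightarrow> closed_cell (bump \<xi> \<epsilon>) k = {}"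
  using closed_cell_near_bump_empty[of \<xi> k "bump \<xi> \<epsilon>" \<epsilon>] by simp

text \<open>A nonempty cell can only grow by ties, which form a null set.\<close>
lemma u_tilde_bump:
  assumes "\<epsilon> > 0" shows "u_tilde D \<mu> a (bump \<xi> \<epsilon>) = u_tilde D \<mu> a \<xi>"
proof -
  have "emeasure \<mu> (cell D a (bump \<xi> \<epsilon>) i) = emeasure \<mu> (cell D a \<xi> i)" for i
  proof (cases "cell D a \<xi> i = {}")
    case True
    then have "cell D a (bump \<xi> \<epsilon>) i = {}" using closed_cell_bump_empty[OF assms True] cell_subset_closed_cell by blast
    then show ?thesis using True by simp
  next
    case False
    then show ?thesis by (simp add: emeasure_cell closed_cell_bump[OF assms False])
  qed
  then show ?thesis by (simp add: u_tilde_def measure_def)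
qed

end

context semidiscrete_coords
begin

section \<open>The derivative of the cell masses\<close>

text \<open>The gradient of the intercept, which is affine in \<open>\<xi>\<close>.\<close>
definition grad_line :: "real \<times> (real^'n \<Rightarrow> real) \<Rightarrow> real^'n" where
  "grad_line l = (\<chi> k. snd l (axis k 1) - snd l 0)"

lemma grad_line_wall: "grad_line (tline (wall h)) = 0"
  by (simp add: grad_line_def tline_def wall_def vec_eq_iff)

lemma grad_line_tie:
  "grad_line (tline (tie i j)) \<bullet> h = (h $ j - h $ i) / cf (a j - a i)"
proof -
  have "grad_line (tline (tie i j)) = (1 / cf (a j - a i)) *\<^sub>R (axis j 1 - axis i 1)"
    by (auto simp: grad_line_def tline_def tie_def vec_eq_iff axis_def)
  then show ?thesis by (simp add: inner_diff_left inner_axis')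
qed

lemma affine_line:
  assumes "l \<in> upper i \<union> lower i"
  shows "snd l \<xi> - snd l \<eta> = grad_line l \<bullet> (\<xi> - \<eta>)"
proof -
  obtain k where k: "k \<in> constraints i" "l = tline k" using assms by (auto simp: upper_def lower_def)
  from k(1) consider h where "k = wall h" | j where "k = tie i j" by (auto simp: constraints_def)
  then show ?thesis
  proof cases
    case 1
    then show ?thesis by (simp add: k grad_line_wall) (simp add: tline_def wall_def)
  next
    case 2
    then show ?thesis unfolding k(2) 2 grad_line_tie by (simp add: tline_def tie_def diff_divide_distrib)
  qed
qed

lemma line_has_derivative:
  assumes "l \<in> upper i \<union> lower i"
  shows "(snd l has_derivative (\<lambda>h. grad_line l \<bullet> h)) (at \<eta>)"
proof -
  have "snd l = (\<lambda>\<xi>. snd l \<eta> + grad_line l \<bullet> (\<xi> - \<eta>))"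
    using affine_line[OF assms, of _ \<eta>] by (auto simp: fun_eq_iff algebra_simps)
  moreover have "((\<lambda>\<xi>. snd l \<eta> + grad_line l \<bullet> (\<xi> - \<eta>)) has_derivative (\<lambda>h. grad_line l \<bullet> h)) (at \<eta>)"
    by (auto intro!: derivative_eq_intros)
  ultimately show ?thesis by simp
qed

text \<open>Suppose that two constraints with the same line are active at a point \<open>x\<close> of the closed cell. As the cell is
  not empty, they bound it from the same side, so that one is a positive multiple of the other. Two walls would
  give the same pair of slope and intercept. Otherwise one of the constraints, a tie with some index \<open>j\<close>, is such
  that \<open>j\<close> can nowhere be the unique maximizer: where it beats \<open>i\<close>, the point lies outside \<open>D\<close> or another index
  beats \<open>j\<close>. Then the cell of \<open>j\<close> is empty although \<open>j\<close> attains the maximum at \<open>x\<close>.\<close>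
lemma coinciding_lines_inactive:
  assumes empty: "\<And>k. cell D a \<eta> k = {} \<Longrightarrow> closed_cell \<eta> k = {}"
    and ne: "cell D a \<eta> i \<noteq> {}"
    and l: "l \<in> upper i \<union> lower i" "l' \<in> upper i \<union> lower i" "l \<noteq> l' \<or> (l \<in> upper i \<and> l' \<in> lower i)"
    and same: "fst l = fst l'" "snd l \<eta> = snd l' \<eta>"
  shows "edge_params i l \<eta> = {}"
proof (rule ccontr)
  assume "edge_params i l \<eta> \<noteq> {}"
  then obtain s where s: "s \<in> edge_params i l \<eta>" by blast
  define x where "x = shear \<kappa> s (line l \<eta> s)"
  have x: "x \<in> closed_cell \<eta> i" using s by (simp add: edge_params_iff x_def)
  have xD: "x \<in> D" and xmax: "\<And>j. val \<eta> j x \<le> val \<eta> i x" using x unfolding closed_cell_def by blast+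
  have ll: "line l \<eta> s = line l' \<eta> s" using same by (simp add: line_def)
  obtain k k' where k: "k \<in> constraints i" "l = tline k" and k': "k' \<in> constraints i" "l' = tline k'"
    and sg: "l \<in> upper i \<and> l' \<in> lower i \<longrightarrow> cf (fst k) > 0 \<and> cf (fst k') < 0 \<or> l \<noteq> l'"
  proof (cases "l \<noteq> l'")
    case True
    obtain k where "k \<in> constraints i" "l = tline k" using l(1) by (auto simp: upper_def lower_def)
    moreover obtain k' where "k' \<in> constraints i" "l' = tline k'" using l(2) by (auto simp: upper_def lower_def)
    ultimately show thesis using that True by blast
  next
    case False
    then have "l \<in> upper i" "l' \<in> lower i" using l(3) by auto
    then obtain k k' where "k \<in> constraints i" "l = tline k" "cf (fst k) > 0" "k' \<in> constraints i" "l' = tline k'" "cf (fst k') < 0"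
      by (auto simp: upper_def lower_def)
    then show thesis using that by blast
  qed
  have c0: "cf (fst k) \<noteq> 0" "cf (fst k') \<noteq> 0" using cf_con k(1) k'(1) by auto
  define t where "t = cf (fst k') / cf (fst k)"
  have t0: "t \<noteq> 0" using c0 by (simp add: t_def)
  have c1: "fst k' $ 1 = t * fst k $ 1" using same(1) c0 by (simp add: k k' tline_def t_def field_simps)
  have c2: "cf (fst k') = t * cf (fst k)" using c0 by (simp add: t_def)
  then have "fst k' $ 2 = t * fst k $ 2" using c1 by (simp add: cf_def algebra_simps)
  then have ck: "fst k' = t *\<^sub>R fst k" using c1 by (simp add: vec_eq_iff forall_2)
  have bk: "snd k' \<eta> = t * snd k \<eta>" using same(2) c0 by (simp add: k k' tline_def t_def field_simps)
  have scaled: "fst k' \<bullet> z - snd k' \<eta> = t * (fst k \<bullet> z - snd k \<eta>)" for z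
    by (simp add: ck bk algebra_simps)
  have xk: "fst k \<bullet> x = snd k \<eta>" using con_shear_eq[OF c0(1)] by (simp add: x_def k)
  have xk': "fst k' \<bullet> x = snd k' \<eta>" using scaled[of x] xk by simp
  \<comment> \<open>Both constraints hold strictly at a point of the cell, hence the two lines bound from the same side.\<close>
  obtain z where z: "z \<in> cell D a \<eta> i" using ne by blast
  have strict: "fst m \<bullet> z < snd m \<eta>" if m: "m \<in> constraints i" for m
  proof -
    from m consider h where "h \<in> HS" "m = wall h" | j where "j \<noteq> i" "m = tie i j" by (auto simp: constraints_def)
    then show ?thesis
    proof cases
      case 1
      have "D \<subseteq> {x. fst h \<bullet> x \<le> snd h}" using D_eq 1 by (auto simp: split_beta)
      then have "interior D \<subseteq> {x. fst h \<bullet> x < snd h}"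
        using interior_mono interior_halfspace_le HS_nz[of "fst h" "snd h"] 1(1) by (metis prod.collapse)
      then show ?thesis using z 1 by (auto simp: cell_iff wall_def)
    next
      case 2
      then have "val \<eta> j z < val \<eta> i z" using z by (auto simp: cell_iff)
      then show ?thesis using 2 by (simp add: tie_def val_def inner_diff_left)
    qed
  qed
  have tpos: "t > 0"
  proof (rule ccontr)
    assume "\<not> t > 0"
    then have "t * (fst k \<bullet> z - snd k \<eta>) > 0" using t0 strict[OF k(1)] by (simp add: mult_neg_neg)
    then show False using scaled[of z] strict[OF k'(1)] by simp
  qed
  then have "l \<noteq> l'" using sg l(3) c2 by (smt (verit) mult_pos_pos)
  \<comment> \<open>A tie that is implied by the other constraint makes the cell of \<open>j\<close> empty, although \<open>j\<close> attains the maximum at \<open>x\<close>.\<close>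
  have contra: "False" if j: "j \<noteq> i" "val \<eta> j x = val \<eta> i x" "cell D a \<eta> j = {}" for j
  proof -
    have "\<forall>l. val \<eta> l x \<le> val \<eta> j x" unfolding j(2) using xmax by blast
    then have "x \<in> closed_cell \<eta> j" using xD unfolding closed_cell_def by blast
    then show False using empty[OF j(3)] by blast
  qed
  have wall_tie: "False" if j: "j \<noteq> i" "m = tie i j" "fst m \<bullet> x = snd m \<eta>" and h: "h \<in> HS"
    and q: "q > 0" "\<And>z. fst h \<bullet> z - snd h = q * (fst m \<bullet> z - snd m \<eta>)" for m j h and q :: real
  proof (rule contra[OF j(1)])
    show "val \<eta> j x = val \<eta> i x" using j(2,3) by (simp add: tie_def val_def inner_diff_left)
    show "cell D a \<eta> j = {}"
    proof (rule ccontr)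
      assume "cell D a \<eta> j \<noteq> {}"
      then obtain y where y: "y \<in> cell D a \<eta> j" by blast
      then have "val \<eta> i y < val \<eta> j y" using j(1) by (auto simp: cell_iff)
      then have "fst m \<bullet> y - snd m \<eta> > 0" by (simp add: j(2) tie_def val_def inner_diff_left)
      then have "fst h \<bullet> y > snd h" using q(1) q(2)[of y] by (metis diff_gt_0_iff_gt mult_pos_pos)
      moreover have "y \<in> D" using y cell_subset_D by blast
      ultimately show False using D_eq h by (auto simp: split_beta)
    qed
  qed
  from k(1) k'(1) consider (ww) h h' where "k = wall h" "k' = wall h'"
    | (wt) h j where "h \<in> HS" "k = wall h" "j \<noteq> i" "k' = tie i j"
    | (tw) h j where "h \<in> HS" "k' = wall h" "j \<noteq> i" "k = tie i j"
    | (tt) j j' where "j \<noteq> i" "k = tie i j" "j' \<noteq> i" "k' = tie i j'"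
    unfolding constraints_def by blast
  then show False
  proof cases
    case ww
    then have "l = l'" using same by (simp add: k k' tline_def wall_def)
    then show False using \<open>l \<noteq> l'\<close> by simp
  next
    case wt
    have "fst h \<bullet> z - snd h = (1 / t) * (fst k' \<bullet> z - snd k' \<eta>)" for z
      using scaled[of z] tpos wt(2) by (simp add: wall_def)
    then show False using wall_tie[OF wt(3,4) xk' wt(1), of "1 / t"] tpos by simp
  next
    case tw
    have "fst h \<bullet> z - snd h = t * (fst k \<bullet> z - snd k \<eta>)" for z
      using scaled[of z] tw(2) by (simp add: wall_def)
    then show False using wall_tie[OF tw(3,4) xk tw(1) tpos] by simp
  next
    case tt
    have jj: "j \<noteq> j'" using \<open>l \<noteq> l'\<close> tt k k' by auto
    have vp: "val \<eta> j' y - val \<eta> i y = t * (val \<eta> j y - val \<eta> i y)" for y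
      using scaled[of y] by (simp add: tt tie_def val_def inner_diff_left algebra_simps)
    have vx: "val \<eta> j x = val \<eta> i x" using xk by (simp add: tt tie_def val_def inner_diff_left)
    then have vx': "val \<eta> j' x = val \<eta> i x" using vp[of x] by simp
    (* For t = 1 the two indices would belong to the same point, for t > 1 index j' beats j wherever j beats i,
       and for t < 1 it is the other way round. *)
    have "t \<noteq> 1"
    proof
      assume "t = 1"
      then have "a j = a j'" using ck by (simp add: tt tie_def)
      then show False using jj inj_a by (simp add: inj_eq)
    qed
    then consider "t > 1" | "t < 1" by linarith
    then show False
    proof cases
      case 1
      have "cell D a \<eta> j = {}"
      proof (rule ccontr)
        assume "cell D a \<eta> j \<noteq> {}"
        then obtain y where y: "y \<in> cell D a \<eta> j" by blast
        then have "val \<eta> i y < val \<eta> j y" "val \<eta> j' y < val \<eta> j y" using tt(1) jj by (auto simp: cell_iff)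
        moreover from this have "val \<eta> j y - val \<eta> i y < t * (val \<eta> j y - val \<eta> i y)" using 1 by simp
        ultimately show False using vp[of y] by linarith
      qed
      then show False using contra[OF tt(1) vx] by blast
    next
      case 2
      have "cell D a \<eta> j' = {}"
      proof (rule ccontr)
        assume "cell D a \<eta> j' \<noteq> {}"
        then obtain y where y: "y \<in> cell D a \<eta> j'" by blast
        then have v: "val \<eta> i y < val \<eta> j' y" "val \<eta> j y < val \<eta> j' y" using tt(3) jj by (auto simp: cell_iff)
        then have "0 < t * (val \<eta> j y - val \<eta> i y)" using vp[of y] by linarith
        then have "val \<eta> j y - val \<eta> i y > 0" using tpos by (simp add: zero_less_mult_iff)
        then have "t * (val \<eta> j y - val \<eta> i y) < val \<eta> j y - val \<eta> i y" using 2 by simp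
        then show False using vp[of y] v by linarith
      qed
      then show False using contra[OF tt(3) vx'] by blast
    qed
  qed
qed

text \<open>The edge integral of the density, divided by \<open>norm (a j - a i)\<close>, in sheared coordinates.\<close>
definition tie_weight :: "'n \<Rightarrow> 'n \<Rightarrow> real^'n \<Rightarrow> real" where
  "tie_weight i j \<eta> = integral (edge_params i (tline (tie i j)) \<eta>) (\<lambda>s. rhos s (line (tline (tie i j)) \<eta> s)) / \<bar>cf (a j - a i)\<bar>"

text \<open>The walls of \<open>D\<close> do not move and contribute nothing. The sign of a lower line is absorbed by the absolute
  value in \<open>tie_weight\<close>.\<close>
lemma cell_mass_has_derivative:
  assumes empty: "\<And>k. cell D a \<eta> k = {} \<Longrightarrow> closed_cell \<eta> k = {}" and ne: "cell D a \<eta> i \<noteq> {}"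
  shows "(cell_mass i has_derivative (\<lambda>h. \<Sum>j\<in>-{i}. tie_weight i j \<eta> * (h $ j - h $ i))) (at \<eta>)"
proof -
  interpret P: moving_polygon rhos "upper i" "lower i" R by (rule polygon)
  obtain M where M: "\<And>x. \<bar>dens x\<bar> \<le> M" using dens_bounded by blast
  define w where "w l = integral (edge_params i l \<eta>) (\<lambda>s. rhos s (line l \<eta> s))" for l
  have deriv: "(P.mass has_derivative (\<lambda>h. (\<Sum>l\<in>upper i. w l * (grad_line l \<bullet> h)) -
      (\<Sum>l\<in>lower i. w l * (grad_line l \<bullet> h)))) (at \<eta>)"
    unfolding w_def edge_params_def
  proof (rule P.mass_has_derivative[where K = "\<Sum>l\<in>upper i \<union> lower i. norm (grad_line l)" and M = M])
    fix l \<xi> assume l: "l \<in> upper i \<union> lower i"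
    have "\<bar>snd l \<xi> - snd l \<eta>\<bar> \<le> norm (grad_line l) * norm (\<xi> - \<eta>)"
      unfolding affine_line[OF l] by (rule Cauchy_Schwarz_ineq2)
    also have "\<dots> \<le> (\<Sum>l\<in>upper i \<union> lower i. norm (grad_line l)) * norm (\<xi> - \<eta>)"
      using P.fin l by (intro mult_right_mono member_le_sum) auto
    finally show "\<bar>snd l \<xi> - snd l \<eta>\<bar> \<le> (\<Sum>l\<in>upper i \<union> lower i. norm (grad_line l)) * norm (\<xi> - \<eta>)" .
  next
    fix l l' assume "l \<in> upper i \<union> lower i" "l' \<in> upper i \<union> lower i" "l \<noteq> l' \<or> l \<in> upper i \<and> l' \<in> lower i"
      "fst l = fst l'" "snd l \<eta> = snd l' \<eta>"
    then show "P.edge l \<eta> = {}"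
      using coinciding_lines_inactive[OF empty ne] by (simp add: edge_params_def)
  qed (use line_has_derivative M in auto)
  define J where "J \<sigma> = {j \<in> -{i}. \<sigma> * cf (a j - a i) > 0}" for \<sigma> :: real
  have inj: "inj_on (\<lambda>j. tline (tie i j)) (-{i})"
  proof (rule inj_onI)
    fix j j' assume j: "j \<in> -{i}" "j' \<in> -{i}" and eq: "tline (tie i j) = tline (tie i j')"
    have "cf (fst (tie i j)) \<noteq> 0" using j by (intro cf_con[of _ i]) (simp add: constraints_def)
    then have nz: "cf (a j - a i) \<noteq> 0" by (simp add: tie_def)
    have "snd (tline (tie i j)) (axis j 1) = snd (tline (tie i j')) (axis j 1)" using eq by simp
    then have "1 / cf (a j - a i) = (if j' = j then 1 else 0) / cf (a j' - a i)"
      using j by (auto simp: tline_def tie_def axis_def)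
    then show "j = j'" using nz by (auto split: if_splits)
  qed
  have part: "(\<Sum>l\<in>tline ` {k \<in> constraints i. \<sigma> * cf (fst k) > 0}. w l * (grad_line l \<bullet> h)) =
      (\<Sum>j\<in>J \<sigma>. w (tline (tie i j)) * ((h $ j - h $ i) / cf (a j - a i)))" for \<sigma> and h :: "real^'n"
  proof -
    have "(\<Sum>l\<in>tline ` {k \<in> constraints i. \<sigma> * cf (fst k) > 0}. w l * (grad_line l \<bullet> h)) =
        (\<Sum>l\<in>(\<lambda>j. tline (tie i j)) ` J \<sigma>. w l * (grad_line l \<bullet> h))"
    proof (rule sum.mono_neutral_right)
      show "(\<lambda>j. tline (tie i j)) ` J \<sigma> \<subseteq> tline ` {k \<in> constraints i. \<sigma> * cf (fst k) > 0}"
        by (auto simp: J_def constraints_def tie_def intro!: imageI)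
      show "\<forall>l\<in>tline ` {k \<in> constraints i. \<sigma> * cf (fst k) > 0} - (\<lambda>j. tline (tie i j)) ` J \<sigma>. w l * (grad_line l \<bullet> h) = 0"
      proof
        fix l assume l: "l \<in> tline ` {k \<in> constraints i. \<sigma> * cf (fst k) > 0} - (\<lambda>j. tline (tie i j)) ` J \<sigma>"
        then obtain k where k: "k \<in> constraints i" "\<sigma> * cf (fst k) > 0" "l = tline k" by blast
        have "\<not> (\<exists>j\<in>-{i}. k = tie i j)"
        proof
          assume "\<exists>j\<in>-{i}. k = tie i j"
          then obtain j where "j \<in> -{i}" "k = tie i j" by blast
          then have "j \<in> J \<sigma>" using k(2) by (simp add: J_def tie_def)
          then show False using l k(3) \<open>k = tie i j\<close> by blast
        qed
        then obtain hh where "k = wall hh" using k(1) by (auto simp: constraints_def)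
        then show "w l * (grad_line l \<bullet> h) = 0" by (simp add: k grad_line_wall)
      qed
    qed (use finite_con in simp)
    also have "\<dots> = (\<Sum>j\<in>J \<sigma>. w (tline (tie i j)) * (grad_line (tline (tie i j)) \<bullet> h))"
      by (rule sum.reindex[unfolded comp_def]) (rule inj_on_subset[OF inj], auto simp: J_def)
    finally show ?thesis by (simp add: grad_line_tie)
  qed
  have "(\<Sum>l\<in>upper i. w l * (grad_line l \<bullet> h)) - (\<Sum>l\<in>lower i. w l * (grad_line l \<bullet> h)) =
      (\<Sum>j\<in>-{i}. tie_weight i j \<eta> * (h $ j - h $ i))" for h
  proof -
    have un: "-{i} = J 1 \<union> J (-1)"
    proof -
      have "cf (a j - a i) \<noteq> 0" if "j \<noteq> i" for j using \<kappa>(2)[OF that] by (simp add: cf_def)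
      then show ?thesis by (force simp: J_def)
    qed
    have dis: "J 1 \<inter> J (-1) = {}" by (auto simp: J_def)
    have "(\<Sum>j\<in>-{i}. tie_weight i j \<eta> * (h $ j - h $ i)) =
        (\<Sum>j\<in>J 1. tie_weight i j \<eta> * (h $ j - h $ i)) + (\<Sum>j\<in>J (-1). tie_weight i j \<eta> * (h $ j - h $ i))"
      unfolding un by (rule sum.union_disjoint) (use dis in auto)
    also have "(\<Sum>j\<in>J 1. tie_weight i j \<eta> * (h $ j - h $ i)) =
        (\<Sum>j\<in>J 1. w (tline (tie i j)) * ((h $ j - h $ i) / cf (a j - a i)))"
      by (rule sum.cong) (auto simp: J_def tie_weight_def w_def)
    also have "(\<Sum>j\<in>J (-1). tie_weight i j \<eta> * (h $ j - h $ i)) =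
        - (\<Sum>j\<in>J (-1). w (tline (tie i j)) * ((h $ j - h $ i) / cf (a j - a i)))"
      unfolding sum_negf[symmetric] by (rule sum.cong) (auto simp: J_def tie_weight_def w_def)
    finally show ?thesis using part[of h 1] part[of h "-1"] by (simp add: upper_def lower_def)
  qed
  then show ?thesis using deriv by (simp add: cell_mass_def)
qed

end

context semidiscrete_coords
begin

lemma tie_in_con: "j \<noteq> i \<Longrightarrow> tie i j \<in> constraints i"
  by (simp add: constraints_def)

lemma cf_tie: "j \<noteq> i \<Longrightarrow> cf (a j - a i) \<noteq> 0"
  using cf_con[OF tie_in_con] by (simp add: tie_def)

lemma tline_tie_in: "j \<noteq> i \<Longrightarrow> tline (tie i j) \<in> upper i \<union> lower i"
  using tie_in_con[of j i] cf_con[OF tie_in_con, of j i] unfolding upper_def lower_def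
  by (cases "cf (fst (tie i j)) > 0") auto

lemma shear_line: "shear \<kappa> s (line l \<eta> s) = shear \<kappa> 0 (snd l \<eta>) + s *\<^sub>R shear \<kappa> 1 (fst l)"
  by (simp add: vec_eq_iff forall_2 line_def algebra_simps)

text \<open>The direction vector of the line is \<open>a j - a i\<close> turned by a right angle and divided by \<open>cf (a j - a i)\<close>.\<close>
lemma norm_tie_direction:
  assumes "j \<noteq> i"
  shows "norm (shear \<kappa> 1 (fst (tline (tie i j)))) = norm (a j - a i) / \<bar>cf (a j - a i)\<bar>"
proof -
  define c where "c = a j - a i"
  have nz: "cf c \<noteq> 0" using cf_tie[OF assms] by (simp add: c_def)
  have v: "shear \<kappa> 1 (fst (tline (tie i j))) $ 1 = c $ 2 / cf c" "shear \<kappa> 1 (fst (tline (tie i j))) $ 2 = - (c $ 1) / cf c"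
    using nz by (simp_all add: tline_def tie_def c_def[symmetric] field_simps) (simp add: cf_def algebra_simps)
  have "(norm (shear \<kappa> 1 (fst (tline (tie i j)))))\<^sup>2 = (c $ 2 / cf c)\<^sup>2 + (- (c $ 1) / cf c)\<^sup>2"
    unfolding power2_norm_eq_inner inner_vec_def sum_2 v by (simp add: power2_eq_square)
  also have "\<dots> = (norm c / \<bar>cf c\<bar>)\<^sup>2"
    unfolding power_divide power2_norm_eq_inner[of c] by (simp add: inner_vec_def UNIV_2 power2_eq_square add_divide_distrib)
  finally have "norm (shear \<kappa> 1 (fst (tline (tie i j)))) = norm c / \<bar>cf c\<bar>"
    by (rule power2_eq_imp_eq) simp_all
  then show ?thesis by (simp add: c_def)
qed

lemma closed_cell_Int_eq_edge:
  assumes "j \<noteq> i"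
  shows "closed_cell \<eta> i \<inter> closed_cell \<eta> j = (\<lambda>s. shear \<kappa> s (line (tline (tie i j)) \<eta> s)) ` edge_params i (tline (tie i j)) \<eta>"
proof (intro set_eqI iffI)
  fix x assume x: "x \<in> closed_cell \<eta> i \<inter> closed_cell \<eta> j"
  define s where "s = x $ 1 - \<kappa> * x $ 2"
  have xs: "x = shear \<kappa> s (x $ 2)" by (simp add: vec_eq_iff forall_2 s_def)
  have "val \<eta> i x = val \<eta> j x" using x unfolding closed_cell_def by (intro antisym) blast+
  then have "fst (tie i j) \<bullet> x = snd (tie i j) \<eta>" by (simp add: tie_def val_def inner_diff_left)
  then have "fst (tie i j) $ 1 * s + cf (fst (tie i j)) * x $ 2 = snd (tie i j) \<eta>"
    by (subst (asm) xs) (simp only: inner_shear)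
  then have "x $ 2 = line (tline (tie i j)) \<eta> s"
    using cf_con[OF tie_in_con[OF assms]] by (simp add: line_tline field_simps)
  then have xe: "x = shear \<kappa> s (line (tline (tie i j)) \<eta> s)" using xs by simp
  moreover have "s \<in> edge_params i (tline (tie i j)) \<eta>" unfolding edge_params_iff xe[symmetric] using x by blast
  ultimately show "x \<in> (\<lambda>s. shear \<kappa> s (line (tline (tie i j)) \<eta> s)) ` edge_params i (tline (tie i j)) \<eta>" by (rule image_eqI)
next
  fix x assume "x \<in> (\<lambda>s. shear \<kappa> s (line (tline (tie i j)) \<eta> s)) ` edge_params i (tline (tie i j)) \<eta>"
  then obtain s where s: "s \<in> edge_params i (tline (tie i j)) \<eta>" "x = shear \<kappa> s (line (tline (tie i j)) \<eta> s)" by blast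
  have xi: "x \<in> closed_cell \<eta> i" using s by (simp add: edge_params_iff)
  have "fst (tie i j) \<bullet> x = snd (tie i j) \<eta>"
    unfolding s(2) by (rule con_shear_eq[OF cf_con[OF tie_in_con[OF assms]]])
  then have eq: "val \<eta> j x = val \<eta> i x" by (simp add: tie_def val_def inner_diff_left)
  have "\<forall>l. val \<eta> l x \<le> val \<eta> j x" unfolding eq using xi unfolding closed_cell_def by blast
  then have "x \<in> closed_cell \<eta> j" using xi unfolding closed_cell_def by blast
  then show "x \<in> closed_cell \<eta> i \<inter> closed_cell \<eta> j" using xi by blast
qed

text \<open>The closures of two nonempty cells are the closed cells, and these meet in the image of the edge, which is
  empty, a single point, or a segment. In the first two cases both sides vanish.\<close>
lemma Theta_offdiag_eq:
  assumes \<epsilon>: "\<epsilon> > 0" and ji: "j \<noteq> i" and ne: "cell D a \<xi> i \<noteq> {}"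
  shows "Theta_offdiag D \<rho> a \<xi> i j = tie_weight i j (bump \<xi> \<epsilon>)"
proof -
  interpret P: moving_polygon rhos "upper i" "lower i" R by (rule polygon)
  define \<eta> where "\<eta> = bump \<xi> \<epsilon>"
  define l where "l = tline (tie i j)"
  define p where "p = shear \<kappa> 0 (snd l \<eta>)"
  define v where "v = shear \<kappa> 1 (fst l)"
  define \<gamma> where "\<gamma> s = p + s *\<^sub>R v" for s
  have \<gamma>: "shear \<kappa> s (line l \<eta> s) = \<gamma> s" for s by (simp add: shear_line \<gamma>_def p_def v_def)
  have int: "closed_cell \<eta> i \<inter> closed_cell \<eta> j = \<gamma> ` edge_params i l \<eta>"
    using closed_cell_Int_eq_edge[OF ji, of \<eta>] by (simp add: l_def[symmetric] \<gamma>)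
  have nv: "norm v = norm (a j - a i) / \<bar>cf (a j - a i)\<bar>"
    using norm_tie_direction[OF ji] by (simp add: v_def l_def)
  have aji: "norm (a j - a i) > 0" using ji inj_a by (simp add: inj_eq)
  have v0: "v \<noteq> 0" using nv aji cf_tie[OF ji] by auto
  have w: "tie_weight i j \<eta> = integral (edge_params i l \<eta>) (\<lambda>s. dens (\<gamma> s)) / \<bar>cf (a j - a i)\<bar>"
    by (simp add: tie_weight_def l_def[symmetric] \<gamma>)
  have "Theta_offdiag D \<rho> a \<xi> i j = tie_weight i j \<eta>"
  proof (cases "cell D a \<xi> j = {}")
    case True
    then have "\<gamma> ` edge_params i l \<eta> = {}" using int closed_cell_bump_empty[OF \<epsilon> True] by (simp add: \<eta>_def)
    then have "edge_params i l \<eta> = {}" by simp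
    then show ?thesis using True by (simp add: w Theta_offdiag_def share_edge_def)
  next
    case False
    have ce: "cell_edge D a \<xi> i j = \<gamma> ` edge_params i l \<eta>"
      using int by (simp add: cell_edge_def closure_cell ne False \<eta>_def closed_cell_bump[OF \<epsilon>])
    have "edge_params i l \<eta> = {} \<or> (\<exists>A B. A \<le> B \<and> edge_params i l \<eta> = {A..B})"
      using P.edge_interval[of l \<eta>] tline_tie_in[OF ji] unfolding edge_params_def l_def by blast
    then show ?thesis
    proof (elim disjE exE conjE)
      assume e: "edge_params i l \<eta> = {}"
      then have "\<not> share_edge D a \<xi> i j" by (auto simp: share_edge_def ce)
      then show ?thesis using e by (simp add: w Theta_offdiag_def)
    next
      fix A B assume AB: "A \<le> B" and e: "edge_params i l \<eta> = {A..B}"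
      show ?thesis
      proof (cases "A = B")
        case True
        have "\<not> share_edge D a \<xi> i j"
        proof
          assume "share_edge D a \<xi> i j"
          then obtain q q' where q: "q \<noteq> q'" "cell_edge D a \<xi> i j = closed_segment q q'"
            unfolding share_edge_def by blast
          then have "{q, q'} \<subseteq> {\<gamma> A}" using ce e True by auto
          then show False using q(1) by blast
        qed
        then show ?thesis using e True by (simp add: w Theta_offdiag_def)
      next
        case neq: False
        have seg: "cell_edge D a \<xi> i j = closed_segment (\<gamma> A) (\<gamma> B)"
        proof -
          have "\<gamma> ` {A..B} = (\<lambda>x. p + x) ` ((\<lambda>s. s *\<^sub>R v) ` closed_segment A B)"
            using AB by (simp add: \<gamma>_def[abs_def] image_image closed_segment_eq_real_ivl)
          also have "(\<lambda>s. s *\<^sub>R v) ` closed_segment A B = closed_segment (A *\<^sub>R v) (B *\<^sub>R v)"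
            by (rule closed_segment_linear_image[symmetric]) (auto intro!: linearI simp: algebra_simps)
          also have "(\<lambda>x. p + x) ` \<dots> = closed_segment (\<gamma> A) (\<gamma> B)"
            by (simp add: \<gamma>_def closed_segment_translation)
          finally show ?thesis using ce e by simp
        qed
        have "\<gamma> A \<noteq> \<gamma> B" using neq v0 by (simp add: \<gamma>_def)
        then have share: "share_edge D a \<xi> i j" using seg ne False unfolding share_edge_def by blast
        have sub: "cell_edge D a \<xi> i j \<subseteq> D" using ce int cell_subset_D(2) by (metis Int_lower1 subset_trans)
        have "(LINT x:cell_edge D a \<xi> i j|hausdorff1. \<rho> x) = (LINT x:cell_edge D a \<xi> i j|hausdorff1. dens x)"
          unfolding set_lebesgue_integral_def
          by (rule Bochner_Integration.integral_cong) (use sub dens_eq in \<open>auto simp: indicator_def\<close>)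
        also have "\<dots> = norm v * integral {A..B} (\<lambda>s. dens (\<gamma> s))"
          unfolding ce e \<gamma>_def using hausdorff1_segment_integral[OF v0 AB continuous_dens, of p] by simp
        finally show ?thesis
          using share aji by (simp add: Theta_offdiag_def w e nv)
      qed
    qed
  qed
  then show ?thesis by (simp add: \<eta>_def)
qed

text \<open>A continuous nonnegative density with integral \<open>0\<close> over the open cell vanishes on the cell, and hence on its
  closure. This is why the zero rows in the definition of \<^const>\<open>Theta\<close> are consistent with the edge integrals.\<close>
lemma dens_zero_on_null_cell:
  assumes "measure \<mu> (cell D a \<xi> i) = 0" and ne: "cell D a \<xi> i \<noteq> {}" and x: "x \<in> closed_cell \<xi> i"
  shows "dens x = 0"
proof -
  let ?N = "{x \<in> cell D a \<xi> i. dens x > 0}"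
  have "emeasure \<mu> (cell D a \<xi> i) = ennreal (cell_mass i \<xi>)"
    by (simp add: emeasure_cell nn_integral_closed_cell)
  then have "emeasure \<mu> (cell D a \<xi> i) = 0" using assms(1) cell_mass_nonneg by (simp add: measure_def)
  then have "(\<integral>\<^sup>+ x. ennreal (dens x) * indicator (cell D a \<xi> i) x \<partial>lborel) = 0"
    using emeasure_\<mu>[OF sets_cell(1) cell_subset_D(1)] by simp
  then have ae: "AE x in lborel. ennreal (dens x) * indicator (cell D a \<xi> i) x = 0"
    by (subst (asm) nn_integral_0_iff_AE) (auto intro!: borel_measurable_times_ennreal borel_measurable_indicator)
  have "open ?N"
  proof -
    have "?N = cell D a \<xi> i \<inter> {x. 0 < dens x}" by blast
    moreover have "open {x. 0 < dens x}" by (intro open_Collect_less continuous_on_const continuous_dens)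
    ultimately show ?thesis using open_cell by (simp add: open_Int)
  qed
  moreover have "negligible ?N"
  proof -
    have "AE x in lborel. x \<notin> ?N" using ae
      by eventually_elim (auto simp: indicator_def not_less ennreal_eq_0_iff split: if_splits)
    then have "?N \<in> null_sets lborel" using \<open>open ?N\<close> by (subst AE_iff_null_sets) auto
    then show ?thesis by (simp add: negligible_iff_null_sets null_sets_completionI)
  qed
  ultimately have N: "?N = {}" by (metis open_not_negligible)
  have "cell D a \<xi> i \<subseteq> {x. dens x = 0}" using N dens_nn by (auto simp: less_le)
  moreover have "closed {x. dens x = 0}" by (intro closed_Collect_eq continuous_on_const continuous_dens)
  ultimately have "closure (cell D a \<xi> i) \<subseteq> {x. dens x = 0}" by (rule closure_minimal)
  then show ?thesis using x closure_cell[OF ne] by blast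
qed

text \<open>A row of an empty cell vanishes because the cell stays empty nearby; the other rows are given by the edge
  integrals of the unchanged partition.\<close>
theorem u_tilde_has_derivative:
  assumes \<epsilon>: "\<epsilon> > 0"
  shows "(u_tilde D \<mu> a has_derivative (\<lambda>h. Theta D \<mu> \<rho> a \<xi> *v h)) (at (bump \<xi> \<epsilon>))"
proof -
  define \<eta> where "\<eta> = bump \<xi> \<epsilon>"
  have "(cell_mass i has_derivative (\<lambda>h. Theta D \<mu> \<rho> a \<xi> $ i \<bullet> h)) (at \<eta>)" for i
  proof (cases "cell D a \<xi> i = {}")
    case True
    have "\<forall>\<^sub>F \<zeta> in nhds \<eta>. cell_mass i \<zeta> = 0"
      unfolding eventually_nhds_metric
    proof (intro exI[of _ "\<epsilon>/2"] conjI allI impI)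
      fix \<zeta> assume "dist \<zeta> \<eta> < \<epsilon>/2"
      then have "closed_cell \<zeta> i = {}"
        using closed_cell_near_bump_empty[OF True, of \<zeta> \<epsilon>] by (simp add: \<eta>_def dist_norm)
      then have "cell D a \<zeta> i = {}" using cell_subset_closed_cell by blast
      then have "u_tilde D \<mu> a \<zeta> $ i = 0" by (simp add: u_tilde_def)
      then show "cell_mass i \<zeta> = 0" by (simp add: u_tilde_eq)
    qed (use \<epsilon> in simp)
    moreover have "Theta D \<mu> \<rho> a \<xi> $ i = 0" using True by (simp add: Theta_def vec_eq_iff)
    ultimately show ?thesis using has_derivative_eventually_eq[OF has_derivative_const] by simp
  next
    case False
    have row: "Theta D \<mu> \<rho> a \<xi> $ i \<bullet> h = (\<Sum>j\<in>-{i}. tie_weight i j \<eta> * (h $ j - h $ i))" for h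
    proof (cases "measure \<mu> (cell D a \<xi> i) > 0")
      case True
      have T: "Theta D \<mu> \<rho> a \<xi> $ i $ k = (if k \<noteq> i then tie_weight i k \<eta> else - (\<Sum>l\<in>-{i}. tie_weight i l \<eta>))" for k
      proof -
        have "(\<Sum>l | l \<noteq> i. Theta_offdiag D \<rho> a \<xi> i l) = (\<Sum>l\<in>-{i}. tie_weight i l \<eta>)"
          by (rule sum.cong) (auto simp: \<eta>_def Theta_offdiag_eq[OF \<epsilon> _ False])
        then show ?thesis using True Theta_offdiag_eq[OF \<epsilon> _ False, of k] by (simp add: Theta_def \<eta>_def)
      qed
      have "Theta D \<mu> \<rho> a \<xi> $ i \<bullet> h = (\<Sum>k\<in>insert i (-{i}). Theta D \<mu> \<rho> a \<xi> $ i $ k * h $ k)"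
      proof -
        have "insert i (-{i}) = UNIV" by auto
        then show ?thesis by (simp only: inner_vec_def inner_real_def)
      qed
      also have "\<dots> = - (\<Sum>l\<in>-{i}. tie_weight i l \<eta>) * h $ i + (\<Sum>k\<in>-{i}. tie_weight i k \<eta> * h $ k)"
        by (subst sum.insert) (auto simp: T intro!: sum.cong)
      also have "\<dots> = (\<Sum>j\<in>-{i}. tie_weight i j \<eta> * (h $ j - h $ i))"
        by (simp add: right_diff_distrib sum_subtractf sum_distrib_right)
      finally show ?thesis .
    next
      case null: False
      then have m0: "measure \<mu> (cell D a \<xi> i) = 0" by (simp add: less_le)
      have "tie_weight i j \<eta> = 0" if "j \<noteq> i" for j
      proof -
        have "integral (edge_params i (tline (tie i j)) \<eta>) (\<lambda>s. rhos s (line (tline (tie i j)) \<eta> s)) = 0"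
        proof -
          have "rhos s (line (tline (tie i j)) \<eta> s) = 0" if "s \<in> edge_params i (tline (tie i j)) \<eta>" for s
          proof -
            have "shear \<kappa> s (line (tline (tie i j)) \<eta> s) \<in> closed_cell \<xi> i"
              using that by (simp add: edge_params_iff \<eta>_def closed_cell_bump[OF \<epsilon> False])
            then show ?thesis by (rule dens_zero_on_null_cell[OF m0 False])
          qed
          then have "integral (edge_params i (tline (tie i j)) \<eta>) (\<lambda>s. rhos s (line (tline (tie i j)) \<eta> s)) =
              integral (edge_params i (tline (tie i j)) \<eta>) (\<lambda>s. 0)"
            by (rule Henstock_Kurzweil_Integration.integral_cong)
          then show ?thesis by simp
        qed
        then show ?thesis by (simp add: tie_weight_def)
      qed
      moreover have "Theta D \<mu> \<rho> a \<xi> $ i = 0" using null by (simp add: Theta_def vec_eq_iff)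
      ultimately show ?thesis by simp
    qed
    have "cell D a \<eta> k = {} \<Longrightarrow> closed_cell \<eta> k = {}" for k
      using closed_cell_bump_empty[OF \<epsilon>, of \<xi> k] cell_bump_nonempty[OF \<epsilon>, of \<xi> k] unfolding \<eta>_def by blast
    then show ?thesis unfolding row
      using cell_mass_has_derivative[of \<eta> i] cell_bump_nonempty[OF \<epsilon> False] by (simp add: \<eta>_def)
  qed
  then have "((\<lambda>\<xi>. \<chi> i. cell_mass i \<xi>) has_derivative (\<lambda>h. \<chi> i. Theta D \<mu> \<rho> a \<xi> $ i \<bullet> h)) (at \<eta>)"
    by (rule has_derivative_vec_lambda)
  moreover have "(\<chi> i. Theta D \<mu> \<rho> a \<xi> $ i \<bullet> h) = Theta D \<mu> \<rho> a \<xi> *v h" for h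
    by (simp add: vec_eq_iff matrix_vector_mul_component)
  ultimately show ?thesis by (simp add: u_tilde_eq[abs_def] \<eta>_def)
qed

end

section \<open>The transport cost by duality\<close>
lemma integrable_continuous_compact:
  fixes f :: "'a::euclidean_space \<Rightarrow> real"
  assumes "finite_measure M" and sets: "sets M = sets (restrict_space borel S)" and "compact S" "continuous_on S f"
  shows "integrable M f"
proof -
  interpret finite_measure M by fact
  have "space M = S" using sets_eq_imp_space_eq[OF sets] by (simp add: space_restrict_space)
  have "bounded (f ` S)" using compact_continuous_image[OF assms(4,3)] by (rule compact_imp_bounded)
  then obtain B where B: "\<And>x. x \<in> S \<Longrightarrow> norm (f x) \<le> B" by (auto simp: bounded_iff)
  have "f \<in> borel_measurable M"
    using borel_measurable_continuous_on_restrict[OF assms(4)] by (simp cong: measurable_cong_sets add: sets)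
  then show ?thesis
    by (intro integrable_const_bound[of _ B] AE_I2) (use B in \<open>auto simp: \<open>space M = S\<close>\<close>)
qed

lemma (in semidiscrete) continuous_u: "continuous_on UNIV (u_tilde D \<mu> a)"
  using coords_exist semidiscrete_coords.continuous_u_tilde by blast

context semidiscrete
begin

lemma finite_measure_\<mu>: "finite_measure \<mu>"
proof
  obtain M where M: "\<And>x. \<bar>dens x\<bar> \<le> M" using dens_bounded by blast
  have "emeasure \<mu> D = (\<integral>\<^sup>+ x. ennreal (dens x) * indicator D x \<partial>lborel)"
    by (rule emeasure_\<mu>) (use D in auto)
  also have "\<dots> \<le> (\<integral>\<^sup>+ x. ennreal M * indicator D x \<partial>lborel)"
    using M by (intro nn_integral_mono mult_right_mono ennreal_leI) (auto simp: abs_le_iff)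
  also have "\<dots> = ennreal M * emeasure lborel D" using D by (simp add: nn_integral_cmult_indicator)
  also have "\<dots> < \<infinity>" using emeasure_bounded_finite[OF D(6)] by (simp add: ennreal_mult_less_top)
  finally show "emeasure \<mu> (space \<mu>) \<noteq> \<infinity>" by simp
qed

lemma integrable_\<mu>: "continuous_on D f \<Longrightarrow> integrable \<mu> (f :: real^2 \<Rightarrow> real)"
  by (rule integrable_continuous_compact[OF finite_measure_\<mu> sets_\<mu> D(1)])

lemma cell_in_\<mu>: "cell D a \<xi> i \<in> sets \<mu>"
  using D cell_subset_D by (simp add: sets_restrict_space_iff)

lemma AE_in_cell: "AE x in \<mu>. \<exists>i. x \<in> cell D a \<xi> i"
  using AE_\<mu>[OF AE_ties[of \<xi>]] AE_space[of \<mu>]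
  by eventually_elim (simp add: D_subset_cells_ties)

lemma sum_indicator_cell:
  fixes c :: "'n \<Rightarrow> real"
  assumes "x \<in> cell D a \<xi> i" shows "(\<Sum>k\<in>UNIV. indicator (cell D a \<xi> k) x * c k) = c i"
proof -
  have "indicator (cell D a \<xi> k) x * c k = (if k = i then c k else 0)" for k
  proof (cases "k = i")
    case False
    then have "x \<notin> cell D a \<xi> k" using cell_disjoint[OF assms, of k] by metis
    then show ?thesis using False by simp
  qed (use assms in simp)
  then show ?thesis by simp
qed

lemma has_bochner_integral_cells:
  "has_bochner_integral \<mu> (\<lambda>x. \<Sum>k\<in>UNIV. indicator (cell D a \<xi> k) x * c k) (\<Sum>k\<in>UNIV. u_tilde D \<mu> a \<xi> $ k * c k)"
  unfolding u_tilde_def vec_lambda_beta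
  using finite_measure.emeasure_finite[OF finite_measure_\<mu>] cell_in_\<mu>
  by (intro has_bochner_integral_sum has_bochner_integral_mult_left has_bochner_integral_real_indicator)
     (auto simp: less_top)

definition psi :: "real^'n \<Rightarrow> real^2 \<Rightarrow> real" where "psi \<xi> x = Max (range (\<lambda>j. val \<xi> j x))"

definition phi :: "real^'n \<Rightarrow> real" where "phi \<xi> = (LINT x|\<mu>. psi \<xi> x)"

lemma val_le_psi: "val \<xi> j x \<le> psi \<xi> x"
  unfolding psi_def by (rule Max_ge) auto

lemma psi_cell:
  assumes "x \<in> cell D a \<xi> i" shows "psi \<xi> x = val \<xi> i x"
proof -
  have "x \<in> closed_cell \<xi> i" using assms cell_subset_closed_cell by blast
  then have "\<forall>j. val \<xi> j x \<le> val \<xi> i x" unfolding closed_cell_def by blast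
  then show ?thesis unfolding psi_def by (intro Max_eqI) auto
qed

lemma continuous_psi: "continuous_on S (psi \<xi>)"
  unfolding psi_def by (rule continuous_on_Max) (auto intro: continuous_val)

text \<open>On the cell of \<open>i\<close> at \<open>\<xi>\<close> the maximum at \<open>\<eta>\<close> is at least the value of index \<open>i\<close>, which has changed by
  \<open>\<xi> $ i - \<eta> $ i\<close>.\<close>
lemma phi_subgradient: "phi \<xi> - u_tilde D \<mu> a \<xi> \<bullet> (\<eta> - \<xi>) \<le> phi \<eta>"
proof -
  let ?f = "\<lambda>x. psi \<xi> x - (\<Sum>k\<in>UNIV. indicator (cell D a \<xi> k) x * (\<eta> $ k - \<xi> $ k))"
  have f: "has_bochner_integral \<mu> ?f (phi \<xi> - u_tilde D \<mu> a \<xi> \<bullet> (\<eta> - \<xi>))"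
    using has_bochner_integral_diff[OF has_bochner_integral_integrable[OF integrable_\<mu>[OF continuous_psi]] has_bochner_integral_cells]
    by (simp only: phi_def inner_vec_def vector_minus_component inner_real_def)
  then have "phi \<xi> - u_tilde D \<mu> a \<xi> \<bullet> (\<eta> - \<xi>) = integral\<^sup>L \<mu> ?f"
    by (simp only: has_bochner_integral_integral_eq)
  also have "\<dots> \<le> phi \<eta>"
    unfolding phi_def
  proof (rule integral_mono_AE)
    show "integrable \<mu> ?f" using f by (simp only: has_bochner_integral_iff)
    show "integrable \<mu> (psi \<eta>)" by (rule integrable_\<mu>[OF continuous_psi])
    show "AE x in \<mu>. ?f x \<le> psi \<eta> x"
      using AE_in_cell[of \<xi>]
    proof eventually_elim
      case (elim x)
      then obtain i where i: "x \<in> cell D a \<xi> i" by blast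
      show ?case unfolding sum_indicator_cell[OF i] psi_cell[OF i] using val_le_psi[of \<eta> i x] by (simp add: val_def)
    qed
  qed
  finally show ?thesis .
qed

text \<open>The subgradient inequalities at both points enclose the increment, and \<open>u\<close> is continuous.\<close>
lemma phi_has_derivative: "(phi has_derivative (\<lambda>h. (- u_tilde D \<mu> a \<xi>) \<bullet> h)) (at \<xi>)"
  unfolding has_derivative_at_alt
proof (intro conjI allI impI)
  show "bounded_linear (\<lambda>h. (- u_tilde D \<mu> a \<xi>) \<bullet> h)" by (rule bounded_linear_inner_right)
  fix e :: real assume "e > 0"
  have "isCont (u_tilde D \<mu> a) \<xi>" using continuous_u by (simp add: continuous_on_eq_continuous_at)
  then obtain d where d: "d > 0" "\<And>\<eta>. dist \<eta> \<xi> < d \<Longrightarrow> dist (u_tilde D \<mu> a \<eta>) (u_tilde D \<mu> a \<xi>) < e"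
    using \<open>e > 0\<close> unfolding continuous_at_eps_delta by metis
  have "norm (phi \<eta> - phi \<xi> - (- u_tilde D \<mu> a \<xi>) \<bullet> (\<eta> - \<xi>)) \<le> e * norm (\<eta> - \<xi>)" if "norm (\<eta> - \<xi>) < d" for \<eta>
  proof -
    have lower: "0 \<le> phi \<eta> - phi \<xi> - (- u_tilde D \<mu> a \<xi>) \<bullet> (\<eta> - \<xi>)"
      using phi_subgradient[of \<xi> \<eta>] by simp
    have "phi \<eta> - phi \<xi> - (- u_tilde D \<mu> a \<xi>) \<bullet> (\<eta> - \<xi>) \<le> (u_tilde D \<mu> a \<xi> - u_tilde D \<mu> a \<eta>) \<bullet> (\<eta> - \<xi>)"
      using phi_subgradient[of \<eta> \<xi>] by (simp add: inner_diff_left inner_diff_right)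
    also have "\<dots> \<le> norm (u_tilde D \<mu> a \<xi> - u_tilde D \<mu> a \<eta>) * norm (\<eta> - \<xi>)" by (rule norm_cauchy_schwarz)
    also have "\<dots> \<le> e * norm (\<eta> - \<xi>)"
      using d(2)[of \<eta>] that by (intro mult_right_mono) (auto simp: dist_norm norm_minus_commute less_imp_le)
    finally show ?thesis using lower by simp
  qed
  then show "\<exists>d>0. \<forall>\<eta>. norm (\<eta> - \<xi>) < d \<longrightarrow> norm (phi \<eta> - phi \<xi> - (- u_tilde D \<mu> a \<xi>) \<bullet> (\<eta> - \<xi>)) \<le> e * norm (\<eta> - \<xi>)"
    using d(1) by blast
qed

lemma C1_real_phi: "C1_real phi"
  by (rule C1_realI[OF phi_has_derivative]) (intro continuous_intros continuous_u)

text \<open>In \<open>\<bar>x - a i\<bar>\<^sup>2 = \<bar>x\<bar>\<^sup>2 - 2 * val \<xi> i x + dual_const \<xi> i\<close> only the middle term couples \<open>x\<close> and \<open>i\<close>, and it is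
  minimal where \<open>val \<xi> i x\<close> is the maximum \<open>psi \<xi> x\<close>. The remaining terms are determined by the marginals.\<close>
definition dual_const :: "real^'n \<Rightarrow> 'n \<Rightarrow> real" where "dual_const \<xi> i = (norm (a i))\<^sup>2 - 2 * \<xi> $ i"

definition dual_value :: "real^'n \<Rightarrow> real" where
  "dual_value \<xi> = (LINT x|\<mu>. (norm x)\<^sup>2 - 2 * psi \<xi> x) + (\<Sum>i\<in>UNIV. u_tilde D \<mu> a \<xi> $ i * dual_const \<xi> i)"

lemma cost_expand: "(norm (x - a i))\<^sup>2 = (norm x)\<^sup>2 - 2 * val \<xi> i x + dual_const \<xi> i"
  by (simp add: val_def dual_const_def power2_norm_eq_inner inner_diff_left inner_diff_right inner_commute algebra_simps)

lemma product_sets: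
  assumes "B \<in> sets (restrict_space borel D)" "C \<subseteq> range a"
  shows "B \<times> C \<in> sets (restrict_space borel (D \<times> range a))"
proof -
  have "finite C" by (rule finite_subset[OF assms(2)]) simp
  then have C: "C \<in> sets borel" by (intro borel_closed finite_imp_closed)
  have S: "D \<times> range a \<in> sets borel"
    unfolding borel_prod[symmetric] using D by (intro pair_measureI) (auto intro!: borel_closed finite_imp_closed)
  have B: "B \<in> sets borel" "B \<subseteq> D" using assms(1) D by (auto simp: sets_restrict_space_iff)
  have "B \<times> C \<in> sets borel" unfolding borel_prod[symmetric] using C B by (intro pair_measureI)
  moreover have "B \<times> C \<subseteq> D \<times> range a" using B(2) assms(2) by blast
  ultimately show ?thesis using S by (simp add: sets_restrict_space_iff)
qed

lemma D_in: "D \<in> sets (restrict_space borel D)"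
  using D by (simp add: sets_restrict_space_iff)

text \<open>Replacing \<open>val \<xi> i x\<close> by the maximum bounds the cost from below by a sum of a function of \<open>x\<close> and a
  function of \<open>i\<close>, whose integral depends only on the marginals.\<close>
lemma coupling_cost_ge:
  assumes \<gamma>: "\<gamma> \<in> couplings D \<mu> a (u_tilde D \<mu> a \<xi>)"
  shows "ennreal (dual_value \<xi>) \<le> (\<integral>\<^sup>+ z. ennreal ((norm (fst z - snd z))\<^sup>2) \<partial>\<gamma>)"
proof -
  let ?S = "D \<times> range a"
  have sets: "sets \<gamma> = sets (restrict_space borel ?S)"
    and m1: "\<And>B. B \<in> sets (restrict_space borel D) \<Longrightarrow> emeasure \<gamma> (B \<times> range a) = emeasure \<mu> B"
    and m2: "\<And>B. B \<subseteq> range a \<Longrightarrow> enn2ereal (emeasure \<gamma> (D \<times> B)) = ereal (\<Sum>i | a i \<in> B. u_tilde D \<mu> a \<xi> $ i)"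
    using \<gamma> by (auto simp: couplings_def)
  have sp: "space \<gamma> = ?S" using sets_eq_imp_space_eq[OF sets] by (simp add: space_restrict_space)
  interpret M: finite_measure \<mu> by (rule finite_measure_\<mu>)
  have fin: "finite_measure \<gamma>"
    by standard (use m1[OF D_in] M.emeasure_finite[of D] in \<open>simp add: sp\<close>)
  interpret G: finite_measure \<gamma> by fact
  have S: "compact ?S" by (intro compact_Times D finite_imp_compact) simp
  note intC = integrable_continuous_compact[OF fin sets S]
  have proj: "distr \<gamma> \<mu> fst = \<mu>" and fm: "fst \<in> measurable \<gamma> \<mu>"
  proof -
    have pre: "fst -` B \<inter> space \<gamma> = B \<times> range a" if "B \<in> sets \<mu>" for B
      using sets.sets_into_space[OF that] by (auto simp: sp)
    show fm: "fst \<in> measurable \<gamma> \<mu>"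
    proof (rule measurableI)
      show "fst -` B \<inter> space \<gamma> \<in> sets \<gamma>" if "B \<in> sets \<mu>" for B
        unfolding pre[OF that] sets using that by (intro product_sets) auto
    qed (auto simp: sp)
    show "distr \<gamma> \<mu> fst = \<mu>"
    proof (rule measure_eqI)
      fix B assume "B \<in> sets (distr \<gamma> \<mu> fst)"
      then have B: "B \<in> sets \<mu>" by simp
      have "emeasure (distr \<gamma> \<mu> fst) B = emeasure \<gamma> (fst -` B \<inter> space \<gamma>)" using B by (rule emeasure_distr[OF fm])
      then show "emeasure (distr \<gamma> \<mu> fst) B = emeasure \<mu> B" using m1[of B] B by (simp add: pre)
    qed simp
  qed
  define h where "h x = (norm x)\<^sup>2 - 2 * psi \<xi> x" for x
  have hc: "continuous_on T h" for T unfolding h_def by (intro continuous_intros continuous_psi)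
  have hint: "(LINT z|\<gamma>. h (fst z)) = (LINT x|\<mu>. h x)"
  proof -
    have "h \<in> borel_measurable \<mu>" using integrable_\<mu>[OF hc] by simp
    from integral_distr[OF fm this] show ?thesis unfolding proj by simp
  qed
  have mi: "D \<times> {a i} \<in> sets \<gamma>" for i unfolding sets by (intro product_sets D_in) simp
  have "measure \<gamma> (D \<times> {a i}) = u_tilde D \<mu> a \<xi> $ i" for i
  proof -
    have "{k. a k \<in> {a i}} = {i}" using inj_a by (auto simp: inj_eq)
    then have "enn2ereal (emeasure \<gamma> (D \<times> {a i})) = ereal (u_tilde D \<mu> a \<xi> $ i)" using m2[of "{a i}"] by simp
    then show ?thesis by (simp add: measure_def enn2real_def)
  qed
  note m = this
  have Bi: "has_bochner_integral \<gamma> (\<lambda>z. indicator (D \<times> {a i}) z * dual_const \<xi> i) (u_tilde D \<mu> a \<xi> $ i * dual_const \<xi> i)" for i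
  proof -
    have "emeasure \<gamma> (D \<times> {a i}) < \<infinity>" by (simp add: G.emeasure_eq_measure)
    from has_bochner_integral_mult_left[OF has_bochner_integral_real_indicator[OF mi[of i] this], of "dual_const \<xi> i"]
    show ?thesis by (simp only: m)
  qed
  have cc: "continuous_on T (\<lambda>z :: (real^2) \<times> (real^2). h (fst z))" for T
    by (intro continuous_on_compose2[OF hc[of UNIV]] continuous_intros) auto
  let ?F = "\<lambda>z. h (fst z) + (\<Sum>i\<in>UNIV. indicator (D \<times> {a i}) z * dual_const \<xi> i)"
  have F: "has_bochner_integral \<gamma> ?F (dual_value \<xi>)"
    unfolding dual_value_def h_def[symmetric] hint[symmetric]
    by (intro has_bochner_integral_add has_bochner_integral_sum has_bochner_integral_integrable Bi intC cc)
  then have "dual_value \<xi> = integral\<^sup>L \<gamma> ?F" by (simp only: has_bochner_integral_integral_eq)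
  also have "\<dots> \<le> (LINT z|\<gamma>. (norm (fst z - snd z))\<^sup>2)"
  proof (rule integral_mono)
    show "integrable \<gamma> (\<lambda>z. (norm (fst z - snd z))\<^sup>2)"
      by (intro intC continuous_intros)
    show "integrable \<gamma> ?F" using F by (simp only: has_bochner_integral_iff)
    fix z assume "z \<in> space \<gamma>"
    then obtain x k where z: "z = (x, a k)" "x \<in> D" by (auto simp: sp)
    have "(\<Sum>i\<in>UNIV. indicator (D \<times> {a i}) z * dual_const \<xi> i) = dual_const \<xi> k"
    proof -
      have "indicator (D \<times> {a i}) z * dual_const \<xi> i = (if i = k then dual_const \<xi> i else 0)" for i
        using z inj_a by (auto simp: indicator_def inj_eq)
      then show ?thesis by simp
    qed
    then show "?F z \<le> (norm (fst z - snd z))\<^sup>2"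
      using val_le_psi[of \<xi> k x] cost_expand[of x k \<xi>] by (simp add: z h_def)
  qed
  finally have "ennreal (dual_value \<xi>) \<le> ennreal (LINT z|\<gamma>. (norm (fst z - snd z))\<^sup>2)" by (rule ennreal_leI)
  also have "\<dots> = (\<integral>\<^sup>+ z. ennreal ((norm (fst z - snd z))\<^sup>2) \<partial>\<gamma>)"
    by (rule nn_integral_eq_integral[symmetric]) (auto intro!: intC continuous_intros)
  finally show ?thesis .
qed

text \<open>Sending the cell of \<open>i\<close> to \<open>a i\<close> turns the lower bound into an equality.\<close>
lemma laguerre_coupling:
  obtains \<gamma> where "\<gamma> \<in> couplings D \<mu> a (u_tilde D \<mu> a \<xi>)"
    "(\<integral>\<^sup>+ z. ennreal ((norm (fst z - snd z))\<^sup>2) \<partial>\<gamma>) = ennreal (dual_value \<xi>)" "0 \<le> dual_value \<xi>"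
proof -
  let ?S = "D \<times> range a" and ?C = "\<Union>i. cell D a \<xi> i"
  (* The value outside the cells, a null set, is arbitrary in F. *)
  define T where "T x = (\<Sum>i\<in>UNIV. indicator (cell D a \<xi> i) x *\<^sub>R a i) + indicator (- ?C) x *\<^sub>R a undefined" for x
  have Tcell: "T x = a i" if "x \<in> cell D a \<xi> i" for x i
  proof -
    have "indicator (cell D a \<xi> k) x *\<^sub>R a k = (if k = i then a k else 0)" for k
    proof (cases "k = i")
      case False
      then have "x \<notin> cell D a \<xi> k" using cell_disjoint[OF that, of k] by metis
      then show ?thesis using False by simp
    qed (use that in simp)
    moreover have "x \<in> ?C" using that by blast
    ultimately show ?thesis by (simp add: T_def)
  qed
  have Tno: "T x = a undefined" if "x \<notin> ?C" for x
  proof -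
    have "indicator (cell D a \<xi> k) x *\<^sub>R a k = 0" for k using that by (auto simp: indicator_def)
    then show ?thesis using that by (simp add: T_def)
  qed
  have Trange: "T x \<in> range a" for x using Tcell Tno by (cases "x \<in> ?C") auto
  have "?C \<in> sets borel" by (intro sets.finite_UN) auto
  then have Cc: "- ?C \<in> sets borel" by (rule borel_comp)
  have Tm: "T \<in> borel_measurable borel" unfolding T_def[abs_def]
    by (intro borel_measurable_add borel_measurable_sum borel_measurable_scaleR borel_measurable_indicator
        borel_measurable_const sets_cell Cc)
  have "(\<lambda>x. (x, T x)) \<in> borel_measurable borel" using Tm by (intro borel_measurable_Pair) auto
  then have "(\<lambda>x. (x, T x)) \<in> restrict_space borel D \<rightarrow>\<^sub>M restrict_space borel ?S"
    by (intro measurable_restrict_space2 measurable_restrict_space1) (auto simp: space_restrict_space Trange)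
  then have gm: "(\<lambda>x. (x, T x)) \<in> measurable \<mu> (restrict_space borel ?S)"
    by (simp cong: measurable_cong_sets)
  define \<gamma> where "\<gamma> = distr \<mu> (restrict_space borel ?S) (\<lambda>x. (x, T x))"
  have em: "emeasure \<gamma> (B \<times> C) = emeasure \<mu> {x \<in> B. T x \<in> C}"
    if "B \<in> sets (restrict_space borel D)" "C \<subseteq> range a" for B C
  proof -
    have "B \<subseteq> D" using that(1) D by (simp add: sets_restrict_space_iff)
    then have "(\<lambda>x. (x, T x)) -` (B \<times> C) \<inter> space \<mu> = {x \<in> B. T x \<in> C}" by auto
    then show ?thesis unfolding \<gamma>_def using emeasure_distr[OF gm product_sets[OF that]] by simp
  qed
  have coup: "\<gamma> \<in> couplings D \<mu> a (u_tilde D \<mu> a \<xi>)"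
    unfolding couplings_def
  proof (intro CollectI conjI ballI allI impI)
    show "sets \<gamma> = sets (restrict_space borel ?S)" by (simp add: \<gamma>_def)
    show "emeasure \<gamma> (B \<times> range a) = emeasure \<mu> B" if "B \<in> sets (restrict_space borel D)" for B
      using em[OF that subset_refl] Trange by simp
    fix B assume B: "B \<subseteq> range a"
    have "emeasure \<gamma> (D \<times> B) = emeasure \<mu> {x \<in> D. T x \<in> B}" by (rule em[OF D_in B])
    also have "\<dots> = emeasure \<mu> (\<Union>i\<in>{i. a i \<in> B}. cell D a \<xi> i)"
    proof (rule emeasure_eq_AE)
      show "AE x in \<mu>. x \<in> {x \<in> D. T x \<in> B} \<longleftrightarrow> x \<in> (\<Union>i\<in>{i. a i \<in> B}. cell D a \<xi> i)"
        using AE_in_cell[of \<xi>]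
      proof eventually_elim
        case (elim x)
        then obtain i where i: "x \<in> cell D a \<xi> i" by blast
        have "x \<in> (\<Union>i\<in>{i. a i \<in> B}. cell D a \<xi> i) \<longleftrightarrow> a i \<in> B" using i cell_disjoint[OF i] by blast
        moreover have "x \<in> D" using i cell_subset_D(1) by blast
        ultimately show ?case using Tcell[OF i] by simp
      qed
      have "{x \<in> D. T x \<in> B} = (\<lambda>x. (x, T x)) -` (D \<times> B) \<inter> space \<mu>" by auto
      also have "\<dots> \<in> sets \<mu>" using measurable_sets[OF gm product_sets[OF D_in B]] .
      finally show "{x \<in> D. T x \<in> B} \<in> sets \<mu>" .
      show "(\<Union>i\<in>{i. a i \<in> B}. cell D a \<xi> i) \<in> sets \<mu>" using cell_in_\<mu> by (intro sets.finite_UN) auto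
    qed
    also have "\<dots> = (\<Sum>i\<in>{i. a i \<in> B}. emeasure \<mu> (cell D a \<xi> i))"
      using cell_in_\<mu> cell_disjoint by (intro sum_emeasure[symmetric]) (auto simp: disjoint_family_on_def)
    also have "\<dots> = (\<Sum>i\<in>{i. a i \<in> B}. ennreal (u_tilde D \<mu> a \<xi> $ i))"
      by (simp add: u_tilde_def finite_measure.emeasure_eq_measure[OF finite_measure_\<mu>])
    also have "\<dots> = ennreal (\<Sum>i | a i \<in> B. u_tilde D \<mu> a \<xi> $ i)"
      by (rule sum_ennreal) (simp add: u_tilde_def)
    finally show "enn2ereal (emeasure \<gamma> (D \<times> B)) = ereal (\<Sum>i | a i \<in> B. u_tilde D \<mu> a \<xi> $ i)"
      by (simp add: u_tilde_def sum_nonneg enn2ereal_ennreal)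
  qed
  define q where "q x = ((norm x)\<^sup>2 - 2 * psi \<xi> x) + (\<Sum>k\<in>UNIV. indicator (cell D a \<xi> k) x * dual_const \<xi> k)" for x
  have q_AE: "AE x in \<mu>. (norm (x - T x))\<^sup>2 = q x"
    using AE_in_cell[of \<xi>]
  proof eventually_elim
    case (elim x)
    then obtain i where i: "x \<in> cell D a \<xi> i" by blast
    then show ?case using cost_expand[of x i \<xi>] by (simp add: q_def Tcell[OF i] sum_indicator_cell[OF i] psi_cell[OF i])
  qed
  have "has_bochner_integral \<mu> q (dual_value \<xi>)"
    unfolding q_def dual_value_def
    by (intro has_bochner_integral_add has_bochner_integral_cells has_bochner_integral_integrable
        integrable_\<mu> continuous_intros continuous_psi)
  then have q_int: "integrable \<mu> q" and q_val: "integral\<^sup>L \<mu> q = dual_value \<xi>"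
    by (simp_all only: has_bochner_integral_iff)
  have q_nn: "AE x in \<mu>. 0 \<le> q x" using q_AE by eventually_elim (metis zero_le_power2)
  have "(\<integral>\<^sup>+ z. ennreal ((norm (fst z - snd z))\<^sup>2) \<partial>\<gamma>) = (\<integral>\<^sup>+ x. ennreal ((norm (x - T x))\<^sup>2) \<partial>\<mu>)"
    unfolding \<gamma>_def
    by (subst nn_integral_distr[OF gm]) (auto intro!: measurable_restrict_space1 borel_measurable_continuous_onI continuous_intros)
  also have "\<dots> = (\<integral>\<^sup>+ x. ennreal (q x) \<partial>\<mu>)"
    by (rule nn_integral_cong_AE) (use q_AE in eventually_elim, simp)
  also have "\<dots> = ennreal (dual_value \<xi>)"
    using nn_integral_eq_integral[OF q_int q_nn] by (simp add: q_val)
  finally have "(\<integral>\<^sup>+ z. ennreal ((norm (fst z - snd z))\<^sup>2) \<partial>\<gamma>) = ennreal (dual_value \<xi>)" .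
  moreover have "0 \<le> dual_value \<xi>" unfolding q_val[symmetric] by (rule integral_nonneg_AE[OF q_nn])
  ultimately show thesis using that coup by blast
qed

theorem wasserstein2_sq_eq: "wasserstein2_sq D \<mu> a (u_tilde D \<mu> a \<xi>) = ennreal (dual_value \<xi>)" "0 \<le> dual_value \<xi>"
proof -
  obtain \<gamma> where \<gamma>: "\<gamma> \<in> couplings D \<mu> a (u_tilde D \<mu> a \<xi>)"
    "(\<integral>\<^sup>+ z. ennreal ((norm (fst z - snd z))\<^sup>2) \<partial>\<gamma>) = ennreal (dual_value \<xi>)" "0 \<le> dual_value \<xi>"
    by (rule laguerre_coupling)
  show "0 \<le> dual_value \<xi>" by (rule \<gamma>(3))
  show "wasserstein2_sq D \<mu> a (u_tilde D \<mu> a \<xi>) = ennreal (dual_value \<xi>)"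
    unfolding wasserstein2_sq_def
  proof (rule antisym)
    show "(INF \<gamma>\<in>couplings D \<mu> a (u_tilde D \<mu> a \<xi>). \<integral>\<^sup>+ z. ennreal ((norm (fst z - snd z))\<^sup>2) \<partial>\<gamma>) \<le> ennreal (dual_value \<xi>)"
      by (rule INF_lower2[OF \<gamma>(1)]) (simp add: \<gamma>(2))
    show "ennreal (dual_value \<xi>) \<le> (INF \<gamma>\<in>couplings D \<mu> a (u_tilde D \<mu> a \<xi>). \<integral>\<^sup>+ z. ennreal ((norm (fst z - snd z))\<^sup>2) \<partial>\<gamma>)"
      by (intro INF_greatest coupling_cost_ge)
  qed
qed

lemma W_fun_eq: "W_fun D \<mu> a \<xi> = (LINT x|\<mu>. (norm x)\<^sup>2) - 2 * phi \<xi> + 2 * ((A_vec a - \<xi>) \<bullet> u_tilde D \<mu> a \<xi>)"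
proof -
  have "(LINT x|\<mu>. (norm x)\<^sup>2 - 2 * psi \<xi> x) = (LINT x|\<mu>. (norm x)\<^sup>2) - 2 * phi \<xi>"
    unfolding phi_def
    by (subst Bochner_Integration.integral_diff) (auto intro!: integrable_\<mu> continuous_intros continuous_psi)
  moreover have "(\<Sum>i\<in>UNIV. u_tilde D \<mu> a \<xi> $ i * dual_const \<xi> i) = 2 * ((A_vec a - \<xi>) \<bullet> u_tilde D \<mu> a \<xi>)"
    by (simp add: inner_vec_def A_vec_def dual_const_def sum_distrib_left algebra_simps)
  moreover have "W_fun D \<mu> a \<xi> = dual_value \<xi>" by (simp add: W_fun_def wasserstein2_sq_eq)
  ultimately show ?thesis by (simp add: dual_value_def)
qed

end

section \<open>Generalized Jacobians\<close>
lemma clarke_jacobianI: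
  assumes "X \<longlonglongrightarrow> x" "\<And>k. (f has_derivative (\<lambda>s. Ms k *v s)) (at (X k))" "Ms \<longlonglongrightarrow> M"
  shows "M \<in> clarke_jacobian f x"
  unfolding clarke_jacobian_def
  by (rule hull_inc) (use assms in blast)

lemma scalar_fun_has_derivative:
  assumes "(f has_derivative (\<lambda>h. w \<bullet> h)) (at x)"
  shows "(scalar_fun f has_derivative (\<lambda>h. rowvector w *v h)) (at x)"
proof -
  have "((\<lambda>x. \<chi> i :: 1. f x) has_derivative (\<lambda>h. \<chi> i :: 1. w \<bullet> h)) (at x)"
    by (rule has_derivative_vec_lambda) (rule assms)
  moreover have "(\<chi> i :: 1. w \<bullet> h) = rowvector w *v h" for h
    by (simp add: vec_eq_iff matrix_vector_mul_component rowvector_def inner_vec_def)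
  ultimately show ?thesis by (simp add: scalar_fun_def vec_def)
qed

lemma C1_selection_imp_PC1_scalar:
  assumes "C1_selection f" "continuous_on UNIV f"
  shows "PC1 (scalar_fun f)"
proof (rule C1_selection_imp_PC1)
  show "C1_selection (\<lambda>x. scalar_fun f x $ i)" for i using assms(1) by (simp add: scalar_fun_def)
  show "continuous_on UNIV (scalar_fun f)" unfolding scalar_fun_def vec_def
    by (intro continuous_on_vec_lambda assms)
qed

lemma tendsto_rowvector_vector_matrix:
  fixes \<Theta> :: "real^'n^'m"
  assumes "(w \<longlongrightarrow> w0) F"
  shows "((\<lambda>k. rowvector (w k v* \<Theta>)) \<longlongrightarrow> (rowvector (w0 v* \<Theta>) :: real^'n^'k)) F"
  unfolding rowvector_def vector_matrix_mult_def vec_lambda_beta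
  by (intro tendsto_vec_lambda tendsto_sum tendsto_mult tendsto_const tendsto_vec_nth assms)

context semidiscrete
begin

lemma bump_tendsto: "(\<lambda>k. bump \<xi> (inverse (real (Suc k)))) \<longlonglongrightarrow> \<xi>"
proof -
  have "(\<lambda>k. \<xi> + inverse (real (Suc k)) *\<^sub>R (\<chi> k. if cell D a \<xi> k = {} then 1 else 0)) \<longlonglongrightarrow>
      \<xi> + 0 *\<^sub>R (\<chi> k. if cell D a \<xi> k = {} then 1 else 0)"
    by (intro tendsto_intros LIMSEQ_inverse_real_of_nat)
  then show ?thesis by (simp add: bump_def)
qed

lemma C1_selection_u: "C1_selection (\<lambda>\<xi>. u_tilde D \<mu> a \<xi> $ i)"
  using coords_exist semidiscrete_coords.C1_selection_u_tilde by blast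

lemma u_has_derivative:
  "\<epsilon> > 0 \<Longrightarrow> (u_tilde D \<mu> a has_derivative (\<lambda>h. Theta D \<mu> \<rho> a \<xi> *v h)) (at (bump \<xi> \<epsilon>))"
  using coords_exist semidiscrete_coords.u_tilde_has_derivative by blast

lemma continuous_W: "continuous_on UNIV (W_fun D \<mu> a)"
  unfolding W_fun_eq[abs_def]
  by (intro continuous_intros continuous_u C1_real_continuous[OF C1_real_phi])

lemma C1_selection_W: "C1_selection (W_fun D \<mu> a)"
proof -
  have eq: "W_fun D \<mu> a = (\<lambda>\<xi>. (LINT x|\<mu>. (norm x)\<^sup>2) - 2 * phi \<xi> + 2 * (\<Sum>i\<in>UNIV. (A_vec a $ i - \<xi> $ i) * u_tilde D \<mu> a \<xi> $ i))"
    by (simp add: W_fun_eq[abs_def] inner_vec_def)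
  show ?thesis unfolding eq
    by (intro C1_selection_add C1_selection_diff C1_selection_mult C1_selection_sum C1_selection_u
        C1_real_imp_selection C1_real_const C1_real_phi C1_real_nth)
qed

text \<open>The derivative of \<open>- 2 * phi\<close> cancels the term that arises from differentiating the factor \<open>A - \<xi>\<close>.\<close>
lemma W_has_derivative:
  assumes \<epsilon>: "\<epsilon> > 0" and \<eta>: "\<eta> = bump \<xi> \<epsilon>"
  shows "(W_fun D \<mu> a has_derivative (\<lambda>h. ((2 *\<^sub>R (A_vec a - \<eta>)) v* Theta D \<mu> \<rho> a \<xi>) \<bullet> h)) (at \<eta>)"
proof -
  have u: "(u_tilde D \<mu> a has_derivative (\<lambda>h. Theta D \<mu> \<rho> a \<xi> *v h)) (at \<eta>)"
    unfolding \<eta> by (rule u_has_derivative[OF \<epsilon>])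
  show ?thesis
    unfolding W_fun_eq[abs_def] dot_lmul_matrix
    by (rule derivative_eq_intros phi_has_derivative u refl | simp add: algebra_simps inner_commute)+
qed

end

theorem theorem3p14:
  fixes a :: "'n::finite \<Rightarrow> real^2"
    and D :: "(real^2) set"
    and u\<^sub>d :: "(real^2) measure"
    and \<rho> :: "real^2 \<Rightarrow> real"
    and \<alpha> :: real
    and g :: "real^'n \<Rightarrow> real"
    and grad_g :: "real^'n \<Rightarrow> real^'n"
    and hess_g :: "real^'n \<Rightarrow> real^'n^'n"
  assumes distinct_points: "inj a"
    and polygon: "polytope D" "interior D \<noteq> {}"
    and density_cont: "continuous_on D \<rho>"
    and density_nonneg: "\<And>x. x \<in> D \<Longrightarrow> 0 \<le> \<rho> x"
    and u\<^sub>d_density: "u\<^sub>d = density (restrict_space lborel D) (\<lambda>x. ennreal (\<rho> x))"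
    and alpha_pos: "\<alpha> > 0"
    and gradient: "\<And>v. GDERIV g v :> grad_g v"
    and hessian: "\<And>v. (grad_g has_derivative (\<lambda>h. hess_g v *v h)) (at v)"
    and hessian_cont: "continuous_on UNIV hess_g"
  defines "u \<equiv> u_tilde D u\<^sub>d a"
    and "W \<equiv> W_fun D u\<^sub>d a"
    and "J \<equiv> J_fun D u\<^sub>d a \<alpha> g"
    and "r \<equiv> r_fun D u\<^sub>d a \<alpha> grad_g"
    and "\<Theta> \<equiv> Theta D u\<^sub>d \<rho> a"
    and "A \<equiv> A_vec a"
  shows "(\<forall>\<xi>. wasserstein2_sq D u\<^sub>d a (u \<xi>) < \<infinity>)
    \<and> (PC1 (scalar_fun J) \<and> semismooth (scalar_fun J))
    \<and> (PC1 r \<and> semismooth r)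
    \<and> (PC1 u \<and> semismooth u)
    \<and> (PC1 (scalar_fun W) \<and> semismooth (scalar_fun W))
    \<and> (\<forall>\<xi>. \<Theta> \<xi> \<in> clarke_jacobian u \<xi>
         \<and> (1 / \<alpha>) *\<^sub>R (hess_g (u \<xi>) ** \<Theta> \<xi>) - mat 1 \<in> clarke_jacobian r \<xi>
         \<and> rowvector ((2 *\<^sub>R (A - \<xi>)) v* \<Theta> \<xi>) \<in> clarke_jacobian (scalar_fun W) \<xi>
         \<and> rowvector ((\<alpha> *\<^sub>R r \<xi>) v* \<Theta> \<xi>) \<in> clarke_jacobian (scalar_fun J) \<xi>)"
proof -
  interpret semidiscrete a D u\<^sub>d \<rho>
    by standard (use distinct_points polygon density_cont density_nonneg u\<^sub>d_density in auto)
  have grad: "(g has_derivative (\<lambda>s. grad_g v \<bullet> s)) (at v)" for v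
    using gradient[of v] by (simp add: gderiv_def inner_commute)
  have grad_cont: "continuous_on UNIV grad_g"
    using hessian by (auto simp: continuous_on_eq_continuous_at intro: has_derivative_continuous)
  have g_cont: "continuous_on UNIV g"
    using grad by (auto simp: continuous_on_eq_continuous_at intro: has_derivative_continuous)
  have u_cont: "continuous_on UNIV u" unfolding u_def by (rule continuous_u)
  have u_sel: "C1_selection (\<lambda>\<xi>. u \<xi> $ i)" for i unfolding u_def by (rule C1_selection_u)
  have J_eq: "J = (\<lambda>\<xi>. g (u \<xi>) + \<alpha> / 2 * W \<xi>)" by (simp add: J_def J_fun_def[abs_def] u_def W_def)
  have r_eq: "r = (\<lambda>\<xi>. A + (1 / \<alpha>) *\<^sub>R grad_g (u \<xi>) - \<xi>)" by (simp add: r_def r_fun_def[abs_def] u_def A_def)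
  have gu_cont: "continuous_on UNIV (\<lambda>\<xi>. g (u \<xi>))" "continuous_on UNIV (\<lambda>\<xi>. grad_g (u \<xi>))"
    using continuous_on_compose2[OF g_cont u_cont] continuous_on_compose2[OF grad_cont u_cont] by auto
  have PC1_u: "PC1 u" by (rule C1_selection_imp_PC1[OF u_sel u_cont])
  have PC1_W: "PC1 (scalar_fun W)"
    unfolding W_def by (rule C1_selection_imp_PC1_scalar[OF C1_selection_W continuous_W])
  have PC1_J: "PC1 (scalar_fun J)"
  proof (rule C1_selection_imp_PC1_scalar)
    show "C1_selection J" unfolding J_eq W_def
      by (intro C1_selection_add C1_selection_mult C1_selection_compose[OF u_sel grad grad_cont] C1_selection_W
          C1_real_imp_selection C1_real_const)
    show "continuous_on UNIV J" unfolding J_eq W_def by (intro continuous_intros gu_cont continuous_W)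
  qed
  have PC1_r: "PC1 r"
  proof (rule C1_selection_imp_PC1)
    fix i
    have "((\<lambda>v. grad_g v $ i) has_derivative (\<lambda>h. hess_g v $ i \<bullet> h)) (at v)" for v
      using bounded_linear.has_derivative[OF bounded_linear_vec_nth hessian, of i v]
      by (simp add: matrix_vector_mul_component)
    moreover have "continuous_on UNIV (\<lambda>v. hess_g v $ i)"
      by (intro bounded_linear.continuous_on[OF bounded_linear_vec_nth] hessian_cont)
    ultimately have "C1_selection (\<lambda>\<xi>. grad_g (u \<xi>) $ i)"
      by (rule C1_selection_compose[OF u_sel])
    then have "C1_selection (\<lambda>\<xi>. A $ i + (1 / \<alpha>) * grad_g (u \<xi>) $ i - \<xi> $ i)"
      by (intro C1_selection_add C1_selection_diff C1_selection_mult C1_real_imp_selection[OF C1_real_const] C1_real_imp_selection[OF C1_real_nth])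
    then show "C1_selection (\<lambda>\<xi>. r \<xi> $ i)" by (simp add: r_eq)
  next
    show "continuous_on UNIV r" unfolding r_eq by (intro continuous_intros gu_cont)
  qed
  have clarke: "\<Theta> \<xi> \<in> clarke_jacobian u \<xi>
         \<and> (1 / \<alpha>) *\<^sub>R (hess_g (u \<xi>) ** \<Theta> \<xi>) - mat 1 \<in> clarke_jacobian r \<xi>
         \<and> rowvector ((2 *\<^sub>R (A - \<xi>)) v* \<Theta> \<xi>) \<in> clarke_jacobian (scalar_fun W) \<xi>
         \<and> rowvector ((\<alpha> *\<^sub>R r \<xi>) v* \<Theta> \<xi>) \<in> clarke_jacobian (scalar_fun J) \<xi>" for \<xi>
  proof -
    (* At all points X k the derivative of u is the same matrix, and u has the same value as at \<xi>. *)
    define X where "X k = bump \<xi> (inverse (real (Suc k)))" for k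
    have X: "X \<longlonglongrightarrow> \<xi>" unfolding X_def by (rule bump_tendsto)
    have uX: "u (X k) = u \<xi>" for k unfolding u_def X_def by (rule u_tilde_bump) simp
    have du: "(u has_derivative (\<lambda>h. \<Theta> \<xi> *v h)) (at (X k))" for k
      unfolding u_def X_def \<Theta>_def by (rule u_has_derivative) simp
    have dW: "(W has_derivative (\<lambda>h. ((2 *\<^sub>R (A - X k)) v* \<Theta> \<xi>) \<bullet> h)) (at (X k))" for k
      unfolding W_def A_def \<Theta>_def by (rule W_has_derivative[OF _ X_def]) simp
    have dgu: "((\<lambda>\<xi>. g (u \<xi>)) has_derivative (\<lambda>h. grad_g (u (X k)) \<bullet> (\<Theta> \<xi> *v h))) (at (X k))" for k
      by (rule has_derivative_compose[OF du grad])
    have dJ: "(J has_derivative (\<lambda>h. ((\<alpha> *\<^sub>R r (X k)) v* \<Theta> \<xi>) \<bullet> h)) (at (X k))" for k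
    proof -
      have "(J has_derivative (\<lambda>h. grad_g (u (X k)) \<bullet> (\<Theta> \<xi> *v h) + \<alpha> / 2 * (((2 *\<^sub>R (A - X k)) v* \<Theta> \<xi>) \<bullet> h))) (at (X k))"
        unfolding J_eq by (intro has_derivative_add dgu has_derivative_mult_right dW)
      moreover have "grad_g (u (X k)) \<bullet> y + \<alpha> / 2 * ((2 *\<^sub>R (A - X k)) \<bullet> y) = (\<alpha> *\<^sub>R r (X k)) \<bullet> y" for y
        using alpha_pos by (simp add: r_eq inner_add_left inner_diff_left algebra_simps)
      ultimately show ?thesis by (simp only: dot_lmul_matrix)
    qed
    have dr: "(r has_derivative (\<lambda>h. ((1 / \<alpha>) *\<^sub>R (hess_g (u \<xi>) ** \<Theta> \<xi>) - mat 1) *v h)) (at (X k))" for k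
    proof -
      have "((\<lambda>\<xi>. grad_g (u \<xi>)) has_derivative (\<lambda>h. hess_g (u (X k)) *v (\<Theta> \<xi> *v h))) (at (X k))"
        by (rule has_derivative_compose[OF du hessian])
      then have "(r has_derivative (\<lambda>h. 0 + (1 / \<alpha>) *\<^sub>R (hess_g (u (X k)) *v (\<Theta> \<xi> *v h)) - h)) (at (X k))"
        unfolding r_eq by (intro has_derivative_diff has_derivative_add has_derivative_const has_derivative_scaleR_right has_derivative_ident)
      moreover have "0 + (1 / \<alpha>) *\<^sub>R (hess_g (u (X k)) *v (\<Theta> \<xi> *v h)) - h =
          ((1 / \<alpha>) *\<^sub>R (hess_g (u \<xi>) ** \<Theta> \<xi>) - mat 1) *v h" for h
        by (simp add: uX matrix_vector_mult_diff_rdistrib matrix_vector_mul_assoc scaleR_matrix_vector_assoc)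
      ultimately show ?thesis by simp
    qed
    have r_lim: "(\<lambda>k. r (X k)) \<longlonglongrightarrow> r \<xi>" unfolding r_eq uX by (intro tendsto_intros X)
    show ?thesis
    proof (intro conjI)
      show "\<Theta> \<xi> \<in> clarke_jacobian u \<xi>" by (rule clarke_jacobianI[OF X du tendsto_const])
      show "(1 / \<alpha>) *\<^sub>R (hess_g (u \<xi>) ** \<Theta> \<xi>) - mat 1 \<in> clarke_jacobian r \<xi>"
        by (rule clarke_jacobianI[OF X dr tendsto_const])
      show "rowvector ((2 *\<^sub>R (A - \<xi>)) v* \<Theta> \<xi>) \<in> clarke_jacobian (scalar_fun W) \<xi>"
        by (rule clarke_jacobianI[OF X scalar_fun_has_derivative[OF dW]])
           (intro tendsto_rowvector_vector_matrix tendsto_intros X)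
      show "rowvector ((\<alpha> *\<^sub>R r \<xi>) v* \<Theta> \<xi>) \<in> clarke_jacobian (scalar_fun J) \<xi>"
        by (rule clarke_jacobianI[OF X scalar_fun_has_derivative[OF dJ]])
           (intro tendsto_rowvector_vector_matrix tendsto_intros r_lim)
    qed
  qed
  have finite_cost: "wasserstein2_sq D u\<^sub>d a (u \<xi>) < \<infinity>" for \<xi>
    unfolding u_def by (simp add: wasserstein2_sq_eq(1))
  note PC1_semismooth = conjI[OF _ PC1_imp_semismooth]
  show ?thesis
    by (rule conjI[OF allI[OF finite_cost] conjI[OF PC1_semismooth[OF PC1_J PC1_J] conjI[OF PC1_semismooth[OF PC1_r PC1_r]
          conjI[OF PC1_semismooth[OF PC1_u PC1_u] conjI[OF PC1_semismooth[OF PC1_W PC1_W] allI[OF clarke]]]]]])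
qed

end
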